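(* Let $(Y,H_\bullet)$ and $(X,G_\bullet)$ be finite connected graphs of finite groups, let $\phi:(Y,H_\bullet)\to(X,G_\bullet)$ be an $n$-sheeted covering of graphs of groups, and let $d_0$ be the entropy-minimizing length distance on $(X,G_\bullet)$ of volume one. Suppose that the degree at each vertex of $(X,G_\bullet)$ and of $(Y,H_\bullet)$ is at least three. Then for every length distance $d$ on $(Y,H_\bullet)$, $$h_{\mathrm{vol}}(Y,H_\bullet,d)\,\mathrm{vol}(Y,H_\bullet,d)\ \geq\ n\,h_{\mathrm{vol}}(X,G_\bullet,d_0)\,\mathrm{vol}(X,G_\bullet,d_0).$$ Equality holds if and only if $d$ is a length distance minimizing the volume entropy among the length distances on $(Y,H_\bullet)$ of the same volume as $d$, and in that case the map $\phi$ is a metric covering from $(Y,H_\bullet,d)$ to $(X,G_\bullet,\lambda d_0)$ for some $\lambda>0$.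
   Context: Graphs: $VX$ is the set of vertices of $X$ and $EX$ the set of oriented edges; each $e\in EX$ has an initial vertex $i(e)$, a terminal vertex $t(e)$ and a reversed edge $\bar e\neq e$ with $\bar{\bar e}=e$, $i(\bar e)=t(e)$. Loops and multiple edges are allowed. Graph of groups $(X,G_\bullet)$ (Bass–Serre): groups $G_x$ ($x\in VX$), groups $G_e=G_{\bar e}$ ($e\in EX$), and monomorphisms $\alpha_e:G_e\to G_{i(e)}$; here all groups are finite and the graphs are finite and connected. $T$ denotes a (Bass–Serre) universal covering tree of $(X,G_\bullet)$. The degree of a vertex $x$ is $\sum_{e\in EX,\ i(e)=x}|G_x|/|G_e|$ (the valency in $T$ of any lift of $x$). Length distances: a length distance $d_\ell$ on $(X,G_\bullet)$ is a length distance on the underlying graph $X$: given positive reals $\ell(e)=\ell(\bar e)$ for $e\in EX$, $d_\ell$ is the maximal distance on the geometric realization of $X$ which makes each half-edge of an edge $e$ containing a vertex isometric to $[0,\ell(e)/2]$ (so each edge $e$ has length $\ell(e)$). The volume is $\mathrm{vol}(X,G_\bullet,d_\ell)=\mathrm{vol}_\ell(X,G_\bullet)=\frac12\sum_{e\in EX}\frac{\ell(e)}{|G_e|}$. Volume entropy: $h_{\mathrm{vol}}(X,G_\bullet,d_\ell)=\limsup_{r\to\infty}\frac1r\log\ell(B(x_0,r))$, where $B(x_0,r)$ is the ball of radius $r$ centered at a fixed vertex $x_0$ of $T$ for the lifted length metric on $T$ (each edge of $T$ has the length of its image in $X$), and $\ell(S)$ denotes the sum of lengths of the (maximal pieces of)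 edges in a connected subset $S\subset T$. When all degrees of $(X,G_\bullet)$ are at least three, there is a unique length distance of volume one on $(X,G_\bullet)$ minimizing $h_{\mathrm{vol}}$ among those of volume one; this is the entropy-minimizing length distance $d_0$. The same definitions apply to $(Y,H_\bullet)$. Coverings (Bass): the path group $\Pi(X,G_\bullet)$ is generated by the groups $G_x$ and the elements $e\in EX$, subject to $\bar e=e^{-1}$ and $e\,\alpha_{\bar e}(s)\,e^{-1}=\alpha_e(s)$ for $s\in G_e$; $\pi_1(X,G_\bullet,x)$ is its subgroup of elements $g_0e_1g_1\cdots e_mg_m$ with $e_1\cdots e_m$ a closed path at $x$ and the $g_j$ in the corresponding vertex groups. A morphism $\phi=(\phi,\phi_\bullet,\gamma_\bullet):(Y,H_\bullet)\to(X,G_\bullet)$ consists of a graph morphism $\phi:Y\to X$, homomorphisms $\phi_y:H_y\to G_{\phi(y)}$ and $\phi_f=\phi_{\bar f}:H_f\to G_{\phi(f)}$, and elements $\gamma_y\in\pi_1(X,G_\bullet,\phi(y))$, $\gamma_f\in\Pi(X,G_\bullet)$ such that $\delta_f:=\gamma_{i(f)}^{-1}\gamma_f\in G_{\phi(i(f))}$ and $\phi_{i(f)}(\alpha_f(s))=\delta_f\,\alpha_{\phi(f)}(\phi_f(s))\,\delta_f^{-1}$ for all $f\in EY$, $s\in H_f$. It is a covering if all $\phi_y,\phi_f$ are injective and, for all $y\in VY$ and $e\in EX$ with $i(e)=\phi(y)$, the map $\bigsqcup_{f\in\phi^{-1}(e),\,i(f)=y}H_y/\alpha_f(H_f)\to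 G_{\phi(y)}/\alpha_e(G_e)$, $[h]_f\mapsto[\phi_y(h)\delta_f]$, is a bijection. For a covering, $n:=\sum_{y\in\phi^{-1}(x)}\frac{|G_x|}{|H_y|}=\sum_{f\in\phi^{-1}(e)}\frac{|G_e|}{|H_f|}$ is an integer independent of $x\in VX$ and $e\in EX$; the covering is then called $n$-sheeted. The covering $\phi$ is a metric covering from $(Y,H_\bullet,d_{\ell'})$ to $(X,G_\bullet,\lambda d_\ell)$ if $\ell'(f)=\lambda\,\ell(\phi(f))$ for every $f\in EY$. *)

theory Defs
  imports
    "HOL-Analysis.Analysis"
    "HOL-Algebra.Left_Coset"
    "Graph_Theory.Digraph_Component"
    "Graph_Theory.Bidirected_Digraph"
begin

section \<open>Graphs of groups\<close>

record ('v, 'e, 'a, 'b) graph_of_groups =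
  base :: "('v, 'e) pre_digraph"
  bar :: "'e \<Rightarrow> 'e"
  vgrp :: "'v \<Rightarrow> 'a monoid"
  egrp :: "'e \<Rightarrow> 'b monoid"
  emb :: "'e \<Rightarrow> 'b \<Rightarrow> 'a"

abbreviation vtx :: "('v, 'e, 'a, 'b) graph_of_groups \<Rightarrow> 'v set" where
  "vtx X \<equiv> verts (base X)"
abbreviation edg :: "('v, 'e, 'a, 'b) graph_of_groups \<Rightarrow> 'e set" where
  "edg X \<equiv> arcs (base X)"
abbreviation ini :: "('v, 'e, 'a, 'b) graph_of_groups \<Rightarrow> 'e \<Rightarrow> 'v" where
  "ini X \<equiv> tail (base X)"
abbreviation ter :: "('v, 'e, 'a, 'b) graph_of_groups \<Rightarrow> 'e \<Rightarrow> 'v" where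
  "ter X \<equiv> head (base X)"

text \<open>
  Since the arcs come in pairs of mutually reversed arcs, strong connectedness of the digraph
  is connectedness of the graph (and includes that there is a vertex).
\<close>

locale finite_graph_of_groups =
  fin_digraph "base X" + bidirected_digraph "base X" "bar X"
  for X :: "('v, 'e, 'a, 'b) graph_of_groups" +
  assumes conn: "strongly_connected (base X)"
    and vgrp_group: "x \<in> vtx X \<Longrightarrow> group (vgrp X x)"
    and vgrp_finite: "x \<in> vtx X \<Longrightarrow> finite (carrier (vgrp X x))"
    and egrp_group: "e \<in> edg X \<Longrightarrow> group (egrp X e)"
    and egrp_finite: "e \<in> edg X \<Longrightarrow> finite (carrier (egrp X e))"
    and egrp_bar: "e \<in> edg X \<Longrightarrow> egrp X (bar X e) = egrp X e"
    and emb_hom: "e \<in> edg X \<Longrightarrow> emb X e \<in> hom (egrp X e) (vgrp X (ini X e))"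
    and emb_inj: "e \<in> edg X \<Longrightarrow> inj_on (emb X e) (carrier (egrp X e))"

definition vertex_degree :: "('v, 'e, 'a, 'b) graph_of_groups \<Rightarrow> 'v \<Rightarrow> real" where
  "vertex_degree X x =
     (\<Sum>e | e \<in> edg X \<and> ini X e = x. real (order (vgrp X x)) / real (order (egrp X e)))"

section \<open>The path group\<close>

text \<open>
  The path group is given by its presentation: its elements are classes of words in the generators
  under the congruence generated by the relations. Formal inverses of generators are not needed,
  because every generator is inverted by another one.
\<close>

datatype ('v, 'e, 'a) letter = Elt 'v 'a | Edge 'e

definition letters :: "('v, 'e, 'a, 'b) graph_of_groups \<Rightarrow> ('v, 'e, 'a) letter set" where
  "letters X = {Elt x g | x g. x \<in> vtx X \<and> g \<in> carrier (vgrp X x)} \<union> Edge ` edg X"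

inductive path_eq ::
  "('v, 'e, 'a, 'b) graph_of_groups \<Rightarrow> ('v, 'e, 'a) letter list \<Rightarrow> ('v, 'e, 'a) letter list \<Rightarrow> bool"
  for X :: "('v, 'e, 'a, 'b) graph_of_groups" where
  refl: "u \<in> lists (letters X) \<Longrightarrow> path_eq X u u"
| sym: "path_eq X u v \<Longrightarrow> path_eq X v u"
| trans: "path_eq X u v \<Longrightarrow> path_eq X v w \<Longrightarrow> path_eq X u w"
| append: "path_eq X u v \<Longrightarrow> path_eq X u' v' \<Longrightarrow> path_eq X (u @ u') (v @ v')"
| vertex_one: "x \<in> vtx X \<Longrightarrow> path_eq X [Elt x \<one>\<^bsub>vgrp X x\<^esub>] []"
| vertex_mult: "x \<in> vtx X \<Longrightarrow> g \<in> carrier (vgrp X x) \<Longrightarrow> h \<in> carrier (vgrp X x) \<Longrightarrow>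
    path_eq X [Elt x g, Elt x h] [Elt x (g \<otimes>\<^bsub>vgrp X x\<^esub> h)]"
| edge_inv: "e \<in> edg X \<Longrightarrow> path_eq X [Edge e, Edge (bar X e)] []"
| edge_conj: "e \<in> edg X \<Longrightarrow> s \<in> carrier (egrp X e) \<Longrightarrow>
    path_eq X [Edge e, Elt (ter X e) (emb X (bar X e) s), Edge (bar X e)]
      [Elt (ini X e) (emb X e s)]"

definition path_class ::
  "('v, 'e, 'a, 'b) graph_of_groups \<Rightarrow> ('v, 'e, 'a) letter list \<Rightarrow> ('v, 'e, 'a) letter list set" where
  "path_class X w = {w'. path_eq X w w'}"

definition path_group ::
  "('v, 'e, 'a, 'b) graph_of_groups \<Rightarrow> ('v, 'e, 'a) letter list set monoid" where
  "path_group X =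
    \<lparr>carrier = path_class X ` lists (letters X),
     mult = (\<lambda>A B. \<Union>u\<in>A. \<Union>v\<in>B. path_class X (u @ v)),
     one = path_class X []\<rparr>"

definition vertex_elt ::
  "('v, 'e, 'a, 'b) graph_of_groups \<Rightarrow> 'v \<Rightarrow> 'a \<Rightarrow> ('v, 'e, 'a) letter list set" where
  "vertex_elt X x g = path_class X [Elt x g]"

definition edge_elt ::
  "('v, 'e, 'a, 'b) graph_of_groups \<Rightarrow> 'e \<Rightarrow> ('v, 'e, 'a) letter list set" where
  "edge_elt X e = path_class X [Edge e]"

lemma path_eq_lists:
  assumes "finite_graph_of_groups X" "path_eq X u v"
  shows "u \<in> lists (letters X) \<and> v \<in> lists (letters X)"
proof -
  interpret finite_graph_of_groups X by fact
  show ?thesis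
    using assms(2)
  proof induction
    case (edge_conj e s)
    then have "emb X e s \<in> carrier (vgrp X (ini X e))"
      using emb_hom by (auto simp: hom_def)
    moreover have "emb X (bar X e) s \<in> carrier (vgrp X (ter X e))"
      using edge_conj emb_hom[of "bar X e"] by (auto simp: hom_def egrp_bar)
    ultimately show ?case
      using edge_conj by (auto simp: letters_def)
  next
    case (vertex_mult x g h)
    then show ?case
      using vgrp_group[of x] by (auto simp: letters_def monoid.m_closed
          group.is_monoid)
  next
    case (vertex_one x)
    then show ?case
      using vgrp_group[of x] by (auto simp: letters_def monoid.one_closed group.is_monoid)
  qed (auto simp: letters_def)
qed

lemma path_class_eqI: "path_eq X u v \<Longrightarrow> path_class X u = path_class X v"
  unfolding path_class_def
  by (intro Collect_cong iffI) (erule path_eq.trans[OF path_eq.sym] path_eq.trans, assumption)+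

lemma path_class_mult:
  assumes "u \<in> lists (letters X)" "v \<in> lists (letters X)"
  shows "path_class X u \<otimes>\<^bsub>path_group X\<^esub> path_class X v = path_class X (u @ v)"
proof -
  have eq: "path_class X (u' @ v') = path_class X (u @ v)"
    if "u' \<in> path_class X u" "v' \<in> path_class X v" for u' v'
  proof -
    have "path_eq X (u @ v) (u' @ v')"
      using that by (auto simp: path_class_def intro: path_eq.append)
    then show ?thesis
      by (rule path_class_eqI[symmetric])
  qed
  have self: "u \<in> path_class X u" "v \<in> path_class X v"
    using assms by (simp_all only: path_class_def mem_Collect_eq path_eq.refl)
  have "(\<Union>u'\<in>path_class X u. \<Union>v'\<in>path_class X v. path_class X (u' @ v')) =
        (\<Union>u'\<in>path_class X u. \<Union>v'\<in>path_class X v. path_class X (u @ v))"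
    by (intro SUP_cong HOL.refl eq)
  also have "\<dots> = path_class X (u @ v)"
    using self by blast
  finally show ?thesis
    by (simp add: path_group_def)
qed

lemma letter_left_inverse:
  assumes "finite_graph_of_groups X" "a \<in> letters X"
  obtains b where "b \<in> letters X" "path_eq X [b, a] []"
proof -
  interpret finite_graph_of_groups X by fact
  show thesis
  proof (cases a)
    case (Elt x g)
    then have x: "x \<in> vtx X" and g: "g \<in> carrier (vgrp X x)"
      using assms(2) by (auto simp: letters_def)
    interpret G: group "vgrp X x"
      using x by (rule vgrp_group)
    let ?b = "Elt x (inv\<^bsub>vgrp X x\<^esub> g)"
    have "path_eq X [?b, a] [Elt x (inv\<^bsub>vgrp X x\<^esub> g \<otimes>\<^bsub>vgrp X x\<^esub> g)]"
      unfolding Elt using x g by (intro path_eq.vertex_mult) auto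
    also have "inv\<^bsub>vgrp X x\<^esub> g \<otimes>\<^bsub>vgrp X x\<^esub> g = \<one>\<^bsub>vgrp X x\<^esub>"
      using g by simp
    finally have "path_eq X [?b, a] []"
      by (rule path_eq.trans) (rule path_eq.vertex_one[OF x])
    moreover have "?b \<in> letters X"
      using x g by (auto simp: letters_def)
    ultimately show thesis
      using that by blast
  next
    case (Edge e)
    then have "e \<in> edg X"
      using assms(2) by (auto simp: letters_def)
    then have "path_eq X [Edge (bar X e), a] []" "Edge (bar X e) \<in> letters X"
      using path_eq.edge_inv[of "bar X e" X] Edge by (auto simp: letters_def)
    then show thesis
      using that by blast
  qed
qed

lemma word_left_inverse:
  assumes "finite_graph_of_groups X" "u \<in> lists (letters X)"
  shows "\<exists>v\<in>lists (letters X). path_eq X (v @ u) []"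
  using assms(2)
proof (induction u)
  case Nil
  show ?case
    by (rule bexI[of _ "[]"]) (auto intro: path_eq.refl)
next
  case (Cons a u)
  obtain b where b: "b \<in> letters X" "path_eq X [b, a] []"
    using assms(1) Cons.hyps(1) by (rule letter_left_inverse)
  obtain v where v: "v \<in> lists (letters X)" "path_eq X (v @ u) []"
    using Cons.IH by blast
  have "path_eq X ([b, a] @ u) ([] @ u)"
    by (rule path_eq.append[OF b(2) path_eq.refl[OF Cons.hyps(2)]])
  then have "path_eq X (v @ ([b, a] @ u)) (v @ ([] @ u))"
    by (rule path_eq.append[OF path_eq.refl[OF v(1)]])
  then have "path_eq X (v @ ([b, a] @ u)) []"
    by (rule path_eq.trans) (use v(2) in simp)
  then show ?case
    using v b by (intro bexI[of _ "v @ [b]"]) simp_all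
qed

lemma group_path_group:
  assumes "finite_graph_of_groups X"
  shows "group (path_group X)"
proof -
  let ?P = "path_group X" and ?L = "lists (letters X)"
  have carrier: "carrier ?P = path_class X ` ?L" and one: "\<one>\<^bsub>?P\<^esub> = path_class X []"
    by (auto simp: path_group_def)
  have nil: "[] \<in> ?L"
    by simp
  have app: "u @ v \<in> ?L" if "u \<in> ?L" "v \<in> ?L" for u v
    using that by simp
  have obt: "\<exists>u\<in>?L. p = path_class X u" if "p \<in> carrier ?P" for p
    using that unfolding carrier by blast
  show ?thesis
  proof (rule groupI)
    fix p q assume "p \<in> carrier ?P" "q \<in> carrier ?P"
    from obt[OF this(1)] obt[OF this(2)]
    obtain u v where u: "u \<in> ?L" "p = path_class X u" and v: "v \<in> ?L" "q = path_class X v"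
      by blast
    have "p \<otimes>\<^bsub>?P\<^esub> q = path_class X (u @ v)"
      unfolding u v by (rule path_class_mult[OF u(1) v(1)])
    then show "p \<otimes>\<^bsub>?P\<^esub> q \<in> carrier ?P"
      unfolding carrier using app[OF u(1) v(1)] by (rule image_eqI)
  next
    show "\<one>\<^bsub>?P\<^esub> \<in> carrier ?P"
      unfolding carrier one using nil by (rule imageI)
  next
    fix p q r assume "p \<in> carrier ?P" "q \<in> carrier ?P" "r \<in> carrier ?P"
    from obt[OF this(1)] obt[OF this(2)] obt[OF this(3)]
    obtain u v w where u: "u \<in> ?L" "p = path_class X u" and v: "v \<in> ?L" "q = path_class X v"
        and w: "w \<in> ?L" "r = path_class X w"
      by blast
    show "p \<otimes>\<^bsub>?P\<^esub> q \<otimes>\<^bsub>?P\<^esub> r = p \<otimes>\<^bsub>?P\<^esub> (q \<otimes>\<^bsub>?P\<^esub> r)"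
      unfolding u v w path_class_mult[OF u(1) v(1)] path_class_mult[OF v(1) w(1)]
        path_class_mult[OF app[OF u(1) v(1)] w(1)] path_class_mult[OF u(1) app[OF v(1) w(1)]]
        append_assoc ..
  next
    fix p assume "p \<in> carrier ?P"
    from obt[OF this] obtain u where u: "u \<in> ?L" "p = path_class X u"
      by blast
    show "\<one>\<^bsub>?P\<^esub> \<otimes>\<^bsub>?P\<^esub> p = p"
      unfolding one u path_class_mult[OF nil u(1)] append_Nil ..
    obtain v where v: "v \<in> ?L" "path_eq X (v @ u) []"
      using word_left_inverse[OF assms u(1)] by blast
    have "path_class X v \<otimes>\<^bsub>?P\<^esub> p = \<one>\<^bsub>?P\<^esub>"
      unfolding one u path_class_mult[OF v(1) u(1)] using v(2) by (rule path_class_eqI)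
    moreover have "path_class X v \<in> carrier ?P"
      unfolding carrier using v(1) by (rule imageI)
    ultimately show "\<exists>q\<in>carrier ?P. q \<otimes>\<^bsub>?P\<^esub> p = \<one>\<^bsub>?P\<^esub>" ..
  qed
qed

inductive path_word ::
  "('v, 'e, 'a, 'b) graph_of_groups \<Rightarrow> 'v \<Rightarrow> ('v, 'e, 'a) letter list \<Rightarrow> 'v \<Rightarrow> bool"
  for X :: "('v, 'e, 'a, 'b) graph_of_groups" and x :: 'v where
  start: "x \<in> vtx X \<Longrightarrow> g \<in> carrier (vgrp X x) \<Longrightarrow> path_word X x [Elt x g] x"
| step: "path_word X x w (ini X e) \<Longrightarrow> e \<in> edg X \<Longrightarrow> g \<in> carrier (vgrp X (ter X e)) \<Longrightarrow>
    path_word X x (w @ [Edge e, Elt (ter X e) g]) (ter X e)"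

definition path_elts ::
  "('v, 'e, 'a, 'b) graph_of_groups \<Rightarrow> 'v \<Rightarrow> 'v \<Rightarrow> ('v, 'e, 'a) letter list set set" where
  "path_elts X x y = path_class X ` {w. path_word X x w y}"

definition fund_group ::
  "('v, 'e, 'a, 'b) graph_of_groups \<Rightarrow> 'v \<Rightarrow> ('v, 'e, 'a) letter list set set" where
  "fund_group X x = path_elts X x x"

section \<open>The Bass--Serre tree\<close>

text \<open>
  Over a vertex \<open>x\<close> lie the cosets \<open>p G\<^sub>x\<close> and over an edge \<open>e\<close> the cosets
  \<open>p \<alpha>\<^sub>e(G\<^sub>e)\<close>, with \<open>p\<close> a path from the base vertex \<open>b\<close> to \<open>x\<close>, resp. to \<open>i(e)\<close>. The edge
  \<open>p \<alpha>\<^sub>e(G\<^sub>e)\<close> leads from \<open>p G\<^bsub>i(e)\<^esub>\<close> to \<open>p e G\<^bsub>t(e)\<^esub>\<close>, and its reverse is the coset of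
  \<open>p e\<close>, which is \<open>p \<alpha>\<^sub>e(G\<^sub>e) e\<close>. The projection to the graph is \<open>fst\<close>.
\<close>

definition vertex_subgroup ::
  "('v, 'e, 'a, 'b) graph_of_groups \<Rightarrow> 'v \<Rightarrow> ('v, 'e, 'a) letter list set set" where
  "vertex_subgroup X x = vertex_elt X x ` carrier (vgrp X x)"

definition edge_subgroup ::
  "('v, 'e, 'a, 'b) graph_of_groups \<Rightarrow> 'e \<Rightarrow> ('v, 'e, 'a) letter list set set" where
  "edge_subgroup X e = (\<lambda>s. vertex_elt X (ini X e) (emb X e s)) ` carrier (egrp X e)"

definition bs_tree :: "('v, 'e, 'a, 'b) graph_of_groups \<Rightarrow> 'v \<Rightarrow>
  ('v \<times> ('v, 'e, 'a) letter list set set, 'e \<times> ('v, 'e, 'a) letter list set set) pre_digraph" where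
  "bs_tree X b =
    \<lparr>verts = (SIGMA x:vtx X. (\<lambda>p. p <#\<^bsub>path_group X\<^esub> vertex_subgroup X x) ` path_elts X b x),
     arcs = (SIGMA e:edg X. (\<lambda>p. p <#\<^bsub>path_group X\<^esub> edge_subgroup X e) ` path_elts X b (ini X e)),
     tail = (\<lambda>(e, C). (ini X e, C <#>\<^bsub>path_group X\<^esub> vertex_subgroup X (ini X e))),
     head = (\<lambda>(e, C). (ter X e,
       (C #>\<^bsub>path_group X\<^esub> edge_elt X e) <#>\<^bsub>path_group X\<^esub> vertex_subgroup X (ter X e)))\<rparr>"

definition bs_bar :: "('v, 'e, 'a, 'b) graph_of_groups \<Rightarrow> 'v \<Rightarrow>
  'e \<times> ('v, 'e, 'a) letter list set set \<Rightarrow> 'e \<times> ('v, 'e, 'a) letter list set set" where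
  "bs_bar X b a = (if a \<in> arcs (bs_tree X b)
     then (bar X (fst a), snd a #>\<^bsub>path_group X\<^esub> edge_elt X (fst a)) else a)"

section \<open>Length distances, volume and entropy\<close>

text \<open>
  In this section a graph is a digraph \<open>D\<close> together with the reversal \<open>r\<close> of its arcs, and \<open>l\<close>
  gives the lengths of the arcs. An interior point of an edge is the set of its two coordinates,
  one for each orientation; \<open>edge_point\<close> parametrizes an edge by its length.
\<close>

datatype ('v, 'e) point = Vertex 'v | Inner "('e \<times> real) set"

definition edge_point ::
  "('v, 'e) pre_digraph \<Rightarrow> ('e \<Rightarrow> 'e) \<Rightarrow> ('e \<Rightarrow> real) \<Rightarrow> 'e \<Rightarrow> real \<Rightarrow> ('v, 'e) point" where
  "edge_point D r l e s =
     (if s = 0 then Vertex (tail D e)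
      else if s = l e then Vertex (head D e)
      else Inner {(e, s), (r e, l e - s)})"

definition realization ::
  "('v, 'e) pre_digraph \<Rightarrow> ('e \<Rightarrow> 'e) \<Rightarrow> ('e \<Rightarrow> real) \<Rightarrow> ('v, 'e) point set" where
  "realization D r l = Vertex ` verts D \<union> (\<Union>e\<in>arcs D. edge_point D r l e ` {0..l e})"

definition half_edge_isometric ::
  "('v, 'e) pre_digraph \<Rightarrow> ('e \<Rightarrow> 'e) \<Rightarrow> ('e \<Rightarrow> real) \<Rightarrow>
   (('v, 'e) point \<Rightarrow> ('v, 'e) point \<Rightarrow> real) \<Rightarrow> bool" where
  "half_edge_isometric D r l d \<longleftrightarrow>
     (\<forall>e\<in>arcs D. \<forall>s\<in>{0..l e / 2}. \<forall>t\<in>{0..l e / 2}.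
        d (edge_point D r l e s) (edge_point D r l e t) = \<bar>s - t\<bar>)"

definition length_distance ::
  "('v, 'e) pre_digraph \<Rightarrow> ('e \<Rightarrow> 'e) \<Rightarrow> ('e \<Rightarrow> real) \<Rightarrow>
   ('v, 'e) point \<Rightarrow> ('v, 'e) point \<Rightarrow> real" where
  "length_distance D r l p q =
     (if p \<in> realization D r l \<and> q \<in> realization D r l
      then SUP d\<in>{d. Metric_space (realization D r l) d \<and> half_edge_isometric D r l d}. d p q
      else 0)"

definition edges_length_in ::
  "('v, 'e) pre_digraph \<Rightarrow> ('e \<Rightarrow> 'e) \<Rightarrow> ('e \<Rightarrow> real) \<Rightarrow> ('v, 'e) point set \<Rightarrow> real" where
  "edges_length_in D r l S =
     (\<Sum>\<^sub>\<infinity>e\<in>arcs D. measure lborel {s \<in> {0..l e}. edge_point D r l e s \<in> S}) / 2"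

definition length_function :: "('v, 'e, 'a, 'b) graph_of_groups \<Rightarrow> ('e \<Rightarrow> real) \<Rightarrow> bool" where
  "length_function X l \<longleftrightarrow> (\<forall>e\<in>edg X. l e > 0 \<and> l (bar X e) = l e)"

definition gog_volume :: "('v, 'e, 'a, 'b) graph_of_groups \<Rightarrow> ('e \<Rightarrow> real) \<Rightarrow> real" where
  "gog_volume X l = (\<Sum>e\<in>edg X. l e / real (order (egrp X e))) / 2"

definition tree_ball_length :: "('v, 'e, 'a, 'b) graph_of_groups \<Rightarrow> 'v \<Rightarrow>
  'v \<times> ('v, 'e, 'a) letter list set set \<Rightarrow> ('e \<Rightarrow> real) \<Rightarrow> real \<Rightarrow> real" where
  "tree_ball_length X b v l \<rho> =
     (let T = bs_tree X b; r = bs_bar X b; l' = l \<circ> fst in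
      edges_length_in T r l'
        (Metric_space.mcball (realization T r l') (length_distance T r l') (Vertex v) \<rho>))"

text \<open>
  The tree depends on a base vertex \<open>b\<close>, and the balls are centred at a vertex \<open>v\<close> of the tree.
  The entropy does not depend on these choices.
\<close>

definition volume_entropy :: "('v, 'e, 'a, 'b) graph_of_groups \<Rightarrow> 'v \<Rightarrow>
  'v \<times> ('v, 'e, 'a) letter list set set \<Rightarrow> ('e \<Rightarrow> real) \<Rightarrow> ereal" where
  "volume_entropy X b v l =
     Limsup at_top (\<lambda>\<rho>. ereal (1 / \<rho> * ln (tree_ball_length X b v l \<rho>)))"

definition entropy_minimizing :: "('v, 'e, 'a, 'b) graph_of_groups \<Rightarrow> 'v \<Rightarrow>
  'v \<times> ('v, 'e, 'a) letter list set set \<Rightarrow> ('e \<Rightarrow> real) \<Rightarrow> bool" where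
  "entropy_minimizing X b v l \<longleftrightarrow> length_function X l \<and>
     (\<forall>l'. length_function X l' \<and> gog_volume X l' = gog_volume X l \<longrightarrow>
        volume_entropy X b v l \<le> volume_entropy X b v l')"

section \<open>Coverings\<close>

record ('w, 'f, 'c, 'd, 'v, 'e, 'a, 'b) gog_morphism =
  vmap :: "'w \<Rightarrow> 'v"
  emap :: "'f \<Rightarrow> 'e"
  vhom :: "'w \<Rightarrow> 'c \<Rightarrow> 'a"
  ehom :: "'f \<Rightarrow> 'd \<Rightarrow> 'b"
  vgam :: "'w \<Rightarrow> ('v, 'e, 'a) letter list set"
  egam :: "'f \<Rightarrow> ('v, 'e, 'a) letter list set"

text \<open>
  \<open>delta_path\<close> is the element \<open>\<delta>\<^sub>f\<close> of the path group, \<open>delta\<close> the element of the vertex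
  group that it is required to come from. (Vertex groups embed into the path group.)
\<close>

definition delta_path :: "('w, 'f, 'c, 'd) graph_of_groups \<Rightarrow> ('v, 'e, 'a, 'b) graph_of_groups \<Rightarrow>
  ('w, 'f, 'c, 'd, 'v, 'e, 'a, 'b) gog_morphism \<Rightarrow> 'f \<Rightarrow> ('v, 'e, 'a) letter list set" where
  "delta_path Y X \<phi> f = inv\<^bsub>path_group X\<^esub> vgam \<phi> (ini Y f) \<otimes>\<^bsub>path_group X\<^esub> egam \<phi> f"

definition delta :: "('w, 'f, 'c, 'd) graph_of_groups \<Rightarrow> ('v, 'e, 'a, 'b) graph_of_groups \<Rightarrow>
  ('w, 'f, 'c, 'd, 'v, 'e, 'a, 'b) gog_morphism \<Rightarrow> 'f \<Rightarrow> 'a" where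
  "delta Y X \<phi> f = (let x = vmap \<phi> (ini Y f) in
     inv_into (carrier (vgrp X x)) (vertex_elt X x) (delta_path Y X \<phi> f))"

definition graph_morphism :: "('w, 'f, 'c, 'd) graph_of_groups \<Rightarrow> ('v, 'e, 'a, 'b) graph_of_groups \<Rightarrow>
  ('w \<Rightarrow> 'v) \<Rightarrow> ('f \<Rightarrow> 'e) \<Rightarrow> bool" where
  "graph_morphism Y X p q \<longleftrightarrow>
     (\<forall>y\<in>vtx Y. p y \<in> vtx X) \<and>
     (\<forall>f\<in>edg Y. q f \<in> edg X \<and> ini X (q f) = p (ini Y f) \<and> ter X (q f) = p (ter Y f) \<and>
        q (bar Y f) = bar X (q f))"

definition gog_morph :: "('w, 'f, 'c, 'd) graph_of_groups \<Rightarrow> ('v, 'e, 'a, 'b) graph_of_groups \<Rightarrow>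
  ('w, 'f, 'c, 'd, 'v, 'e, 'a, 'b) gog_morphism \<Rightarrow> bool" where
  "gog_morph Y X \<phi> \<longleftrightarrow>
     graph_morphism Y X (vmap \<phi>) (emap \<phi>) \<and>
     (\<forall>y\<in>vtx Y. vhom \<phi> y \<in> hom (vgrp Y y) (vgrp X (vmap \<phi> y)) \<and>
        vgam \<phi> y \<in> fund_group X (vmap \<phi> y)) \<and>
     (\<forall>f\<in>edg Y. ehom \<phi> f \<in> hom (egrp Y f) (egrp X (emap \<phi> f)) \<and>
        (\<forall>s\<in>carrier (egrp Y f). ehom \<phi> (bar Y f) s = ehom \<phi> f s) \<and>
        egam \<phi> f \<in> carrier (path_group X) \<and>
        delta_path Y X \<phi> f \<in> vertex_subgroup X (vmap \<phi> (ini Y f)) \<and>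
        (let G = vgrp X (vmap \<phi> (ini Y f)) in
          \<forall>s\<in>carrier (egrp Y f). vhom \<phi> (ini Y f) (emb Y f s) =
            delta Y X \<phi> f \<otimes>\<^bsub>G\<^esub> emb X (emap \<phi> f) (ehom \<phi> f s) \<otimes>\<^bsub>G\<^esub> inv\<^bsub>G\<^esub> delta Y X \<phi> f))"

text \<open>
  \<open>fibre_map Y X \<phi> y e\<close> sends the coset \<open>C = h \<alpha>\<^sub>f(H\<^sub>f)\<close> to \<open>\<phi>\<^sub>y(h) \<delta>\<^sub>f \<alpha>\<^sub>e(G\<^sub>e)\<close>; the latter coset
  is the same for all \<open>h \<in> C\<close>, so it is their union.
\<close>

definition fibre_map :: "('w, 'f, 'c, 'd) graph_of_groups \<Rightarrow> ('v, 'e, 'a, 'b) graph_of_groups \<Rightarrow>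
  ('w, 'f, 'c, 'd, 'v, 'e, 'a, 'b) gog_morphism \<Rightarrow> 'w \<Rightarrow> 'e \<Rightarrow> 'f \<times> 'c set \<Rightarrow> 'a set" where
  "fibre_map Y X \<phi> y e = (\<lambda>(f, C). let G = vgrp X (vmap \<phi> y) in
     \<Union>h\<in>C. (vhom \<phi> y h \<otimes>\<^bsub>G\<^esub> delta Y X \<phi> f) <#\<^bsub>G\<^esub> (emb X e ` carrier (egrp X e)))"

definition covering :: "('w, 'f, 'c, 'd) graph_of_groups \<Rightarrow> ('v, 'e, 'a, 'b) graph_of_groups \<Rightarrow>
  ('w, 'f, 'c, 'd, 'v, 'e, 'a, 'b) gog_morphism \<Rightarrow> bool" where
  "covering Y X \<phi> \<longleftrightarrow> gog_morph Y X \<phi> \<and>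
     (\<forall>y\<in>vtx Y. inj_on (vhom \<phi> y) (carrier (vgrp Y y))) \<and>
     (\<forall>f\<in>edg Y. inj_on (ehom \<phi> f) (carrier (egrp Y f))) \<and>
     (\<forall>y\<in>vtx Y. \<forall>e\<in>edg X. ini X e = vmap \<phi> y \<longrightarrow>
        bij_betw (fibre_map Y X \<phi> y e)
          (SIGMA f:{f \<in> edg Y. emap \<phi> f = e \<and> ini Y f = y}.
             lcosets\<^bsub>vgrp Y y\<^esub> (emb Y f ` carrier (egrp Y f)))
          (lcosets\<^bsub>vgrp X (vmap \<phi> y)\<^esub> (emb X e ` carrier (egrp X e))))"

definition sheeted_covering :: "nat \<Rightarrow> ('w, 'f, 'c, 'd) graph_of_groups \<Rightarrow>
  ('v, 'e, 'a, 'b) graph_of_groups \<Rightarrow> ('w, 'f, 'c, 'd, 'v, 'e, 'a, 'b) gog_morphism \<Rightarrow> bool" where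
  "sheeted_covering n Y X \<phi> \<longleftrightarrow> covering Y X \<phi> \<and>
     (\<forall>x\<in>vtx X. (\<Sum>y | y \<in> vtx Y \<and> vmap \<phi> y = x.
        real (order (vgrp X x)) / real (order (vgrp Y y))) = real n) \<and>
     (\<forall>e\<in>edg X. (\<Sum>f | f \<in> edg Y \<and> emap \<phi> f = e.
        real (order (egrp X e)) / real (order (egrp Y f))) = real n)"

text \<open>A covering \<open>\<phi>\<close> that is metric from \<open>(Y, l')\<close> to \<open>(X, \<lambda> l)\<close>.\<close>

definition metric_covering :: "('w, 'f, 'c, 'd) graph_of_groups \<Rightarrow> ('f \<Rightarrow> real) \<Rightarrow>
  ('v, 'e, 'a, 'b) graph_of_groups \<Rightarrow> ('e \<Rightarrow> real) \<Rightarrow>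
  ('w, 'f, 'c, 'd, 'v, 'e, 'a, 'b) gog_morphism \<Rightarrow> bool" where
  "metric_covering Y l' X l \<phi> \<longleftrightarrow> covering Y X \<phi> \<and> (\<forall>f\<in>edg Y. l' f = l (emap \<phi> f))"

end

theory Submission
  imports Defs "HOL-Real_Asymp.Real_Asymp"
begin

text \<open>
  Everything follows from a sharp lower bound for one graph of groups \<open>X\<close> all of whose degrees
  are at least three. Write \<open>q\<^sub>x\<close> for the degree of \<open>x\<close> minus one, the number of ways of continuing
  a path of the tree that arrives over \<open>x\<close> without turning back, and put
  \<open>H(X) = 1/2 \<Sum>\<^sub>e ln q\<^bsub>t(e)\<^esub> / |G\<^sub>e|\<close>. Then \<open>h\<^sub>v\<^sub>o\<^sub>l(\<ell>) vol(\<ell>) \<ge> H(X)\<close> for every length function \<open>\<ell>\<close>, with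
  equality exactly when \<open>\<ell>(e)\<close> is proportional to \<open>ln (q\<^bsub>i(e)\<^esub> q\<^bsub>t(e)\<^esub>)\<close>. So an entropy-minimizing length
  distance is one with \<open>h vol = H\<close>. A covering preserves degrees, because its local bijections match
  the edges of the two trees at corresponding vertices, and the edges over \<open>e\<close> have total mass
  \<open>\<Sum>\<^sub>f 1/|H\<^sub>f| = n/|G\<^sub>e|\<close>. Hence \<open>H(Y) = n H(X)\<close> (\<open>minimal_product_lift\<close>), and the optimal length
  function of \<open>Y\<close> is the pullback of that of \<open>X\<close>; this gives the inequality, the case of equality and
  the metric covering.

  The lower bound is an entropy argument. Let \<open>A(e,f)\<close> be the number of non-backtracking
  continuations over \<open>f\<close> of an edge over \<open>e\<close>. For \<open>s > h\<^sub>v\<^sub>o\<^sub>l\<close> the Poincare series \<open>\<Sum> exp (- s d(v,u))\<close>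
  over the vertices \<open>u\<close> of the tree converges. Summed along branches it yields a function \<open>x > 0\<close> on
  the edges of \<open>X\<close> with \<open>\<Sum>\<^sub>f A(e,f) exp (- s \<ell>(f)) x\<^sub>f \<le> x\<^sub>e\<close> (\<open>superharmonic_above_entropy\<close>). The walk
  that chooses each of the \<open>q\<close> continuations with equal probability has the stationary measure
  \<open>1/|G\<^sub>e|\<close>. Put \<open>t\<^sub>e\<^sub>f = ln x\<^sub>f - s \<ell>(f) - ln x\<^sub>e + ln q\<^bsub>t(e)\<^esub>\<close>; by superharmonicity the mean of \<open>exp t\<^sub>e\<^sub>f\<close> is at
  most one, while by stationarity the integral of \<open>t\<^sub>e\<^sub>f\<close> is \<open>2 H - 2 s vol\<close>. Since \<open>1 + t \<le> exp t\<close>, this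
  forces \<open>s vol \<ge> H\<close>; more precisely the integral of \<open>exp t - 1 - t \<ge> 0\<close> is at most \<open>2 (s vol - H)\<close>
  (\<open>log_defect_sum\<close>). If \<open>h vol = H\<close>, let \<open>s\<close> decrease to \<open>h\<close>: all \<open>t\<^sub>e\<^sub>f\<close> become arbitrarily small, and
  adding them along a few turns at the two ends of an edge eliminates \<open>x\<close> and determines \<open>\<ell>\<close>
  (\<open>rigidity\<close>). Conversely, for \<open>\<ell>(e) = 1/2 ln (q\<^bsub>i(e)\<^esub> q\<^bsub>t(e)\<^esub>)\<close> and \<open>s = 1\<close> the function \<open>x\<^sub>e = sqrt q\<^bsub>t(e)\<^esub>\<close>
  satisfies the inequality with equality, which bounds the number of vertices of the tree at
  distance at most \<open>\<rho>\<close> by \<open>exp \<rho>\<close> times a linear factor (\<open>entropy_upper_bound\<close>).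

  To count in the tree, it must be known to be a tree. Its vertices are cosets in a group given by
  a presentation, and \<open>normal_form_unique\<close> says that every path has a unique expression by coset
  representatives and edges without backtracking. This follows by letting the words act on the
  normal forms (\<open>run_path_eq\<close>). The vertices then correspond to the normal forms from the centre of
  the balls, and an embedding of the tree into an \<open>\<ell>\<^sup>1\<close> space shows that the length distance
  from the centre is the length of the path (\<open>length_dist_root_ept\<close>).
\<close>

section \<open>The flow of non-backtracking edge pairs\<close>

context finite_graph_of_groups
begin

text \<open>
  The number of edges over \<open>e\<close> that issue from a given vertex of the tree over \<open>i(e)\<close>.
\<close>

definition lifts :: "'e \<Rightarrow> real" where
  "lifts e = real (order (vgrp X (ini X e))) / real (order (egrp X e))"

definition branching :: "'v \<Rightarrow> real" where
  "branching x = vertex_degree X x - 1"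

text \<open>
  The number of edges over \<open>f\<close> by which a path of the tree arriving along an edge over \<open>e\<close> can
  continue; the reverse of the arriving edge is one of the edges over \<open>bar e\<close>.
\<close>

definition succ_weight :: "'e \<Rightarrow> 'e \<Rightarrow> real" where
  "succ_weight e f =
     (if ter X e = ini X f then lifts f - (if f = bar X e then 1 else 0) else 0)"

definition mass :: "'e \<Rightarrow> real" where
  "mass e = 1 / real (order (egrp X e))"

text \<open>
  The value of entropy times volume that every length function exceeds, except for the multiples of
  \<open>optimal_length\<close> below, which attain it.
\<close>

definition minimal_product :: real where
  "minimal_product = (\<Sum>e\<in>edg X. mass e * ln (branching (ter X e))) / 2"

text \<open>
  The transfer operator of the walk with weights \<open>exp (- s l(f))\<close>: its \<open>m\<close>-th power applied to the
  constant 1 sums \<open>exp (- s \<cdot>)\<close> of the lengths of the non-backtracking continuations by \<open>m\<close> edges.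
\<close>

definition transfer :: "('e \<Rightarrow> real) \<Rightarrow> real \<Rightarrow> ('e \<Rightarrow> real) \<Rightarrow> 'e \<Rightarrow> real" where
  "transfer l s u e = (\<Sum>f\<in>edg X. succ_weight e f * exp (- s * l f) * u f)"

lemma bar_edge [simp]: "e \<in> edg X \<Longrightarrow> bar X e \<in> edg X"
  by simp

lemma finite_edges [simp]: "finite (edg X)"
  by (rule finite_arcs)

lemma order_egrp_pos: "e \<in> edg X \<Longrightarrow> order (egrp X e) > 0"
  using egrp_group egrp_finite by (simp add: group.is_monoid monoid.order_gt_0_iff_finite)

lemma order_vgrp_pos: "x \<in> vtx X \<Longrightarrow> order (vgrp X x) > 0"
  using vgrp_group vgrp_finite by (simp add: group.is_monoid monoid.order_gt_0_iff_finite)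

lemma emb_subgroup:
  assumes "e \<in> edg X"
  shows "subgroup (emb X e ` carrier (egrp X e)) (vgrp X (ini X e))"
proof -
  interpret group_hom "egrp X e" "vgrp X (ini X e)" "emb X e"
    using assms by (intro group_hom.intro group_hom_axioms.intro egrp_group vgrp_group emb_hom) auto
  show ?thesis by (rule img_is_subgroup)
qed

lemma card_emb_image: "e \<in> edg X \<Longrightarrow> card (emb X e ` carrier (egrp X e)) = order (egrp X e)"
  by (simp add: card_image emb_inj order_def)

lemma lifts_eq_index:
  assumes "e \<in> edg X"
  shows "lifts e = real (card (lcosets\<^bsub>vgrp X (ini X e)\<^esub> (emb X e ` carrier (egrp X e))))"
proof -
  interpret G: group "vgrp X (ini X e)" using assms by (intro vgrp_group) auto
  let ?c = "card (lcosets\<^bsub>vgrp X (ini X e)\<^esub> (emb X e ` carrier (egrp X e)))"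
  have "?c * order (egrp X e) = order (vgrp X (ini X e))"
    using G.l_lagrange[OF vgrp_finite emb_subgroup[OF assms]] assms by (simp add: card_emb_image)
  then have "real ?c * real (order (egrp X e)) = real (order (vgrp X (ini X e)))"
    by (simp only: of_nat_mult[symmetric])
  moreover have "real (order (egrp X e)) \<noteq> 0" using order_egrp_pos[OF assms] by simp
  ultimately show ?thesis unfolding lifts_def by (subst nonzero_divide_eq_eq) simp_all
qed

lemma lifts_ge_1:
  assumes "e \<in> edg X"
  shows "lifts e \<ge> 1"
proof -
  obtain k :: nat where "lifts e = real k" using lifts_eq_index[OF assms] by blast
  moreover have "lifts e > 0"
    unfolding lifts_def using assms order_egrp_pos order_vgrp_pos by auto
  ultimately show ?thesis by simp
qed

lemma mass_pos: "e \<in> edg X \<Longrightarrow> mass e > 0"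
  unfolding mass_def using order_egrp_pos by simp

lemma mass_bar: "e \<in> edg X \<Longrightarrow> mass (bar X e) = mass e"
  unfolding mass_def by (simp add: egrp_bar)

lemma succ_weight_nonneg: "e \<in> edg X \<Longrightarrow> f \<in> edg X \<Longrightarrow> succ_weight e f \<ge> 0"
  using lifts_ge_1[of f] by (auto simp: succ_weight_def)

lemma sum_out_edges:
  "(\<Sum>f\<in>edg X. if ini X f = x then g f else 0) = (\<Sum>f | f \<in> edg X \<and> ini X f = x. (g f :: real))"
  by (subst sum.inter_filter [symmetric]) auto

lemma degree_eq_sum_lifts: "vertex_degree X x = (\<Sum>f | f \<in> edg X \<and> ini X f = x. lifts f)"
  unfolding vertex_degree_def lifts_def by (intro sum.cong) auto

lemma sum_succ_weight:
  assumes e: "e \<in> edg X"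
  shows "(\<Sum>f\<in>edg X. succ_weight e f) = branching (ter X e)"
proof -
  have "(\<Sum>f\<in>edg X. succ_weight e f) =
      (\<Sum>f\<in>edg X. (if ini X f = ter X e then lifts f else 0) - (if f = bar X e then 1 else 0))"
    using e by (intro sum.cong) (auto simp: succ_weight_def)
  also have "\<dots> = vertex_degree X (ter X e) - 1"
    using e by (simp add: sum_subtractf sum_out_edges degree_eq_sum_lifts)
  finally show ?thesis by (simp add: branching_def)
qed

text \<open>
  The mass \<open>1/|G\<^sub>e|\<close> is stationary for the uniform non-backtracking walk: at a vertex \<open>x\<close>, all
  \<open>|G\<^sub>x|/|G\<^sub>e|\<close> edges over \<open>bar e\<close> together carry the mass \<open>|G\<^sub>x|/(|G\<^sub>e| |G\<^sub>f|)\<close> into \<open>f\<close>, up to the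
  factor \<open>1/q\<close>, and these add up to
  the degree times \<open>1/|G\<^sub>f|\<close>, from which only the turn back from \<open>bar f\<close> is missing.
\<close>

lemma mass_balance:
  assumes f: "f \<in> edg X"
  shows "(\<Sum>e\<in>edg X. mass e * succ_weight e f) = branching (ini X f) * mass f"
proof -
  let ?x = "ini X f"
  have ord: "real (order (vgrp X ?x)) > 0" "real (order (egrp X f)) > 0"
    using f order_vgrp_pos order_egrp_pos by auto
  have "(\<Sum>e\<in>edg X. mass e * succ_weight e f) =
      (\<Sum>e\<in>edg X. mass (bar X e) * succ_weight (bar X e) f)"
    by (rule sum.reindex_bij_witness[of _ "bar X" "bar X"]) auto
  also have "\<dots> = (\<Sum>e\<in>edg X. (if ini X e = ?x then lifts e * mass f else 0)
      - (if e = f then mass f else 0))"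
  proof (intro sum.cong HOL.refl)
    fix e assume e: "e \<in> edg X"
    show "mass (bar X e) * succ_weight (bar X e) f =
        (if ini X e = ?x then lifts e * mass f else 0) - (if e = f then mass f else 0)"
      using e f by (simp only: mass_bar) (auto simp: succ_weight_def lifts_def mass_def right_diff_distrib diff_divide_distrib)
  qed
  also have "\<dots> = vertex_degree X ?x * mass f - mass f"
    using f by (simp add: sum_subtractf sum_out_edges degree_eq_sum_lifts sum_distrib_right)
  finally show ?thesis by (simp add: branching_def algebra_simps)
qed

lemma volume_eq: "gog_volume X l = (\<Sum>e\<in>edg X. mass e * l e) / 2"
  unfolding gog_volume_def mass_def by simp

end

locale branching_graph_of_groups = finite_graph_of_groups X
  for X :: "('v, 'e, 'a, 'b) graph_of_groups" +
  assumes degree_ge_3: "x \<in> vtx X \<Longrightarrow> vertex_degree X x \<ge> 3"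
begin

lemma branching_ge_2: "x \<in> vtx X \<Longrightarrow> branching x \<ge> 2"
  using degree_ge_3 by (simp add: branching_def)

lemma ex_edge: "\<exists>e. e \<in> edg X"
proof (rule ccontr)
  assume no: "\<nexists>e. e \<in> edg X"
  obtain x where x: "x \<in> vtx X" using conn by (auto simp: strongly_connected_def)
  have "vertex_degree X x = 0" using no by (simp add: vertex_degree_def)
  then show False using degree_ge_3[OF x] by simp
qed

lemma minimal_product_pos: "minimal_product > 0"
proof -
  have "0 < (\<Sum>e\<in>edg X. mass e * ln (branching (ter X e)))"
  proof (rule sum_pos)
    fix e assume e: "e \<in> edg X"
    then have "branching (ter X e) \<ge> 2" by (intro branching_ge_2) auto
    then show "0 < mass e * ln (branching (ter X e))"
      using mass_pos[OF e] by (intro mult_pos_pos) auto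
  qed (use ex_edge in auto)
  then show ?thesis by (simp add: minimal_product_def)
qed

lemma volume_pos:
  assumes "length_function X l"
  shows "gog_volume X l > 0"
proof -
  have "0 < (\<Sum>e\<in>edg X. mass e * l e)"
    by (rule sum_pos) (use assms mass_pos ex_edge in \<open>auto simp: length_function_def\<close>)
  then show ?thesis by (simp add: volume_eq)
qed

text \<open>
  The stationary probability flow, not normalized: \<open>mass\<close> is both its outgoing and its incoming
  marginal.
\<close>

definition edge_flow :: "'e \<Rightarrow> 'e \<Rightarrow> real" where
  "edge_flow e f = mass e * succ_weight e f / branching (ter X e)"

lemma edge_flow_nonneg: "e \<in> edg X \<Longrightarrow> f \<in> edg X \<Longrightarrow> edge_flow e f \<ge> 0"
  unfolding edge_flow_def
  using succ_weight_nonneg[of e f] mass_pos[of e] branching_ge_2[of "ter X e"] by auto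

lemma edge_flow_pos: "e \<in> edg X \<Longrightarrow> succ_weight e f > 0 \<Longrightarrow> edge_flow e f > 0"
  unfolding edge_flow_def
  using mass_pos[of e] branching_ge_2[of "ter X e"] by auto

lemma edge_flow_out: "e \<in> edg X \<Longrightarrow> (\<Sum>f\<in>edg X. edge_flow e f) = mass e"
  unfolding edge_flow_def using branching_ge_2[of "ter X e"]
  by (simp add: sum_divide_distrib[symmetric] sum_distrib_left[symmetric] sum_succ_weight)

lemma edge_flow_in:
  assumes "f \<in> edg X"
  shows "(\<Sum>e\<in>edg X. edge_flow e f) = mass f"
proof -
  have "(\<Sum>e\<in>edg X. edge_flow e f) =
      (\<Sum>e\<in>edg X. mass e * succ_weight e f) / branching (ini X f)"
    unfolding sum_divide_distrib edge_flow_def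
    by (intro sum.cong HOL.refl) (auto simp: succ_weight_def)
  then show ?thesis
    using mass_balance[OF assms] branching_ge_2[of "ini X f"] assms by simp
qed

text \<open>
  The logarithm of how much the summand of \<open>f\<close> in \<open>transfer l s x e \<le> x e\<close> deviates from an equal
  share \<open>x e / q\<close>, where \<open>q\<close> is the number of continuations of \<open>e\<close>.
\<close>

definition log_defect :: "('e \<Rightarrow> real) \<Rightarrow> real \<Rightarrow> ('e \<Rightarrow> real) \<Rightarrow> 'e \<Rightarrow> 'e \<Rightarrow> real" where
  "log_defect l s x e f = ln (x f) - s * l f - ln (x e) + ln (branching (ter X e))"

text \<open>
  The mean of \<open>exp t - 1\<close> is nonpositive because \<open>x\<close> is superharmonic. In the mean of \<open>t\<close> the terms
  \<open>ln x\<^sub>f\<close> and \<open>ln x\<^sub>e\<close> cancel by stationarity, and what remains no longer depends on \<open>x\<close>.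
\<close>

lemma log_defect_sum:
  assumes sub: "\<And>e. e \<in> edg X \<Longrightarrow> transfer l s x e \<le> x e"
    and pos: "\<And>e. e \<in> edg X \<Longrightarrow> x e > 0"
  shows "(\<Sum>e\<in>edg X. \<Sum>f\<in>edg X. edge_flow e f * (exp (log_defect l s x e f) - 1 - log_defect l s x e f))
    \<le> 2 * (s * gog_volume X l - minimal_product)"
proof -
  have a: "(\<Sum>f\<in>edg X. edge_flow e f * exp (log_defect l s x e f)) \<le> mass e" if e: "e \<in> edg X" for e
  proof -
    have q: "branching (ter X e) > 0" using e branching_ge_2[of "ter X e"] by auto
    have "(\<Sum>f\<in>edg X. edge_flow e f * exp (log_defect l s x e f))
        = (\<Sum>f\<in>edg X. mass e * (succ_weight e f * exp (- s * l f) * x f) / x e)"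
      using q pos e unfolding edge_flow_def log_defect_def
      by (intro sum.cong HOL.refl) (auto simp: exp_add exp_diff exp_minus field_simps)
    also have "\<dots> = mass e * (transfer l s x e / x e)"
      unfolding transfer_def by (simp add: sum_divide_distrib sum_distrib_left)
    also have "\<dots> \<le> mass e * 1"
      using sub[OF e] pos[OF e] mass_pos[OF e] by (intro mult_left_mono) auto
    finally show ?thesis by simp
  qed
  have out: "(\<Sum>e\<in>edg X. \<Sum>f\<in>edg X. edge_flow e f * g e) = (\<Sum>e\<in>edg X. mass e * g e)" for g
    by (intro sum.cong HOL.refl) (simp only: sum_distrib_right[symmetric] edge_flow_out)
  have inn: "(\<Sum>e\<in>edg X. \<Sum>f\<in>edg X. edge_flow e f * g f) = (\<Sum>e\<in>edg X. mass e * g e)" for g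
    by (subst sum.swap, intro sum.cong HOL.refl) (simp only: sum_distrib_right[symmetric] edge_flow_in)
  have "(\<Sum>e\<in>edg X. \<Sum>f\<in>edg X. edge_flow e f * log_defect l s x e f) =
      (\<Sum>e\<in>edg X. \<Sum>f\<in>edg X. edge_flow e f * (ln (x f) - s * l f)
         + edge_flow e f * (ln (branching (ter X e)) - ln (x e)))"
    unfolding log_defect_def by (intro sum.cong HOL.refl) (simp add: algebra_simps)
  also have "\<dots> = (\<Sum>e\<in>edg X. mass e * (ln (x e) - s * l e))
      + (\<Sum>e\<in>edg X. mass e * (ln (branching (ter X e)) - ln (x e)))"
    by (simp add: sum.distrib inn[of "\<lambda>f. ln (x f) - s * l f"]
        out[of "\<lambda>e. ln (branching (ter X e)) - ln (x e)"])
  also have "\<dots> = 2 * minimal_product - 2 * s * gog_volume X l"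
  proof -
    have "(\<Sum>e\<in>edg X. mass e * (ln (x e) - s * l e)) =
        (\<Sum>e\<in>edg X. mass e * ln (x e)) - s * (\<Sum>e\<in>edg X. mass e * l e)"
      by (simp add: right_diff_distrib sum_subtractf sum_distrib_left mult.left_commute)
    moreover have "(\<Sum>e\<in>edg X. mass e * (ln (branching (ter X e)) - ln (x e))) =
        (\<Sum>e\<in>edg X. mass e * ln (branching (ter X e))) - (\<Sum>e\<in>edg X. mass e * ln (x e))"
      by (simp add: right_diff_distrib sum_subtractf)
    ultimately show ?thesis by (simp add: minimal_product_def volume_eq)
  qed
  finally have b: "(\<Sum>e\<in>edg X. \<Sum>f\<in>edg X. edge_flow e f * log_defect l s x e f) =
      2 * minimal_product - 2 * s * gog_volume X l" .
  have "(\<Sum>e\<in>edg X. \<Sum>f\<in>edg X. edge_flow e f * (exp (log_defect l s x e f) - 1 - log_defect l s x e f))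
    = (\<Sum>e\<in>edg X. \<Sum>f\<in>edg X. edge_flow e f * exp (log_defect l s x e f)) - (\<Sum>e\<in>edg X. mass e)
      - (\<Sum>e\<in>edg X. \<Sum>f\<in>edg X. edge_flow e f * log_defect l s x e f)"
    using out[of "\<lambda>_. 1"] by (simp add: right_diff_distrib sum_subtractf)
  also have "\<dots> \<le> 2 * (s * gog_volume X l - minimal_product)"
    unfolding b using sum_mono[OF a] by (simp add: algebra_simps)
  finally show ?thesis .
qed

lemma exp_defect_nonneg: "exp t - 1 - t \<ge> (0::real)"
  using exp_ge_add_one_self[of t] by linarith

lemma log_defect_term:
  assumes sub: "\<And>e. e \<in> edg X \<Longrightarrow> transfer l s x e \<le> x e"
    and pos: "\<And>e. e \<in> edg X \<Longrightarrow> x e > 0" and e: "e \<in> edg X" and f: "f \<in> edg X"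
  shows "edge_flow e f * (exp (log_defect l s x e f) - 1 - log_defect l s x e f)
    \<le> 2 * (s * gog_volume X l - minimal_product)"
proof -
  let ?g = "\<lambda>e f. edge_flow e f * (exp (log_defect l s x e f) - 1 - log_defect l s x e f)"
  have nn: "?g e f \<ge> 0" if "e \<in> edg X" "f \<in> edg X" for e f
    using that edge_flow_nonneg exp_defect_nonneg by auto
  have "?g e f \<le> (\<Sum>f\<in>edg X. ?g e f)"
    using nn e f by (intro member_le_sum) auto
  also have "\<dots> \<le> (\<Sum>e\<in>edg X. \<Sum>f\<in>edg X. ?g e f)"
    using nn e by (intro member_le_sum[of e _ "\<lambda>e. \<Sum>f\<in>edg X. ?g e f"] sum_nonneg) auto
  also note log_defect_sum[OF sub pos]
  finally show ?thesis by simp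
qed

corollary superharmonic_volume_bound:
  assumes sub: "\<And>e. e \<in> edg X \<Longrightarrow> transfer l s x e \<le> x e"
    and pos: "\<And>e. e \<in> edg X \<Longrightarrow> x e > 0"
  shows "minimal_product \<le> s * gog_volume X l"
proof -
  obtain e where e: "e \<in> edg X" using ex_edge by blast
  have "0 \<le> edge_flow e e * (exp (log_defect l s x e e) - 1 - log_defect l s x e e)"
    using edge_flow_nonneg[OF e e] exp_defect_nonneg by auto
  with log_defect_term[OF sub pos e e] show ?thesis by auto
qed

text \<open>
  At a vertex one can get from the incoming edge \<open>bar f\<close> to the outgoing edge \<open>f\<close> by one step of the
  walk, or else by a step, a step back and a step. This is where degree three is used: if \<open>f\<close> has a single lift, the
  other outgoing edges have at least two lifts together, so \<open>g\<close> and \<open>h\<close> can be chosen among them,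
  and \<open>g = h\<close> only if this edge has several lifts.
\<close>

lemma zigzag:
  assumes f: "f \<in> edg X"
  shows "succ_weight (bar X f) f > 0 \<or>
    (\<exists>g h. g \<in> edg X \<and> h \<in> edg X \<and> ini X g = ini X f \<and> ini X h = ini X f \<and>
      succ_weight (bar X f) g > 0 \<and> succ_weight (bar X h) g > 0 \<and> succ_weight (bar X h) f > 0)"
proof (cases "lifts f > 1")
  case True
  then show ?thesis using f by (simp add: succ_weight_def)
next
  case False
  then have 1: "lifts f = 1" using lifts_ge_1[OF f] by simp
  let ?O = "{g \<in> edg X. ini X g = ini X f}"
  have "(\<Sum>g\<in>?O. lifts g) \<ge> 3"
    using degree_ge_3[of "ini X f"] f by (simp add: degree_eq_sum_lifts)
  moreover have "(\<Sum>g\<in>?O. lifts g) = lifts f + (\<Sum>g\<in>?O - {f}. lifts g)"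
    using f by (intro sum.remove) auto
  ultimately have sum2: "(\<Sum>g\<in>?O - {f}. lifts g) \<ge> 2" using 1 by simp
  then have "?O - {f} \<noteq> {}" by (metis not_numeral_le_zero sum.empty)
  then obtain g where g: "g \<in> ?O - {f}" by blast
  have "\<exists>h\<in>?O - {f}. lifts g > 1 \<or> h \<noteq> g"
  proof (cases "?O - {f} = {g}")
    case True
    then show ?thesis using sum2 by auto
  next
    case False
    then show ?thesis using g by blast
  qed
  then obtain h where h: "h \<in> ?O - {f}" "lifts g > 1 \<or> h \<noteq> g" by blast
  have "succ_weight (bar X f) g > 0" "succ_weight (bar X h) g > 0" "succ_weight (bar X h) f > 0"
    using f g h lifts_ge_1[of g] lifts_ge_1[of f] by (auto simp: succ_weight_def)
  then show ?thesis using g h by blast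
qed

end

section \<open>Superharmonic functions and optimal lengths\<close>

text \<open>
  A quantitative converse of \<open>exp 0 - 1 - 0 = 0\<close>; it rests on \<open>exp t = exp (t/2)\<^sup>2 \<ge> (1 + t/2)\<^sup>2\<close>.
\<close>

lemma exp_defect_small:
  assumes "exp t - 1 - t \<le> \<eta>\<^sup>2 / 4" "0 < \<eta>" "\<eta> < (1::real)"
  shows "\<bar>t\<bar> \<le> \<eta>"
proof -
  have e1: "\<eta>\<^sup>2 < 1" using assms by (simp add: power_less_one_iff)
  have "t \<ge> -2"
  proof (rule ccontr)
    assume "\<not> t \<ge> -2"
    then have "exp t - 1 - t > 1" using exp_gt_zero[of t] by linarith
    with assms(1) e1 show False by simp
  qed
  then have "(1 + t / 2)\<^sup>2 \<le> (exp (t / 2))\<^sup>2"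
    using exp_ge_add_one_self[of "t / 2"] by (intro power_mono) auto
  also have "\<dots> = exp t" by (simp add: exp_double[symmetric])
  finally have "t\<^sup>2 \<le> \<eta>\<^sup>2" using assms(1) by (simp add: power2_eq_square algebra_simps)
  then show ?thesis using assms power2_le_iff_abs_le[of \<eta> t] by simp
qed

context branching_graph_of_groups
begin

text \<open>
  A stationary flow that never leaves a set cannot enter it either.
\<close>

lemma succ_closed_imp_pred_closed:
  assumes S: "S \<subseteq> edg X"
    and succ: "\<And>e f. e \<in> S \<Longrightarrow> f \<in> edg X \<Longrightarrow> succ_weight e f > 0 \<Longrightarrow> f \<in> S"
    and e: "e \<in> edg X" and f: "f \<in> S" and w: "succ_weight e f > 0"
  shows "e \<in> S"
proof (rule ccontr)
  assume eS: "e \<notin> S"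
  have fin: "finite S" using S finite_edges by (rule finite_subset)
  have "(\<Sum>f\<in>S. mass f) = (\<Sum>f\<in>S. \<Sum>e\<in>edg X. edge_flow e f)"
    using S by (intro sum.cong) (auto simp: edge_flow_in)
  also have "\<dots> = (\<Sum>f\<in>S. \<Sum>e\<in>S. edge_flow e f) + (\<Sum>f\<in>S. \<Sum>e\<in>edg X - S. edge_flow e f)"
    using S by (simp add: sum.distrib[symmetric] sum.subset_diff add.commute)
  also have "(\<Sum>f\<in>S. \<Sum>e\<in>S. edge_flow e f) = (\<Sum>e\<in>S. \<Sum>f\<in>edg X. edge_flow e f)"
  proof (subst sum.swap, rule sum.cong[OF HOL.refl], rule sum.mono_neutral_left)
    fix e assume e: "e \<in> S"
    show "\<forall>f\<in>edg X - S. edge_flow e f = 0"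
    proof
      fix f assume f: "f \<in> edg X - S"
      then have "succ_weight e f = 0"
        using succ[OF e, of f] succ_weight_nonneg[of e f] S e by force
      then show "edge_flow e f = 0" by (simp add: edge_flow_def)
    qed
  qed (use S in auto)
  also have "\<dots> = (\<Sum>f\<in>S. mass f)"
    using S by (intro sum.cong) (auto simp: edge_flow_out)
  finally have zero: "(\<Sum>f\<in>S. \<Sum>e\<in>edg X - S. edge_flow e f) = 0" by simp
  have nn: "edge_flow e f \<ge> 0" if "e \<in> edg X - S" "f \<in> S" for e f
    using that S edge_flow_nonneg by auto
  have "edge_flow e f \<le> (\<Sum>e\<in>edg X - S. edge_flow e f)"
    using e eS f nn by (intro member_le_sum[of e _ "\<lambda>e. edge_flow e f"]) auto
  also have "\<dots> \<le> (\<Sum>f\<in>S. \<Sum>e\<in>edg X - S. edge_flow e f)"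
    using f nn fin by (intro member_le_sum[of f S "\<lambda>f. \<Sum>e\<in>edg X - S. edge_flow e f"] sum_nonneg) auto
  finally have "edge_flow e f \<le> 0" using zero by simp
  with edge_flow_pos[OF e w] show False by simp
qed

text \<open>
  The non-backtracking walk is irreducible. A set closed under successors is closed under
  predecessors, hence by \<open>zigzag\<close> under reversal; so it contains all edges at a vertex as soon as it
  contains one, and the graph is connected.
\<close>

lemma succ_closed_imp_all:
  assumes S: "S \<subseteq> edg X" and ne: "S \<noteq> {}"
    and succ: "\<And>e f. e \<in> S \<Longrightarrow> f \<in> edg X \<Longrightarrow> succ_weight e f > 0 \<Longrightarrow> f \<in> S"
  shows "S = edg X"
proof -
  have pred: "e \<in> S" if "e \<in> edg X" "f \<in> S" "succ_weight e f > 0" for e f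
    by (rule succ_closed_imp_pred_closed[OF S _ that]) (rule succ)
  have bar': "f \<in> S" if "bar X f \<in> S" "f \<in> edg X" for f
    using zigzag[OF that(2)]
  proof
    assume "succ_weight (bar X f) f > 0"
    then show ?thesis using succ that by blast
  next
    assume "\<exists>g h. g \<in> edg X \<and> h \<in> edg X \<and> ini X g = ini X f \<and> ini X h = ini X f \<and>
      succ_weight (bar X f) g > 0 \<and> succ_weight (bar X h) g > 0 \<and> succ_weight (bar X h) f > 0"
    then obtain g h where gh: "g \<in> edg X" "h \<in> edg X"
      "succ_weight (bar X f) g > 0" "succ_weight (bar X h) g > 0" "succ_weight (bar X h) f > 0"
      by blast
    then have "g \<in> S" using succ that by blast
    then have "bar X h \<in> S" using pred gh bar_edge by blast
    then show ?thesis using succ gh that by blast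
  qed
  have bar: "bar X f \<in> S" if "f \<in> S" for f
    using bar'[of "bar X f"] that S by auto
  have star: "f \<in> S" if "e \<in> S" "f \<in> edg X" "ini X f = ini X e" for e f
  proof (cases "f = e")
    case False
    have "succ_weight (bar X e) f > 0"
      using False that S lifts_ge_1[of f] by (auto simp: succ_weight_def)
    then show ?thesis using succ bar that by blast
  qed (use that in simp)
  obtain e0 where e0: "e0 \<in> S" using ne by blast
  have "\<forall>f. f \<in> edg X \<longrightarrow> ini X f = x \<longrightarrow> f \<in> S" if "ini X e0 \<rightarrow>\<^sup>*\<^bsub>base X\<^esub> x" for x
    using that
  proof (induction rule: reachable_induct)
    case base
    then show ?case using star[OF e0] by blast
  next
    case (step x y)
    from step(2) obtain e where e: "e \<in> edg X" "ini X e = x" "ter X e = y"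
      by (auto simp: arcs_ends_def arc_to_ends_def)
    then have "bar X e \<in> S" using step bar by blast
    then show ?case using star[of "bar X e"] e by auto
  qed
  moreover have "ini X e0 \<rightarrow>\<^sup>*\<^bsub>base X\<^esub> ini X f" if "f \<in> edg X" for f
    using conn e0 S that by (auto simp: strongly_connected_def)
  ultimately show ?thesis using S by blast
qed

lemma transfer_power_nonneg: "e \<in> edg X \<Longrightarrow> (transfer l s ^^ m) (\<lambda>_. 1) e \<ge> 0"
proof (induction m arbitrary: e)
  case (Suc m)
  then show ?case
    by (auto simp: transfer_def intro!: sum_nonneg mult_nonneg_nonneg succ_weight_nonneg)
qed simp

text \<open>
  The sum \<open>x = \<Sum>\<^sub>m M\<^sup>m 1\<close> over the powers of the transfer operator satisfies \<open>M x = x - 1\<close>. The edges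
  where it converges are closed under successors, so by irreducibility one such edge is enough.
\<close>

lemma superharmonic_from_summable:
  assumes e0: "e0 \<in> edg X" and sum0: "summable (\<lambda>m. (transfer l s ^^ m) (\<lambda>_. 1) e0)"
  shows "\<exists>x. \<forall>e\<in>edg X. x e > 0 \<and> transfer l s x e \<le> x e"
proof -
  let ?M = "\<lambda>m. (transfer l s ^^ m) (\<lambda>_. 1)"
  note nn = transfer_power_nonneg
  define S where "S = {e \<in> edg X. summable (\<lambda>m. ?M m e)}"
  have "S = edg X"
  proof (rule succ_closed_imp_all)
    show "S \<noteq> {}" using e0 sum0 by (auto simp: S_def)
    fix e f assume e: "e \<in> S" and f: "f \<in> edg X" and w: "succ_weight e f > 0"
    let ?c = "succ_weight e f * exp (- s * l f)"
    have eX: "e \<in> edg X" and se: "summable (\<lambda>m. ?M (Suc m) e)"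
      using e summable_Suc_iff[of "\<lambda>m. ?M m e"] by (auto simp: S_def)
    have "?c * ?M m f \<le> ?M (Suc m) e" for m
    proof -
      have "?c * ?M m f \<le> (\<Sum>f\<in>edg X. succ_weight e f * exp (- s * l f) * ?M m f)"
        using f eX nn succ_weight_nonneg
        by (intro member_le_sum[of f _ "\<lambda>f. succ_weight e f * exp (- s * l f) * ?M m f"]
            mult_nonneg_nonneg) auto
      then show ?thesis by (simp add: transfer_def)
    qed
    moreover have "0 \<le> ?c * ?M m f" for m
      using nn[OF f, of m] w by simp
    ultimately have "summable (\<lambda>m. ?c * ?M m f)"
      by (intro summable_comparison_test'[OF se, of 0]) auto
    then have "summable (\<lambda>m. ?M m f)"
      using w by (subst (asm) summable_cmult_iff) auto
    then show "f \<in> S" using f by (simp add: S_def)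
  qed (auto simp: S_def)
  then have sm: "summable (\<lambda>m. ?M m e)" if "e \<in> edg X" for e using that by (auto simp: S_def)
  define x where "x e = (\<Sum>m. ?M m e)" for e
  have "x e > 0 \<and> transfer l s x e \<le> x e" if e: "e \<in> edg X" for e
  proof -
    have "transfer l s x e = (\<Sum>f\<in>edg X. succ_weight e f * exp (- s * l f) * x f)"
      by (rule transfer_def)
    also have "\<dots> = (\<Sum>f\<in>edg X. \<Sum>m. succ_weight e f * exp (- s * l f) * ?M m f)"
      unfolding x_def by (intro sum.cong HOL.refl suminf_mult[symmetric] sm)
    also have "\<dots> = (\<Sum>m. \<Sum>f\<in>edg X. succ_weight e f * exp (- s * l f) * ?M m f)"
      by (intro suminf_sum[symmetric] summable_mult sm)
    also have "\<dots> = (\<Sum>m. ?M (Suc m) e)" by (simp add: transfer_def)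
    also have "\<dots> = x e - 1"
      using suminf_split_head[OF sm[OF e]] by (simp add: x_def)
    finally have t: "transfer l s x e = x e - 1" .
    have "x f \<ge> 0" if "f \<in> edg X" for f
      unfolding x_def using that by (intro suminf_nonneg sm nn)
    then have "transfer l s x e \<ge> 0"
      unfolding transfer_def using e
      by (auto intro!: sum_nonneg mult_nonneg_nonneg succ_weight_nonneg)
    with t show ?thesis by simp
  qed
  then show ?thesis by blast
qed

text \<open>
  Let \<open>s\<close> tend to the critical value \<open>\<delta>\<close>. By \<open>log_defect_term\<close> all defects tend to zero. Combined as in
  \<open>zigzag\<close>, three of them give the defect of the pair \<open>(bar f, f)\<close>, and likewise of \<open>(f, bar f)\<close>;
  in the sum of these two the unknown \<open>x\<close> cancels, leaving
  \<open>ln q\<^bsub>i(f)\<^esub> + ln q\<^bsub>t(f)\<^esub> - 2 s l(f)\<close>.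
\<close>

lemma rigidity:
  assumes l: "length_function X l"
    and crit: "\<delta> * gog_volume X l = minimal_product"
    and super: "\<And>s. s > \<delta> \<Longrightarrow> \<exists>x. \<forall>e\<in>edg X. x e > 0 \<and> transfer l s x e \<le> x e"
    and f: "f \<in> edg X"
  shows "2 * \<delta> * l f = ln (branching (ini X f) * branching (ter X f))"
proof -
  let ?V = "gog_volume X l"
  have V: "?V > 0" using volume_pos[OF l] .
  have lb: "l (bar X f) = l f" "l f > 0" using l f by (auto simp: length_function_def)
  define P where "P = {p \<in> edg X \<times> edg X. succ_weight (fst p) (snd p) > 0}"
  have "finite P" unfolding P_def by simp
  then obtain c where c: "c > 0" "\<And>p. p \<in> P \<Longrightarrow> c \<le> edge_flow (fst p) (snd p)"
  proof (cases "P = {}")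
    case True
    then show ?thesis using that[of 1] by simp
  next
    case False
    let ?I = "(\<lambda>p. edge_flow (fst p) (snd p)) ` P"
    have "Min ?I \<in> ?I" using \<open>finite P\<close> False by (intro Min_in) auto
    then have "Min ?I > 0" by (auto simp: P_def edge_flow_pos)
    then show ?thesis using that[of "Min ?I"] \<open>finite P\<close> by simp
  qed
  let ?q = "branching (ini X f)" and ?q' = "branching (ter X f)"
  let ?K = "6 + 2 * l f * c / (8 * ?V)"
  have q: "?q > 0" "?q' > 0" using branching_ge_2[of "ini X f"] branching_ge_2[of "ter X f"] f by auto
  have small: "\<bar>ln ?q + ln ?q' - 2 * \<delta> * l f\<bar> \<le> ?K * \<eta>" if \<eta>: "0 < \<eta>" "\<eta> < 1" for \<eta> :: real
  proof -
    \<comment> \<open>The excess of \<open>s\<close> is chosen so small that even an edge pair with the least flow \<open>c\<close> has a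
      defect of at most \<open>\<eta>\<close>.\<close>
    define s where "s = \<delta> + c * \<eta>\<^sup>2 / (8 * ?V)"
    have "s > \<delta>" unfolding s_def using c V \<eta> by simp
    then obtain x where x: "\<And>e. e \<in> edg X \<Longrightarrow> x e > 0" "\<And>e. e \<in> edg X \<Longrightarrow> transfer l s x e \<le> x e"
      using super by blast
    have gap: "2 * (s * ?V - minimal_product) = c * (\<eta>\<^sup>2 / 4)"
      unfolding crit[symmetric] s_def using V by (simp add: field_simps)
    have ld: "\<bar>log_defect l s x e g\<bar> \<le> \<eta>" if "e \<in> edg X" "g \<in> edg X" "succ_weight e g > 0" for e g
    proof (rule exp_defect_small)
      let ?g = "exp (log_defect l s x e g) - 1 - log_defect l s x e g"
      have "c * ?g \<le> edge_flow e g * ?g"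
        using c(2)[of "(e, g)"] that exp_defect_nonneg by (intro mult_right_mono) (auto simp: P_def)
      also have "\<dots> \<le> c * (\<eta>\<^sup>2 / 4)"
        using log_defect_term[OF x(2,1) that(1,2)] gap by simp
      finally show "?g \<le> \<eta>\<^sup>2 / 4" using c(1) by simp
    qed (use \<eta> in auto)
    have turn: "\<bar>log_defect l s x (bar X h) h\<bar> \<le> 3 * \<eta>" if h: "h \<in> edg X" for h
      using zigzag[OF h]
    proof
      assume "succ_weight (bar X h) h > 0"
      then show ?thesis using ld[of "bar X h" h] h \<eta> by auto
    next
      assume "\<exists>g k. g \<in> edg X \<and> k \<in> edg X \<and> ini X g = ini X h \<and> ini X k = ini X h \<and>
        succ_weight (bar X h) g > 0 \<and> succ_weight (bar X k) g > 0 \<and> succ_weight (bar X k) h > 0"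
      then obtain g k where gk: "g \<in> edg X" "k \<in> edg X" "ini X g = ini X h" "ini X k = ini X h"
        "succ_weight (bar X h) g > 0" "succ_weight (bar X k) g > 0" "succ_weight (bar X k) h > 0"
        by blast
      have "log_defect l s x (bar X h) h =
          log_defect l s x (bar X h) g - log_defect l s x (bar X k) g + log_defect l s x (bar X k) h"
        using gk h by (simp add: log_defect_def)
      moreover have "\<bar>log_defect l s x (bar X h) g\<bar> \<le> \<eta>" "\<bar>log_defect l s x (bar X k) g\<bar> \<le> \<eta>"
        "\<bar>log_defect l s x (bar X k) h\<bar> \<le> \<eta>"
        using gk h by (auto intro!: ld)
      ultimately show ?thesis by linarith
    qed
    have "ln ?q + ln ?q' - 2 * s * l f = log_defect l s x (bar X f) f + log_defect l s x f (bar X f)"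
      using f lb by (simp add: log_defect_def)
    then have a: "\<bar>ln ?q + ln ?q' - 2 * s * l f\<bar> \<le> 6 * \<eta>"
      using turn[OF f] turn[of "bar X f"] f by simp
    have "\<bar>2 * s * l f - 2 * \<delta> * l f\<bar> = 2 * l f * c / (8 * ?V) * \<eta>\<^sup>2"
      unfolding s_def using lb c V by (simp add: algebra_simps abs_mult)
    also have "\<dots> \<le> 2 * l f * c / (8 * ?V) * \<eta>"
      using lb c V \<eta> by (intro mult_left_mono) (auto simp: power2_eq_square mult_le_one intro: mult_left_le)
    finally show ?thesis using a by (simp add: algebra_simps)
  qed
  moreover have "?K > 0" using lb c V by (simp add: add_pos_nonneg)
  ultimately obtain K :: real where K: "K > 0"
    and small: "\<And>\<eta>. 0 < \<eta> \<Longrightarrow> \<eta> < 1 \<Longrightarrow> \<bar>ln ?q + ln ?q' - 2 * \<delta> * l f\<bar> \<le> K * \<eta>" by blast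
  define D where "D = \<bar>ln ?q + ln ?q' - 2 * \<delta> * l f\<bar>"
  have "D \<le> 0"
  proof (rule ccontr)
    assume "\<not> ?thesis"
    then have pos: "D > 0" by simp
    define \<eta> where "\<eta> = min (1/2) (D / (2 * K))"
    have e: "0 < \<eta>" "\<eta> < 1" using pos K by (auto simp: \<eta>_def)
    have "K * \<eta> \<le> K * (D / (2 * K))"
      using K by (intro mult_left_mono) (auto simp: \<eta>_def)
    also have "\<dots> = D / 2" using K by simp
    finally show False using small[OF e] pos D_def by linarith
  qed
  then have "ln ?q + ln ?q' - 2 * \<delta> * l f = 0" unfolding D_def by simp
  then show ?thesis using q by (simp add: ln_mult)
qed

text \<open>
  Normalized such that the entropy is 1.
\<close>

definition optimal_length :: "'e \<Rightarrow> real" where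
  "optimal_length e = ln (branching (ini X e) * branching (ter X e)) / 2"

lemma length_function_optimal:
  assumes "k > 0"
  shows "length_function X (\<lambda>e. k * optimal_length e)"
  unfolding length_function_def
proof (intro ballI conjI)
  fix e assume e: "e \<in> edg X"
  then have "branching (ini X e) * branching (ter X e) \<ge> 2 * 2"
    using branching_ge_2 by (intro mult_mono) (auto intro: order_trans[of _ 2])
  then show "k * optimal_length e > 0" using assms unfolding optimal_length_def by simp
  show "k * optimal_length (bar X e) = k * optimal_length e"
    using e by (simp add: optimal_length_def mult.commute)
qed

lemma volume_optimal: "gog_volume X (\<lambda>e. k * optimal_length e) = k * minimal_product"
proof -
  have "(\<Sum>e\<in>edg X. mass e * ln (branching (ini X e))) = (\<Sum>e\<in>edg X. mass e * ln (branching (ter X e)))"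
    by (rule sum.reindex_bij_witness[of _ "bar X" "bar X"]) (auto simp: mass_bar)
  moreover have "mass e * (k * optimal_length e) =
      k / 2 * (mass e * ln (branching (ini X e))) + k / 2 * (mass e * ln (branching (ter X e)))"
    if "e \<in> edg X" for e
    using that branching_ge_2[of "ini X e"] branching_ge_2[of "ter X e"]
    by (simp add: optimal_length_def ln_mult algebra_simps add_divide_distrib)
  then have "(\<Sum>e\<in>edg X. mass e * (k * optimal_length e)) =
      (\<Sum>e\<in>edg X. k / 2 * (mass e * ln (branching (ini X e))) + k / 2 * (mass e * ln (branching (ter X e))))"
    by (intro sum.cong HOL.refl)
  ultimately show ?thesis
    by (simp only: volume_eq minimal_product_def sum.distrib sum_distrib_left[symmetric]) simp
qed

lemma optimal_harmonic:
  assumes k: "k > 0" and e: "e \<in> edg X"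
  shows "transfer (\<lambda>e. k * optimal_length e) (1 / k) (\<lambda>e. sqrt (branching (ter X e))) e
    = sqrt (branching (ter X e))"
proof -
  have "transfer (\<lambda>e. k * optimal_length e) (1 / k) (\<lambda>e. sqrt (branching (ter X e))) e =
      (\<Sum>f\<in>edg X. succ_weight e f / sqrt (branching (ter X e)))"
    unfolding transfer_def
  proof (intro sum.cong HOL.refl)
    fix f assume f: "f \<in> edg X"
    let ?a = "branching (ini X f)" and ?b = "branching (ter X f)"
    have q: "?a > 0" "?b > 0" using f branching_ge_2[of "ini X f"] branching_ge_2[of "ter X f"] by auto
    have "exp (- (1 / k) * (k * optimal_length f)) = 1 / sqrt (?a * ?b)"
      using k q by (simp add: optimal_length_def exp_minus ln_sqrt[symmetric] inverse_eq_divide)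
    then show "succ_weight e f * exp (- (1 / k) * (k * optimal_length f)) * sqrt ?b
        = succ_weight e f / sqrt (branching (ter X e))"
      using q by (auto simp: succ_weight_def real_sqrt_mult)
  qed
  also have "\<dots> = sqrt (branching (ter X e))"
    using e branching_ge_2[of "ter X e"] by (simp add: sum_divide_distrib[symmetric] sum_succ_weight real_div_sqrt)
  finally show ?thesis .
qed

end

section \<open>Normal forms of paths\<close>

context finite_graph_of_groups
begin

abbreviation edge_image :: "'e \<Rightarrow> 'a set" where
  "edge_image e \<equiv> emb X e ` carrier (egrp X e)"

text \<open>
  The trivial coset is represented by the neutral element, so that an edge followed by its
  reverse cancels exactly when the representative between the two is neutral.
\<close>

definition coset_rep :: "'e \<Rightarrow> 'a \<Rightarrow> 'a" where
  "coset_rep e g = (if g \<in> edge_image e then \<one>\<^bsub>vgrp X (ini X e)\<^esub>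
     else (SOME h. h \<in> g <#\<^bsub>vgrp X (ini X e)\<^esub> edge_image e))"

definition transversal :: "'e \<Rightarrow> 'a set" where
  "transversal e = coset_rep e ` carrier (vgrp X (ini X e))"

text \<open>
  Together with \<open>coset_rep\<close> this decomposes a vertex group element as \<open>g = coset_rep e g \<cdot> \<alpha>\<^sub>e(s)\<close>.
\<close>

definition edge_part :: "'e \<Rightarrow> 'a \<Rightarrow> 'b" where
  "edge_part e g = (SOME s. s \<in> carrier (egrp X e) \<and>
     g = coset_rep e g \<otimes>\<^bsub>vgrp X (ini X e)\<^esub> emb X e s)"

lemma vgrp_ini: "e \<in> edg X \<Longrightarrow> group (vgrp X (ini X e))"
  by (intro vgrp_group) auto

lemma vgrp_ter: "e \<in> edg X \<Longrightarrow> group (vgrp X (ter X e))"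
  by (intro vgrp_group) auto

lemma emb_closed [simp]: "e \<in> edg X \<Longrightarrow> s \<in> carrier (egrp X e) \<Longrightarrow> emb X e s \<in> carrier (vgrp X (ini X e))"
  using emb_hom by (auto simp: hom_def)

lemma emb_bar_closed [simp]: "e \<in> edg X \<Longrightarrow> s \<in> carrier (egrp X e) \<Longrightarrow>
    emb X (bar X e) s \<in> carrier (vgrp X (ter X e))"
  using emb_closed[of "bar X e" s] by (simp add: egrp_bar)

lemma emb_mult: "e \<in> edg X \<Longrightarrow> s \<in> carrier (egrp X e) \<Longrightarrow> t \<in> carrier (egrp X e) \<Longrightarrow>
    emb X e (s \<otimes>\<^bsub>egrp X e\<^esub> t) = emb X e s \<otimes>\<^bsub>vgrp X (ini X e)\<^esub> emb X e t"
  using emb_hom by (auto simp: hom_def)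

lemma emb_bar_mult: "e \<in> edg X \<Longrightarrow> s \<in> carrier (egrp X e) \<Longrightarrow> t \<in> carrier (egrp X e) \<Longrightarrow>
    emb X (bar X e) (s \<otimes>\<^bsub>egrp X e\<^esub> t) = emb X (bar X e) s \<otimes>\<^bsub>vgrp X (ter X e)\<^esub> emb X (bar X e) t"
  using emb_mult[of "bar X e" s t] by (simp add: egrp_bar)

lemma emb_one: "e \<in> edg X \<Longrightarrow> emb X e \<one>\<^bsub>egrp X e\<^esub> = \<one>\<^bsub>vgrp X (ini X e)\<^esub>"
  using hom_one[OF emb_hom egrp_group vgrp_ini] by auto

lemma emb_bar_one: "e \<in> edg X \<Longrightarrow> emb X (bar X e) \<one>\<^bsub>egrp X e\<^esub> = \<one>\<^bsub>vgrp X (ter X e)\<^esub>"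
  using emb_one[of "bar X e"] by (simp add: egrp_bar)

context
  fixes e assumes e: "e \<in> edg X"
begin

interpretation G: group "vgrp X (ini X e)" by (rule vgrp_ini[OF e])
interpretation S: group "egrp X e" by (rule egrp_group[OF e])

lemma coset_rep_in_coset:
  assumes g: "g \<in> carrier (vgrp X (ini X e))"
  shows "coset_rep e g \<in> g <#\<^bsub>vgrp X (ini X e)\<^esub> edge_image e"
proof (cases "g \<in> edge_image e")
  case True
  then show ?thesis
    using G.coset_join3[OF g emb_subgroup[OF e] True] subgroup.one_closed[OF emb_subgroup[OF e]]
    by (simp add: coset_rep_def)
next
  case False
  then show ?thesis
    using G.lcos_self[OF g emb_subgroup[OF e]] by (auto simp: coset_rep_def intro: someI)
qed

lemma coset_rep_closed: "g \<in> carrier (vgrp X (ini X e)) \<Longrightarrow> coset_rep e g \<in> carrier (vgrp X (ini X e))"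
  using coset_rep_in_coset G.l_coset_carrier[OF _ _ emb_subgroup[OF e]] by blast

lemma coset_rep_coset: "g \<in> carrier (vgrp X (ini X e)) \<Longrightarrow>
    coset_rep e g <#\<^bsub>vgrp X (ini X e)\<^esub> edge_image e = g <#\<^bsub>vgrp X (ini X e)\<^esub> edge_image e"
  using G.l_repr_independence[OF coset_rep_in_coset _ emb_subgroup[OF e]] by simp

lemma coset_rep_eq_iff:
  assumes g: "g \<in> carrier (vgrp X (ini X e))" and h: "h \<in> carrier (vgrp X (ini X e))"
  shows "coset_rep e g = coset_rep e h \<longleftrightarrow>
    g <#\<^bsub>vgrp X (ini X e)\<^esub> edge_image e = h <#\<^bsub>vgrp X (ini X e)\<^esub> edge_image e" (is "_ \<longleftrightarrow> ?c g = ?c h")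
proof
  assume "coset_rep e g = coset_rep e h"
  then show "?c g = ?c h" using coset_rep_coset[OF g] coset_rep_coset[OF h] by simp
next
  assume eq: "?c g = ?c h"
  have "k \<in> edge_image e \<longleftrightarrow> ?c k = edge_image e" if "k \<in> carrier (vgrp X (ini X e))" for k
    using G.coset_join3[OF that emb_subgroup[OF e]] G.lcos_self[OF that emb_subgroup[OF e]] by auto
  then show "coset_rep e g = coset_rep e h"
    using eq g h by (simp add: coset_rep_def)
qed

lemma coset_rep_idem: "g \<in> carrier (vgrp X (ini X e)) \<Longrightarrow> coset_rep e (coset_rep e g) = coset_rep e g"
  by (simp add: coset_rep_eq_iff coset_rep_closed coset_rep_coset)

lemma transversal_closed: "g \<in> transversal e \<Longrightarrow> g \<in> carrier (vgrp X (ini X e))"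
  by (auto simp: transversal_def coset_rep_closed)

lemma coset_rep_transversal: "g \<in> transversal e \<Longrightarrow> coset_rep e g = g"
  by (auto simp: transversal_def coset_rep_idem)

lemma coset_rep_mult:
  assumes "g \<in> carrier (vgrp X (ini X e))" "s \<in> carrier (egrp X e)"
  shows "coset_rep e (g \<otimes>\<^bsub>vgrp X (ini X e)\<^esub> emb X e s) = coset_rep e g"
proof -
  have "g \<otimes>\<^bsub>vgrp X (ini X e)\<^esub> emb X e s \<in> g <#\<^bsub>vgrp X (ini X e)\<^esub> edge_image e"
    using assms by (auto simp: l_coset_def)
  then show ?thesis
    using assms e G.l_repr_independence[OF _ _ emb_subgroup[OF e]] by (simp add: coset_rep_eq_iff)
qed

lemma coset_rep_one: "coset_rep e \<one>\<^bsub>vgrp X (ini X e)\<^esub> = \<one>\<^bsub>vgrp X (ini X e)\<^esub>"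
  using subgroup.one_closed[OF emb_subgroup[OF e]] by (simp add: coset_rep_def)

lemma one_transversal: "\<one>\<^bsub>vgrp X (ini X e)\<^esub> \<in> transversal e"
  unfolding transversal_def using coset_rep_one by force

lemma edge_part:
  assumes g: "g \<in> carrier (vgrp X (ini X e))"
  shows "edge_part e g \<in> carrier (egrp X e)"
    and "coset_rep e g \<otimes>\<^bsub>vgrp X (ini X e)\<^esub> emb X e (edge_part e g) = g"
proof -
  have "g \<in> coset_rep e g <#\<^bsub>vgrp X (ini X e)\<^esub> edge_image e"
    using coset_rep_coset[OF g] G.lcos_self[OF g emb_subgroup[OF e]] by simp
  then have "\<exists>s. s \<in> carrier (egrp X e) \<and> g = coset_rep e g \<otimes>\<^bsub>vgrp X (ini X e)\<^esub> emb X e s"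
    by (auto simp: l_coset_def)
  from someI_ex[OF this] show "edge_part e g \<in> carrier (egrp X e)"
    "coset_rep e g \<otimes>\<^bsub>vgrp X (ini X e)\<^esub> emb X e (edge_part e g) = g"
    unfolding edge_part_def by auto
qed

lemma decompose_unique:
  assumes g: "g \<in> transversal e" and s: "s \<in> carrier (egrp X e)"
  shows "coset_rep e (g \<otimes>\<^bsub>vgrp X (ini X e)\<^esub> emb X e s) = g"
    and "edge_part e (g \<otimes>\<^bsub>vgrp X (ini X e)\<^esub> emb X e s) = s"
proof -
  note gc = transversal_closed[OF g]
  let ?h = "g \<otimes>\<^bsub>vgrp X (ini X e)\<^esub> emb X e s"
  show 1: "coset_rep e ?h = g" using coset_rep_mult[OF gc s] coset_rep_transversal[OF g] by simp
  have "g \<otimes>\<^bsub>vgrp X (ini X e)\<^esub> emb X e (edge_part e ?h) = ?h"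
    using edge_part(2)[of ?h] gc s e 1 by simp
  then have "emb X e (edge_part e ?h) = emb X e s"
    using gc s e edge_part(1)[of ?h] by simp
  then show "edge_part e ?h = s"
    using inj_onD[OF emb_inj[OF e]] edge_part(1)[of ?h] s gc e by simp
qed

lemma decompose_transversal:
  assumes g: "g \<in> transversal e"
  shows "coset_rep e g = g" "edge_part e g = \<one>\<^bsub>egrp X e\<^esub>"
  using decompose_unique[OF g S.one_closed] transversal_closed[OF g] by (simp_all add: emb_one[OF e])

lemma decompose_emb:
  assumes "s \<in> carrier (egrp X e)"
  shows "coset_rep e (emb X e s) = \<one>\<^bsub>vgrp X (ini X e)\<^esub>" "edge_part e (emb X e s) = s"
  using decompose_unique[OF one_transversal assms] assms e by simp_all

lemma finite_transversal: "finite (transversal e)"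
  unfolding transversal_def using e by (intro finite_imageI vgrp_finite) auto

lemma card_transversal: "real (card (transversal e)) = lifts e"
proof -
  have "bij_betw (\<lambda>g. g <#\<^bsub>vgrp X (ini X e)\<^esub> edge_image e) (transversal e)
      (lcosets\<^bsub>vgrp X (ini X e)\<^esub> (edge_image e))"
    unfolding bij_betw_def
  proof
    show "inj_on (\<lambda>g. g <#\<^bsub>vgrp X (ini X e)\<^esub> edge_image e) (transversal e)"
      by (intro inj_onI) (metis coset_rep_eq_iff coset_rep_transversal transversal_closed)
    show "(\<lambda>g. g <#\<^bsub>vgrp X (ini X e)\<^esub> edge_image e) ` transversal e =
        lcosets\<^bsub>vgrp X (ini X e)\<^esub> (edge_image e)"
      by (auto simp: LCOSETS_def transversal_def image_image coset_rep_coset)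
  qed
  then show ?thesis
    by (simp add: lifts_eq_index[OF e] bij_betw_same_card)
qed

end

end

text \<open>
  Normal forms of paths from the vertex \<open>root\<close>. The path \<open>g\<^sub>1 e\<^sub>1 \<dots> g\<^sub>m e\<^sub>m\<close> is represented by the list
  of the pairs \<open>(g\<^sub>j, e\<^sub>j)\<close> with the last pair first, so that a path is extended by consing.
\<close>

locale rooted_graph_of_groups = finite_graph_of_groups X
  for X :: "('v, 'e, 'a, 'b) graph_of_groups" +
  fixes root :: 'v
  assumes root: "root \<in> vtx X"
begin

fun endpoint :: "('a \<times> 'e) list \<Rightarrow> 'v" where
  "endpoint [] = root"
| "endpoint ((g, e) # r) = ter X e"

definition backtracks :: "('a \<times> 'e) list \<Rightarrow> 'a \<Rightarrow> 'e \<Rightarrow> bool" where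
  "backtracks r g e \<longleftrightarrow> g = \<one>\<^bsub>vgrp X (ini X e)\<^esub> \<and> r \<noteq> [] \<and> snd (hd r) = bar X e"

fun reduced :: "('a \<times> 'e) list \<Rightarrow> bool" where
  "reduced [] \<longleftrightarrow> True"
| "reduced ((g, e) # r) \<longleftrightarrow>
     e \<in> edg X \<and> ini X e = endpoint r \<and> g \<in> transversal e \<and> \<not> backtracks r g e \<and> reduced r"

text \<open>
  A state \<open>(r, h)\<close> stands for the path \<open>r h\<close>, where \<open>h\<close> belongs to the group of the last vertex.
\<close>

definition states :: "(('a \<times> 'e) list \<times> 'a) set" where
  "states = {(r, h). reduced r \<and> h \<in> carrier (vgrp X (endpoint r))}"

text \<open>
  Right multiplication of a normal form by an edge: write \<open>h = g \<alpha>\<^sub>e(s)\<close> and move \<open>s\<close> across \<open>e\<close>, where it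
  becomes \<open>\<alpha>\<^bsub>bar e\<^esub>(s)\<close>; then either \<open>g e\<close> is appended, or \<open>e\<close> cancels against the last edge.
\<close>

definition traverse :: "'e \<Rightarrow> ('a \<times> 'e) list \<times> 'a \<Rightarrow> ('a \<times> 'e) list \<times> 'a" where
  "traverse e = (\<lambda>(r, h). if backtracks r (coset_rep e h) e
     then (tl r, fst (hd r) \<otimes>\<^bsub>vgrp X (ter X e)\<^esub> emb X (bar X e) (edge_part e h))
     else ((coset_rep e h, e) # r, emb X (bar X e) (edge_part e h)))"

text \<open>
  Path group relations hold between all words, not only between words of composable letters. The
  letters act on the normal forms of paths by right multiplication whenever this makes sense;
  otherwise an element of a vertex group acts trivially. An edge \<open>e\<close> acts at \<open>t(e)\<close> as its inverse
  \<open>bar e\<close>, which makes it a permutation that exchanges the paths ending at \<open>i(e)\<close> with those ending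
  at \<open>t(e)\<close>. With this choice the action respects all relations.
\<close>

fun act :: "('v, 'e, 'a) letter \<Rightarrow> ('a \<times> 'e) list \<times> 'a \<Rightarrow> ('a \<times> 'e) list \<times> 'a" where
  "act (Elt x g) (r, h) = (if endpoint r = x then (r, h \<otimes>\<^bsub>vgrp X x\<^esub> g) else (r, h))"
| "act (Edge e) (r, h) =
     (if endpoint r = ini X e then traverse e (r, h)
      else if endpoint r = ter X e then traverse (bar X e) (r, h) else (r, h))"

lemma endpoint_vertex: "reduced r \<Longrightarrow> endpoint r \<in> vtx X"
  by (cases r rule: endpoint.cases) (auto simp: root)

lemma traverse_state:
  assumes e: "e \<in> edg X" and st: "(r, h) \<in> states" and r: "endpoint r = ini X e"
  shows "traverse e (r, h) \<in> states" "endpoint (fst (traverse e (r, h))) = ter X e"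
proof -
  have h: "h \<in> carrier (vgrp X (ini X e))" and red: "reduced r" using st r by (auto simp: states_def)
  interpret G': group "vgrp X (ter X e)" using e by (rule vgrp_ter)
  have "traverse e (r, h) \<in> states \<and> endpoint (fst (traverse e (r, h))) = ter X e"
  proof (cases "backtracks r (coset_rep e h) e")
    case True
    then obtain g' r' where r': "r = (g', bar X e) # r'"
      by (cases r) (auto simp: backtracks_def)
    then have "endpoint r' = ter X e" "reduced r'" "g' \<in> carrier (vgrp X (ter X e))"
      using red e transversal_closed[of "bar X e" g'] by auto
    then show ?thesis
      using True r' e edge_part(1)[OF e h] by (simp add: traverse_def states_def)
  next
    case False
    then show ?thesis
      using red e r edge_part(1)[OF e h] h by (simp add: traverse_def states_def transversal_def)
  qed
  then show "traverse e (r, h) \<in> states" "endpoint (fst (traverse e (r, h))) = ter X e" by auto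
qed

text \<open>
  This gives the relation \<open>e \<alpha>\<^bsub>bar e\<^esub>(s) (bar e) = \<alpha>\<^sub>e(s)\<close> for the action, and for \<open>s = 1\<close> the relation
  \<open>e (bar e) = 1\<close>.
\<close>

lemma traverse_back:
  assumes e: "e \<in> edg X" and st: "(r, h) \<in> states" and r: "endpoint r = ini X e"
    and s: "s \<in> carrier (egrp X e)" and tr: "traverse e (r, h) = (r1, h1)"
  shows "traverse (bar X e) (r1, h1 \<otimes>\<^bsub>vgrp X (ter X e)\<^esub> emb X (bar X e) s) =
    (r, h \<otimes>\<^bsub>vgrp X (ini X e)\<^esub> emb X e s)"
proof -
  have h: "h \<in> carrier (vgrp X (ini X e))" and red: "reduced r" using st r by (auto simp: states_def)
  interpret G': group "vgrp X (ter X e)" using e by (rule vgrp_ter)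
  interpret G: group "vgrp X (ini X e)" using e by (rule vgrp_ini)
  interpret S: group "egrp X e" using e by (rule egrp_group)
  define g t where "g = coset_rep e h" and "t = edge_part e h"
  have gc: "g \<in> carrier (vgrp X (ini X e))" using coset_rep_closed[OF e h] by (simp add: g_def)
  have t: "t \<in> carrier (egrp X e)" "g \<otimes>\<^bsub>vgrp X (ini X e)\<^esub> emb X e t = h"
    using edge_part[OF e h] by (simp_all add: g_def t_def)
  have ts: "t \<otimes>\<^bsub>egrp X e\<^esub> s \<in> carrier (egrp X (bar X e))" using e s t by (simp add: egrp_bar)
  have be: "bar X e \<in> edg X" "ini X (bar X e) = ter X e" using e by auto
  have out: "g \<otimes>\<^bsub>vgrp X (ini X e)\<^esub> emb X e (t \<otimes>\<^bsub>egrp X e\<^esub> s) = h \<otimes>\<^bsub>vgrp X (ini X e)\<^esub> emb X e s"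
    using e s t gc by (simp add: emb_mult G.m_assoc[symmetric])
  show ?thesis
  proof (cases "backtracks r g e")
    case True
    then obtain g' r' where r': "r = (g', bar X e) # r'"
      by (cases r) (auto simp: backtracks_def)
    have g1: "g = \<one>\<^bsub>vgrp X (ini X e)\<^esub>" using True by (simp add: backtracks_def)
    have g': "g' \<in> transversal (bar X e)" "\<not> backtracks r' g' (bar X e)"
      using red r' by auto
    have g'c: "g' \<in> carrier (vgrp X (ter X e))" using transversal_closed[OF be(1) g'(1)] be by simp
    have "r1 = r'" "h1 = g' \<otimes>\<^bsub>vgrp X (ter X e)\<^esub> emb X (bar X e) t"
      using tr True r' by (auto simp: traverse_def g_def t_def)
    then have "h1 \<otimes>\<^bsub>vgrp X (ter X e)\<^esub> emb X (bar X e) s =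
        g' \<otimes>\<^bsub>vgrp X (ter X e)\<^esub> emb X (bar X e) (t \<otimes>\<^bsub>egrp X e\<^esub> s)"
      using e s t g'c by (simp add: emb_bar_mult G'.m_assoc)
    then show ?thesis
      using decompose_unique[OF be(1) g'(1) ts] be g' r' g1 out e \<open>r1 = r'\<close> s t
      by (simp add: traverse_def)
  next
    case False
    have "r1 = (g, e) # r" "h1 = emb X (bar X e) t"
      using tr False by (auto simp: traverse_def g_def t_def)
    moreover have "h1 \<otimes>\<^bsub>vgrp X (ter X e)\<^esub> emb X (bar X e) s = emb X (bar X e) (t \<otimes>\<^bsub>egrp X e\<^esub> s)"
      using e s t by (simp add: emb_bar_mult \<open>h1 = _\<close>)
    ultimately show ?thesis
      using decompose_emb[OF be(1) ts] be out e
      by (simp add: traverse_def backtracks_def)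
  qed
qed

lemma traverse_bar:
  assumes e: "e \<in> edg X" and st: "(r, h) \<in> states" and r: "endpoint r = ini X e"
  shows "traverse (bar X e) (traverse e (r, h)) = (r, h)"
proof -
  obtain r1 h1 where tr: "traverse e (r, h) = (r1, h1)" by fastforce
  interpret G': group "vgrp X (ter X e)" using e by (rule vgrp_ter)
  interpret G: group "vgrp X (ini X e)" using e by (rule vgrp_ini)
  interpret S: group "egrp X e" using e by (rule egrp_group)
  have "h1 \<in> carrier (vgrp X (ter X e))" "h \<in> carrier (vgrp X (ini X e))"
    using traverse_state[OF e st r] st r tr by (auto simp: states_def)
  then show ?thesis
    using traverse_back[OF e st r S.one_closed tr] tr e
    by (simp add: emb_one emb_bar_one)
qed

lemma act_state:
  assumes "a \<in> letters X" "st \<in> states"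
  shows "act a st \<in> states"
proof -
  obtain r h where st: "st = (r, h)" by fastforce
  show ?thesis
  proof (cases a)
    case (Elt x g)
    then have "x \<in> vtx X" "g \<in> carrier (vgrp X x)" using assms(1) by (auto simp: letters_def)
    then show ?thesis
      using assms(2) st Elt vgrp_group[of x] by (auto simp: states_def group.is_monoid monoid.m_closed)
  next
    case (Edge e)
    then have "e \<in> edg X" using assms(1) by (auto simp: letters_def)
    then show ?thesis
      using assms(2) st Edge traverse_state[of e r h] traverse_state[of "bar X e" r h] by auto
  qed
qed

lemma run_state: "u \<in> lists (letters X) \<Longrightarrow> st \<in> states \<Longrightarrow> fold act u st \<in> states"
  by (induction u arbitrary: st) (auto simp: act_state)

text \<open>
  The action of the words factors through the path group. Acting on the empty path recovers a
  normal form from its class, as \<open>run_word\<close> shows.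
\<close>

lemma run_path_eq:
  assumes "path_eq X u v" "st \<in> states"
  shows "fold act u st = fold act v st"
  using assms
proof (induction arbitrary: st)
  case (append u v u' v')
  have "u \<in> lists (letters X)"
    using append.hyps(1) path_eq_lists finite_graph_of_groups_axioms by blast
  then have "fold act u st \<in> states" using run_state append.prems by blast
  then show ?case using append.IH(1)[OF append.prems] append.IH(2)[of "fold act u st"] by simp
next
  case (vertex_one x)
  obtain r h where st: "st = (r, h)" by fastforce
  then show ?case using vertex_one vgrp_group[of x] by (auto simp: states_def group.is_monoid)
next
  case (vertex_mult x g h)
  obtain r k where st: "st = (r, k)" by fastforce
  then show ?case
    using vertex_mult vgrp_group[of x] by (auto simp: states_def group.is_monoid monoid.m_assoc)
next
  case (edge_inv e)
  obtain r h where st: "st = (r, h)" by fastforce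
  obtain r1 h1 where tr: "traverse e (r, h) = (r1, h1)" by fastforce
  obtain r2 h2 where tr': "traverse (bar X e) (r, h) = (r2, h2)" by fastforce
  show ?case
    using edge_inv st tr tr' traverse_bar[of e r h] traverse_bar[of "bar X e" r h]
      traverse_state[of e r h] traverse_state[of "bar X e" r h]
    by auto
next
  case (edge_conj e s)
  obtain r h where st: "st = (r, h)" by fastforce
  obtain r1 h1 where tr: "traverse e (r, h) = (r1, h1)" by fastforce
  obtain r2 h2 where tr': "traverse (bar X e) (r, h) = (r2, h2)" by fastforce
  show ?case
    using edge_conj st tr tr' traverse_back[of e r h s r1 h1] traverse_bar[of "bar X e" r h]
      traverse_state[of e r h] traverse_state[of "bar X e" r h]
    by auto
qed auto

fun word :: "('a \<times> 'e) list \<Rightarrow> ('v, 'e, 'a) letter list" where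
  "word [] = []"
| "word ((g, e) # r) = word r @ [Elt (ini X e) g, Edge e]"

lemma word_letters: "reduced r \<Longrightarrow> word r \<in> lists (letters X)"
proof (induction r rule: word.induct)
  case (2 g e r)
  then have "e \<in> edg X" "g \<in> carrier (vgrp X (ini X e))"
    using transversal_closed[of e g] by auto
  then show ?case using 2 endpoint_vertex[of r] by (auto simp: letters_def)
qed simp

lemma run_word:
  "reduced r \<Longrightarrow> fold act (word r) ([], \<one>\<^bsub>vgrp X root\<^esub>) = (r, \<one>\<^bsub>vgrp X (endpoint r)\<^esub>)"
proof (induction r rule: word.induct)
  case (2 g e r)
  then have e: "e \<in> edg X" "ini X e = endpoint r" "g \<in> transversal e" "\<not> backtracks r g e" by auto
  interpret G: group "vgrp X (endpoint r)" using e vgrp_ini[of e] by simp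
  show ?case
    using 2 e transversal_closed[OF e(1,3)] decompose_transversal[OF e(1,3)]
    by (simp add: traverse_def emb_bar_one)
qed simp

lemma word_eq_imp_eq:
  assumes r: "reduced r" "reduced r'" and h: "h \<in> carrier (vgrp X (endpoint r))"
    and h': "h' \<in> carrier (vgrp X (endpoint r'))"
    and eq: "path_eq X (word r @ [Elt (endpoint r) h]) (word r' @ [Elt (endpoint r') h'])"
  shows "r = r'" "h = h'"
proof -
  have run: "fold act (word r @ [Elt (endpoint r) h]) ([], \<one>\<^bsub>vgrp X root\<^esub>) = (r, h)"
    if "reduced r" "h \<in> carrier (vgrp X (endpoint r))" for r h
    using that run_word[OF that(1)] vgrp_group[OF endpoint_vertex[OF that(1)]]
    by (simp add: group.is_monoid)
  have "([], \<one>\<^bsub>vgrp X root\<^esub>) \<in> states"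
    using root vgrp_group by (auto simp: states_def group.is_monoid)
  from run_path_eq[OF eq this] show "r = r'" "h = h'"
    using run[OF r(1) h] run[OF r(2) h'] by auto
qed

end

section \<open>The length distance of a rooted tree\<close>

definition l1_dist :: "('i \<Rightarrow> real) \<Rightarrow> ('i \<Rightarrow> real) \<Rightarrow> real" where
  "l1_dist f g = (\<Sum>i | f i \<noteq> g i. \<bar>f i - g i\<bar>)"

lemma l1_dist_superset: "finite A \<Longrightarrow> {i. f i \<noteq> g i} \<subseteq> A \<Longrightarrow> l1_dist f g = (\<Sum>i\<in>A. \<bar>f i - g i\<bar>)"
  unfolding l1_dist_def by (rule sum.mono_neutral_left) auto

lemma l1_dist_triangle:
  assumes "finite {i. f i \<noteq> 0}" "finite {i. g i \<noteq> 0}" "finite {i. h i \<noteq> (0::real)}"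
  shows "l1_dist f h \<le> l1_dist f g + l1_dist g h"
proof -
  let ?A = "{i. f i \<noteq> 0} \<union> {i. g i \<noteq> 0} \<union> {i. h i \<noteq> 0}"
  have A: "finite ?A" using assms by simp
  have "l1_dist f h = (\<Sum>i\<in>?A. \<bar>f i - h i\<bar>)" by (rule l1_dist_superset[OF A]) auto
  also have "\<dots> \<le> (\<Sum>i\<in>?A. \<bar>f i - g i\<bar> + \<bar>g i - h i\<bar>)" by (rule sum_mono) linarith
  also have "\<dots> = l1_dist f g + l1_dist g h"
    unfolding sum.distrib by (intro arg_cong2[where f = "(+)"] l1_dist_superset[OF A, symmetric]) auto
  finally show ?thesis .
qed

lemma l1_dist_eq_0:
  assumes "finite {i. f i \<noteq> 0}" "finite {i. g i \<noteq> (0::real)}"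
  shows "l1_dist f g = 0 \<longleftrightarrow> f = g"
proof
  assume "l1_dist f g = 0"
  moreover have fin: "finite {i. f i \<noteq> g i}"
    by (rule finite_subset[OF _ finite_UnI[OF assms]]) auto
  ultimately have "\<forall>i\<in>{i. f i \<noteq> g i}. \<bar>f i - g i\<bar> = 0"
    unfolding l1_dist_def by (subst (asm) sum_nonneg_eq_0_iff) auto
  then show "f = g" by auto
qed (simp add: l1_dist_def)

text \<open>
  A tree with a chosen root, given by an enumeration of its vertices. The vertices are enumerated by
  a set of lists closed under \<open>tl\<close>, where \<open>V r\<close> is a child of \<open>V (tl r)\<close> and \<open>V []\<close> is the root. The
  edge between \<open>V (tl r)\<close> and \<open>V r\<close> appears as two arcs, \<open>down r\<close> leading away from the root and
  \<open>up r\<close> leading towards it.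
\<close>

locale rooted_tree_model =
  fixes T :: "('p, 'q) pre_digraph" and rv :: "'q \<Rightarrow> 'q" and len :: "'q \<Rightarrow> real"
    and R :: "'n list set" and V :: "'n list \<Rightarrow> 'p" and down up :: "'n list \<Rightarrow> 'q"
  assumes Nil_node: "[] \<in> R" and tl_node: "r \<in> R \<Longrightarrow> tl r \<in> R"
    and vertices: "bij_betw V R (verts T)"
    and arcs_eq: "arcs T = down ` (R - {[]}) \<union> up ` (R - {[]})"
    and inj_down: "inj_on down (R - {[]})" and inj_up: "inj_on up (R - {[]})"
    and down_up_disjoint: "down ` (R - {[]}) \<inter> up ` (R - {[]}) = {}"
    and tail_down: "r \<in> R \<Longrightarrow> r \<noteq> [] \<Longrightarrow> tail T (down r) = V (tl r)"
    and head_down: "r \<in> R \<Longrightarrow> r \<noteq> [] \<Longrightarrow> head T (down r) = V r"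
    and tail_up: "r \<in> R \<Longrightarrow> r \<noteq> [] \<Longrightarrow> tail T (up r) = V r"
    and head_up: "r \<in> R \<Longrightarrow> r \<noteq> [] \<Longrightarrow> head T (up r) = V (tl r)"
    and rv_down: "r \<in> R \<Longrightarrow> r \<noteq> [] \<Longrightarrow> rv (down r) = up r"
    and rv_up: "r \<in> R \<Longrightarrow> r \<noteq> [] \<Longrightarrow> rv (up r) = down r"
    and len_up: "r \<in> R \<Longrightarrow> r \<noteq> [] \<Longrightarrow> len (up r) = len (down r)"
    and len_pos: "r \<in> R \<Longrightarrow> r \<noteq> [] \<Longrightarrow> len (down r) > 0"
begin

fun depth :: "'n list \<Rightarrow> real" where
  "depth [] = 0"
| "depth (a # r) = len (down (a # r)) + depth r"

text \<open>
  The embedding of the tree into the \<open>\<ell>\<^sup>1\<close> space over its edges: the coordinate of a point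
  with index \<open>r\<close> is the length of the part of the edge \<open>r\<close> that lies on the segment from the root to the
  point. On an edge only the coordinate of this edge varies, so edges are embedded isometrically, and
  the norm is the distance from the root.
\<close>

fun vcoord :: "'n list \<Rightarrow> 'n list \<Rightarrow> real" where
  "vcoord [] = (\<lambda>_. 0)"
| "vcoord (a # r) = (vcoord r)(a # r := len (down (a # r)))"

abbreviation ecoord :: "'n list \<Rightarrow> real \<Rightarrow> 'n list \<Rightarrow> real" where
  "ecoord r s \<equiv> (vcoord (tl r))(r := s)"

text \<open>
  The coordinates of the point on the edge \<open>r\<close> at distance \<open>s\<close> from its end nearer to the root are \<open>ecoord r s\<close>.
  An inner point is a set containing both of its descriptions, from which \<open>r\<close> and \<open>s\<close> are recovered.
\<close>

definition coord :: "('p, 'q) point \<Rightarrow> 'n list \<Rightarrow> real" where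
  "coord p = (case p of Vertex v \<Rightarrow> vcoord (inv_into R V v)
     | Inner I \<Rightarrow> (SOME c. \<exists>r s. r \<in> R - {[]} \<and> I = {(down r, s), (up r, len (down r) - s)} \<and> c = ecoord r s))"

abbreviation pts :: "('p, 'q) point set" where "pts \<equiv> realization T rv len"

abbreviation ept :: "'n list \<Rightarrow> real \<Rightarrow> ('p, 'q) point" where
  "ept r s \<equiv> edge_point T rv len (down r) s"

lemma depth_tl: "r \<noteq> [] \<Longrightarrow> depth r = depth (tl r) + len (down r)"
  by (cases r) auto

lemma vcoord_length: "vcoord r i \<noteq> 0 \<Longrightarrow> length i \<le> length r"
  by (induction r) (auto split: if_splits)

lemma vcoord_self: "r \<noteq> [] \<Longrightarrow> vcoord (tl r) r = 0"
  using vcoord_length[of "tl r" r] by (cases r) auto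

lemma finite_vcoord [simp]: "finite {i. vcoord r i \<noteq> 0}"
proof (induction r)
  case (Cons a r)
  show ?case by (rule finite_subset[of _ "insert (a # r) {i. vcoord r i \<noteq> 0}"]) (use Cons in auto)
qed simp

lemma finite_ecoord [simp]: "finite {i. ecoord r s i \<noteq> 0}"
  by (rule finite_subset[of _ "insert r {i. vcoord (tl r) i \<noteq> 0}"]) auto

lemma l1_ecoord: "r \<in> R \<Longrightarrow> r \<noteq> [] \<Longrightarrow> s \<ge> 0 \<Longrightarrow> l1_dist (\<lambda>_. 0) (ecoord r s) = depth (tl r) + s"
proof -
  have e: "l1_dist (\<lambda>_. 0) (ecoord r s) = l1_dist (\<lambda>_. 0) (vcoord (tl r)) + s"
    if "r \<noteq> []" "s \<ge> 0" for r s
  proof -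
    let ?A = "{i. vcoord (tl r) i \<noteq> 0}"
    have "l1_dist (\<lambda>_. 0) (ecoord r s) = (\<Sum>i\<in>insert r ?A. \<bar>0 - ecoord r s i\<bar>)"
      by (rule l1_dist_superset) auto
    also have "\<dots> = s + (\<Sum>i\<in>?A. \<bar>0 - ecoord r s i\<bar>)"
      using that vcoord_self[of r] by simp
    also have "(\<Sum>i\<in>?A. \<bar>0 - ecoord r s i\<bar>) = (\<Sum>i\<in>?A. \<bar>0 - vcoord (tl r) i\<bar>)"
      using vcoord_self[OF that(1)] by (intro sum.cong) auto
    also have "\<dots> = l1_dist (\<lambda>_. 0) (vcoord (tl r))"
      by (rule l1_dist_superset[symmetric]) auto
    finally show ?thesis by (simp only: add.commute)
  qed
  have v: "l1_dist (\<lambda>_. 0) (vcoord r) = depth r" if "r \<in> R" for r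
    using that
  proof (induction r)
    case (Cons a r)
    then show ?case
      using e[of "a # r" "len (down (a # r))"] len_pos[of "a # r"] tl_node[of "a # r"]
      by (simp del: fun_upd_apply)
  qed (simp add: l1_dist_def)
  show "l1_dist (\<lambda>_. 0) (ecoord r s) = depth (tl r) + s" if "r \<in> R" "r \<noteq> []" "s \<ge> 0"
    using e[of r s] v[of "tl r"] that tl_node by simp
qed

lemma ecoord_inj:
  assumes eq: "ecoord r s = ecoord r' s'" and s: "s > 0" "s' > 0" and r: "r \<noteq> []" "r' \<noteq> []"
  shows "r = r' \<and> s = s'"
proof -
  have le: "r = r' \<or> length r < length r'"
    if "ecoord r s = ecoord r' s'" "s > 0" "r' \<noteq> []" for r r' s s'
  proof (rule disjCI)
    assume "\<not> length r < length r'"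
    then have "vcoord (tl r') r = 0" using vcoord_length[of "tl r'" r] that(3) by (cases r') auto
    then show "r = r'" using fun_cong[OF that(1), of r] that(2) by (auto split: if_splits)
  qed
  have "r = r'" using le[OF eq s(1) r(2)] le[OF eq[symmetric] s(2) r(1)] by auto
  then show ?thesis using fun_cong[OF eq, of r] by simp
qed

text \<open>
  Both arcs of an edge parametrize the same points, so it suffices to treat the arcs \<open>down r\<close>.
\<close>

lemma edge_point_flip:
  assumes "r \<in> R" "r \<noteq> []"
  shows "edge_point T rv len (up r) s = ept r (len (down r) - s)"
  using assms len_pos[OF assms]
  by (auto simp: edge_point_def tail_down head_down tail_up head_up rv_down rv_up len_up)

lemma coord_vertex: "r \<in> R \<Longrightarrow> coord (Vertex (V r)) = vcoord r"
  using vertices by (simp add: coord_def bij_betw_def)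

lemma coord_ept:
  assumes r: "r \<in> R" "r \<noteq> []" and s: "0 \<le> s" "s \<le> len (down r)"
  shows "coord (ept r s) = ecoord r s"
proof -
  consider "s = 0" | "s = len (down r)" "s \<noteq> 0" | "s \<noteq> 0" "s \<noteq> len (down r)" by blast
  then show ?thesis
  proof cases
    case 1
    then show ?thesis
      using r vcoord_self[of r] tl_node[of r] by (auto simp: edge_point_def tail_down coord_vertex)
  next
    case 2
    then show ?thesis
      using r by (cases r) (auto simp: edge_point_def head_down coord_vertex)
  next
    case 3
    let ?I = "\<lambda>r s. {(down r, s), (up r, len (down r) - s)}"
    have "r' = r \<and> s' = s" if "r' \<in> R - {[]}" "?I r s = ?I r' s'" for r' s'
    proof -
      have "(down r, s) \<in> ?I r' s'" using that(2) by blast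
      moreover have "down r \<noteq> up r'" using down_up_disjoint r that(1) by auto
      ultimately have "down r = down r'" "s = s'" by auto
      then show ?thesis using inj_onD[OF inj_down] r that(1) by auto
    qed
    then have "(SOME c. \<exists>r' s'. r' \<in> R - {[]} \<and> ?I r s = ?I r' s' \<and> c = ecoord r' s') = ecoord r s"
      using r by (intro some_equality) auto
    then show ?thesis using 3 r by (simp add: edge_point_def coord_def rv_down)
  qed
qed

lemma ept_in: "r \<in> R \<Longrightarrow> r \<noteq> [] \<Longrightarrow> 0 \<le> s \<Longrightarrow> s \<le> len (down r) \<Longrightarrow> ept r s \<in> pts"
  unfolding realization_def arcs_eq by (rule UnI2, rule UN_I[of "down r"]) auto

lemma vertex_in: "r \<in> R \<Longrightarrow> Vertex (V r) \<in> pts"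
  using vertices by (auto simp: realization_def bij_betw_def)

lemma ept_0: "r \<in> R \<Longrightarrow> r \<noteq> [] \<Longrightarrow> ept r 0 = Vertex (V (tl r))"
  by (simp add: edge_point_def tail_down)

lemma ept_len: "r \<in> R \<Longrightarrow> r \<noteq> [] \<Longrightarrow> ept r (len (down r)) = Vertex (V r)"
  using len_pos[of r] by (simp add: edge_point_def head_down)

lemma point_cases:
  assumes "p \<in> pts"
  obtains "p = Vertex (V [])"
    | r s where "r \<in> R" "r \<noteq> []" "0 < s" "s \<le> len (down r)" "p = ept r s"
proof -
  note base = that(1) and inner = that(2)
  have vert: thesis if "r \<in> R" "p = Vertex (V r)" for r
  proof (cases "r = []")
    case False
    show ?thesis
      by (rule inner[of r "len (down r)"]) (use False that ept_len[of r] len_pos[of r] in auto)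
  qed (use that base in simp)
  have edge: thesis if "r \<in> R" "r \<noteq> []" "0 \<le> s" "s \<le> len (down r)" "p = ept r s" for r s
  proof (cases "s = 0")
    case True
    then show ?thesis using vert[of "tl r"] that tl_node ept_0 by simp
  next
    case False
    show ?thesis by (rule inner[of r s])
        (use False that in auto)
  qed
  from assms consider v where "v \<in> verts T" "p = Vertex v"
    | r s where "r \<in> R" "r \<noteq> []" "s \<in> {0..len (down r)}" "p = ept r s"
    | r s where "r \<in> R" "r \<noteq> []" "s \<in> {0..len (up r)}" "p = edge_point T rv len (up r) s"
    unfolding realization_def arcs_eq by blast
  then show thesis
  proof cases
    case 1
    then show ?thesis using vert vertices by (auto simp: bij_betw_def)
  next
    case 2
    then show ?thesis using edge by auto
  next
    case 3
    then show ?thesis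
      using edge[of r "len (down r) - s"] by (auto simp: edge_point_flip len_up)
  qed
qed

definition tree_dist :: "('p, 'q) point \<Rightarrow> ('p, 'q) point \<Rightarrow> real" where
  "tree_dist p q = l1_dist (coord p) (coord q)"

lemma coord_root: "coord (Vertex (V [])) = (\<lambda>_. 0)"
  using coord_vertex[OF Nil_node] by simp

lemma finite_coord: "p \<in> pts \<Longrightarrow> finite {i. coord p i \<noteq> 0}"
  by (erule point_cases) (simp_all add: coord_root coord_ept del: fun_upd_apply)

lemma coord_inj:
  assumes "p \<in> pts" "q \<in> pts" "coord p = coord q"
  shows "p = q"
proof -
  have nz: "ecoord r s \<noteq> (\<lambda>_. 0)" if "s > 0" for r s
    using that by (auto simp: fun_eq_iff)
  show ?thesis
    using assms(1)
  proof (cases rule: point_cases)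
    case 1
    from assms(2) show ?thesis
    proof (cases rule: point_cases)
      case (2 r s)
      then show ?thesis using assms(3) 1 nz[of s r] by (simp add: coord_root coord_ept del: fun_upd_apply)
    qed (use 1 in simp)
  next
    case p: (2 r s)
    from assms(2) show ?thesis
    proof (cases rule: point_cases)
      case 1
      then show ?thesis
        using assms(3) p nz[of s r] by (simp add: coord_root coord_ept del: fun_upd_apply)
    next
      case (2 r' s')
      then have "ecoord r s = ecoord r' s'"
        using assms(3) p by (simp add: coord_ept del: fun_upd_apply)
      then show ?thesis using ecoord_inj p 2 by blast
    qed
  qed
qed

lemma tree_dist_metric: "Metric_space pts tree_dist"
proof
  show "0 \<le> tree_dist p q" "tree_dist p q = tree_dist q p" for p q
    unfolding tree_dist_def l1_dist_def
    by (auto intro!: sum_nonneg sum.cong)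
next
  fix p q assume "p \<in> pts" "q \<in> pts"
  then show "tree_dist p q = 0 \<longleftrightarrow> p = q"
    unfolding tree_dist_def using l1_dist_eq_0[OF finite_coord finite_coord] coord_inj by auto
next
  fix p q z assume "p \<in> pts" "q \<in> pts" "z \<in> pts"
  then show "tree_dist p z \<le> tree_dist p q + tree_dist q z"
    unfolding tree_dist_def by (intro l1_dist_triangle finite_coord)
qed

lemma tree_dist_ept:
  assumes "r \<in> R" "r \<noteq> []" "0 \<le> s" "s \<le> len (down r)" "0 \<le> t" "t \<le> len (down r)"
  shows "tree_dist (ept r s) (ept r t) = \<bar>s - t\<bar>"
proof -
  have "l1_dist (ecoord r s) (ecoord r t) = (\<Sum>i\<in>{r}. \<bar>ecoord r s i - ecoord r t i\<bar>)"
    by (rule l1_dist_superset) auto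
  then show ?thesis using assms by (simp add: tree_dist_def coord_ept del: fun_upd_apply) simp
qed

lemma tree_dist_half_edge: "half_edge_isometric T rv len tree_dist"
  unfolding half_edge_isometric_def
proof (intro ballI)
  fix e s t assume e: "e \<in> arcs T" and s: "s \<in> {0..len e / 2}" and t: "t \<in> {0..len e / 2}"
  from e consider r where "r \<in> R" "r \<noteq> []" "e = down r" | r where "r \<in> R" "r \<noteq> []" "e = up r"
    unfolding arcs_eq by blast
  then show "tree_dist (edge_point T rv len e s) (edge_point T rv len e t) = \<bar>s - t\<bar>"
  proof cases
    case 1
    then show ?thesis using s t len_pos[of r] by (auto intro!: tree_dist_ept)
  next
    case 2
    have "tree_dist (ept r (len (down r) - s)) (ept r (len (down r) - t)) = \<bar>(len (down r) - s) - (len (down r) - t)\<bar>"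
      using 2 s t len_pos[of r] by (intro tree_dist_ept) (auto simp: len_up)
    then show ?thesis using 2 by (simp add: edge_point_flip)
  qed
qed

abbreviation metrics :: "(('p, 'q) point \<Rightarrow> ('p, 'q) point \<Rightarrow> real) set" where
  "metrics \<equiv> {d. Metric_space pts d \<and> half_edge_isometric T rv len d}"

lemma tree_dist_in_metrics: "tree_dist \<in> metrics"
  using tree_dist_metric tree_dist_half_edge by simp

text \<open>
  The half-edge condition controls a competing metric only up to the midpoint of an edge; beyond it,
  the condition for the reversed arc and the triangle inequality take over.
\<close>

lemma metrics_edge_bound:
  assumes d: "d \<in> metrics" and r: "r \<in> R" "r \<noteq> []" and s: "0 \<le> s" "s \<le> len (down r)"
  shows "d (Vertex (V (tl r))) (ept r s) \<le> s"
proof -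
  interpret Metric_space pts d using d by simp
  let ?L = "len (down r)"
  have half: "d (edge_point T rv len e s) (edge_point T rv len e t) = \<bar>s - t\<bar>"
    if "e \<in> arcs T" "s \<in> {0..len e / 2}" "t \<in> {0..len e / 2}" for e s t
    using d that by (auto simp: half_edge_isometric_def)
  have arcs: "down r \<in> arcs T" "up r \<in> arcs T" using r by (auto simp: arcs_eq)
  have L: "?L > 0" using len_pos[OF r] .
  have first: "d (ept r 0) (ept r s) \<le> s" if "0 \<le> s" "s \<le> ?L / 2" for s
    using half[OF arcs(1), of 0 s] that by simp
  have "d (ept r 0) (ept r s) \<le> s"
  proof (cases "s \<le> ?L / 2")
    case False
    have "d (edge_point T rv len (up r) (?L / 2)) (edge_point T rv len (up r) (?L - s)) = \<bar>?L / 2 - (?L - s)\<bar>"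
      using False s L r by (intro half[OF arcs(2)]) (auto simp: len_up)
    then have "d (ept r (?L / 2)) (ept r s) = s - ?L / 2"
      using False r by (simp add: edge_point_flip)
    moreover have "d (ept r 0) (ept r s) \<le> d (ept r 0) (ept r (?L / 2)) + d (ept r (?L / 2)) (ept r s)"
      using r s L by (intro triangle ept_in) auto
    ultimately show ?thesis using first[of "?L / 2"] L by simp
  qed (use first s in simp)
  then show ?thesis using ept_0[OF r] by simp
qed

lemma metrics_vertex_bound:
  assumes d: "d \<in> metrics" and r: "r \<in> R"
  shows "d (Vertex (V [])) (Vertex (V r)) \<le> depth r"
  using r
proof (induction r)
  case Nil
  interpret Metric_space pts d using d by simp
  show ?case using vertex_in[OF Nil_node] by simp
next
  case (Cons a r)
  interpret Metric_space pts d using d by simp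
  have r: "r \<in> R" using tl_node[OF Cons.prems] by simp
  have "d (Vertex (V r)) (Vertex (V (a # r))) \<le> len (down (a # r))"
    using metrics_edge_bound[OF d Cons.prems, of "len (down (a # r))"] len_pos[OF Cons.prems]
      ept_len[OF Cons.prems] by simp
  then show ?case
    using Cons.IH[OF r] triangle[OF vertex_in[OF Nil_node] vertex_in[OF r] vertex_in[OF Cons.prems]]
    by simp
qed

text \<open>
  Among the competing metrics, \<open>tree_dist\<close> is the largest one as far as distances from the root are
  concerned; the supremum defining the length distance is attained there.
\<close>

lemma metrics_root_bound:
  assumes d: "d \<in> metrics" and p: "p \<in> pts"
  shows "d (Vertex (V [])) p \<le> tree_dist (Vertex (V [])) p"
proof -
  interpret Metric_space pts d using d by simp
  show ?thesis
    using p
  proof (cases rule: point_cases)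
    case 1
    then show ?thesis
      using vertex_in[OF Nil_node] Metric_space.nonneg[OF tree_dist_metric] by simp
  next
    case (2 r s)
    have "d (Vertex (V [])) p \<le> d (Vertex (V [])) (Vertex (V (tl r))) + d (Vertex (V (tl r))) p"
      using 2 p Nil_node tl_node by (intro triangle vertex_in) auto
    also have "\<dots> \<le> depth (tl r) + s"
      using metrics_vertex_bound[OF d tl_node] metrics_edge_bound[OF d] 2 by (intro add_mono) auto
    also have "\<dots> = tree_dist (Vertex (V [])) p"
      using 2 by (simp add: tree_dist_def coord_root coord_ept l1_ecoord del: fun_upd_apply)
    finally show ?thesis .
  qed
qed

abbreviation length_dist :: "('p, 'q) point \<Rightarrow> ('p, 'q) point \<Rightarrow> real" where
  "length_dist \<equiv> length_distance T rv len"

lemma metrics_bdd: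
  assumes "p \<in> pts" "q \<in> pts"
  shows "bdd_above ((\<lambda>d. d p q) ` metrics)"
proof (rule bdd_aboveI2)
  fix d assume d: "d \<in> metrics"
  then interpret Metric_space pts d by simp
  have "d p q \<le> d (Vertex (V [])) p + d (Vertex (V [])) q"
    using triangle[OF assms(1) vertex_in[OF Nil_node] assms(2)] commute by simp
  then show "d p q \<le> tree_dist (Vertex (V [])) p + tree_dist (Vertex (V [])) q"
    using metrics_root_bound[OF d] assms by (meson add_mono order_trans)
qed

lemma length_dist_upper: "p \<in> pts \<Longrightarrow> q \<in> pts \<Longrightarrow> d \<in> metrics \<Longrightarrow> d p q \<le> length_dist p q"
  unfolding length_distance_def using metrics_bdd by (auto intro!: cSUP_upper)

lemma length_dist_least:
  "p \<in> pts \<Longrightarrow> q \<in> pts \<Longrightarrow> (\<And>d. d \<in> metrics \<Longrightarrow> d p q \<le> B) \<Longrightarrow> length_dist p q \<le> B"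
  unfolding length_distance_def using tree_dist_in_metrics by (auto intro!: cSUP_least)

lemma length_dist_metric: "Metric_space pts length_dist"
proof
  show "0 \<le> length_dist p q" for p q
  proof (cases "p \<in> pts \<and> q \<in> pts")
    case True
    then show ?thesis
      using length_dist_upper[OF _ _ tree_dist_in_metrics, of p q] Metric_space.nonneg[OF tree_dist_metric, of p q]
      by simp
  qed (auto simp: length_distance_def)
  show "length_dist p q = length_dist q p" for p q
  proof -
    have "(\<lambda>d. d p q) ` metrics = (\<lambda>d. d q p) ` metrics"
      using Metric_space.commute by (intro image_cong) fastforce+
    then show ?thesis unfolding length_distance_def by simp
  qed
next
  fix p q assume pq: "p \<in> pts" "q \<in> pts"
  show "length_dist p q = 0 \<longleftrightarrow> p = q"
  proof
    assume "length_dist p q = 0"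
    then have "tree_dist p q = 0"
      using length_dist_upper[OF pq tree_dist_in_metrics] Metric_space.nonneg[OF tree_dist_metric, of p q] by simp
    then show "p = q" using Metric_space.zero[OF tree_dist_metric pq] by simp
  next
    assume "p = q"
    then have "length_dist p q \<le> 0" using pq Metric_space.zero by (intro length_dist_least) fastforce+
    moreover have "tree_dist p q \<le> length_dist p q" using length_dist_upper[OF pq tree_dist_in_metrics] .
    ultimately show "length_dist p q = 0" using Metric_space.nonneg[OF tree_dist_metric, of p q] by simp
  qed
next
  fix p q z assume pqz: "p \<in> pts" "q \<in> pts" "z \<in> pts"
  show "length_dist p z \<le> length_dist p q + length_dist q z"
  proof (rule length_dist_least)
    fix d assume d: "d \<in> metrics"
    then interpret Metric_space pts d by simp
    have "d p z \<le> d p q + d q z" using triangle pqz by blast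
    also have "\<dots> \<le> length_dist p q + length_dist q z" using length_dist_upper d pqz by (intro add_mono) auto
    finally show "d p z \<le> length_dist p q + length_dist q z" .
  qed (use pqz in auto)
qed

lemma length_dist_root_ept:
  assumes "r \<in> R" "r \<noteq> []" "0 \<le> s" "s \<le> len (down r)"
  shows "length_dist (Vertex (V [])) (ept r s) = depth (tl r) + s"
proof -
  have "length_dist (Vertex (V [])) (ept r s) = tree_dist (Vertex (V [])) (ept r s)"
    using assms Nil_node
    by (intro antisym length_dist_least length_dist_upper metrics_root_bound tree_dist_in_metrics vertex_in ept_in)
  then show ?thesis
    using assms by (simp add: tree_dist_def coord_root coord_ept l1_ecoord del: fun_upd_apply)
qed

definition root_ball :: "real \<Rightarrow> ('p, 'q) point set" where
  "root_ball \<rho> = Metric_space.mcball pts length_dist (Vertex (V [])) \<rho>"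

lemma ept_in_root_ball:
  assumes "r \<in> R" "r \<noteq> []" "0 \<le> s" "s \<le> len (down r)"
  shows "ept r s \<in> root_ball \<rho> \<longleftrightarrow> depth (tl r) + s \<le> \<rho>"
  using assms Metric_space.in_mcball[OF length_dist_metric] vertex_in[OF Nil_node] ept_in length_dist_root_ept
  by (simp add: root_ball_def)

definition arc_in_ball :: "real \<Rightarrow> 'q \<Rightarrow> real" where
  "arc_in_ball \<rho> e = measure lborel {s \<in> {0..len e}. edge_point T rv len e s \<in> root_ball \<rho>}"

lemma arc_in_ball_down:
  assumes r: "r \<in> R" "r \<noteq> []"
  shows "arc_in_ball \<rho> (down r) = max 0 (min (len (down r)) (\<rho> - depth (tl r)))"
proof -
  have "{s \<in> {0..len (down r)}. ept r s \<in> root_ball \<rho>} = {0..min (len (down r)) (\<rho> - depth (tl r))}"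
    using ept_in_root_ball[OF r] by auto
  then show ?thesis unfolding arc_in_ball_def by (simp add: max_def)
qed

lemma arc_in_ball_up:
  assumes r: "r \<in> R" "r \<noteq> []"
  shows "arc_in_ball \<rho> (up r) = max 0 (min (len (down r)) (\<rho> - depth (tl r)))"
proof -
  let ?L = "len (down r)"
  have "{s \<in> {0..len (up r)}. edge_point T rv len (up r) s \<in> root_ball \<rho>} =
      {max 0 (depth (tl r) + ?L - \<rho>)..?L}"
    using ept_in_root_ball[OF r] by (auto simp: len_up[OF r] edge_point_flip[OF r])
  then show ?thesis unfolding arc_in_ball_def using len_pos[OF r] by (auto simp: max_def min_def)
qed

text \<open>
  Each edge contributes the length of its part within the ball, once for each of its two arcs; the
  factor one half in \<open>edges_length_in\<close> compensates for this.
\<close>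

lemma ball_length:
  assumes fin: "finite {r \<in> R - {[]}. depth (tl r) \<le> \<rho>}"
  shows "edges_length_in T rv len (root_ball \<rho>) =
    (\<Sum>r | r \<in> R - {[]} \<and> depth (tl r) \<le> \<rho>. min (len (down r)) (\<rho> - depth (tl r)))"
proof -
  let ?B = "{r \<in> R - {[]}. depth (tl r) \<le> \<rho>}"
  let ?g = "\<lambda>r. max 0 (min (len (down r)) (\<rho> - depth (tl r)))"
  have inj: "inj_on down ?B" "inj_on up ?B" using inj_down inj_up by (auto intro: inj_on_subset)
  have "(\<Sum>\<^sub>\<infinity>e\<in>arcs T. arc_in_ball \<rho> e) = (\<Sum>\<^sub>\<infinity>e\<in>down ` ?B \<union> up ` ?B. arc_in_ball \<rho> e)"
  proof (rule infsum_cong_neutral)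
    fix e assume "e \<in> arcs T - (down ` ?B \<union> up ` ?B)"
    then obtain r where "r \<in> R" "r \<noteq> []" "e = down r \<or> e = up r" "depth (tl r) > \<rho>"
      unfolding arcs_eq by fastforce
    moreover from this have "arc_in_ball \<rho> e = max 0 (min (len (down r)) (\<rho> - depth (tl r)))"
      using arc_in_ball_down arc_in_ball_up by blast
    ultimately show "arc_in_ball \<rho> e = 0" by simp
  qed (auto simp: arcs_eq)
  also have "\<dots> = (\<Sum>e\<in>down ` ?B \<union> up ` ?B. arc_in_ball \<rho> e)"
    using fin by (intro infsum_finite) auto
  also have "\<dots> = (\<Sum>e\<in>down ` ?B. arc_in_ball \<rho> e) + (\<Sum>e\<in>up ` ?B. arc_in_ball \<rho> e)"
    using fin down_up_disjoint by (intro sum.union_disjoint) auto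
  also have "\<dots> = (\<Sum>r\<in>?B. ?g r) + (\<Sum>r\<in>?B. ?g r)"
    unfolding sum.reindex[OF inj(1)] sum.reindex[OF inj(2)]
    by (intro arg_cong2[where f = "(+)"] sum.cong HOL.refl)
      (auto simp: arc_in_ball_down arc_in_ball_up)
  also have "(\<Sum>r\<in>?B. ?g r) = (\<Sum>r\<in>?B. min (len (down r)) (\<rho> - depth (tl r)))"
    by (intro sum.cong HOL.refl) (auto simp: max_def less_imp_le[OF len_pos])
  finally show ?thesis unfolding edges_length_in_def arc_in_ball_def by simp
qed

lemma ball_length_upper:
  assumes fin: "finite {r \<in> R - {[]}. depth (tl r) \<le> \<rho>}"
  shows "edges_length_in T rv len (root_ball \<rho>) \<le> (\<Sum>r | r \<in> R - {[]} \<and> depth (tl r) \<le> \<rho>. len (down r))"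
  unfolding ball_length[OF fin] by (rule sum_mono) simp

lemma ball_length_lower:
  assumes fin: "finite {r \<in> R - {[]}. depth (tl r) \<le> \<rho>}"
  shows "(\<Sum>r | r \<in> R - {[]} \<and> depth r \<le> \<rho>. len (down r)) \<le> edges_length_in T rv len (root_ball \<rho>)"
proof -
  have "(\<Sum>r | r \<in> R - {[]} \<and> depth r \<le> \<rho>. len (down r)) =
      (\<Sum>r | r \<in> R - {[]} \<and> depth r \<le> \<rho>. min (len (down r)) (\<rho> - depth (tl r)))"
    by (intro sum.cong HOL.refl) (auto simp: depth_tl)
  also have "\<dots> \<le> edges_length_in T rv len (root_ball \<rho>)"
    unfolding ball_length[OF fin]
  proof (intro sum_mono2 fin)
    show "{r \<in> R - {[]}. depth r \<le> \<rho>} \<subseteq> {r \<in> R - {[]}. depth (tl r) \<le> \<rho>}"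
      using len_pos by (fastforce simp: depth_tl)
  qed (auto simp: less_imp_le[OF len_pos])
  finally show ?thesis .
qed

end

section \<open>Calculating in the path group\<close>

context finite_graph_of_groups
begin

abbreviation P where "P \<equiv> path_group X"
abbreviation cls where "cls \<equiv> path_class X"

sublocale path: group P
  by (rule group_path_group) (rule finite_graph_of_groups_axioms)

lemma carrier_P: "carrier P = cls ` lists (letters X)"
  by (simp add: path_group_def)

lemma one_P: "\<one>\<^bsub>P\<^esub> = cls []"
  by (simp add: path_group_def)

lemma cls_closed: "u \<in> lists (letters X) \<Longrightarrow> cls u \<in> carrier P"
  unfolding carrier_P by (rule imageI)

lemma cls_append: "u \<in> lists (letters X) \<Longrightarrow> v \<in> lists (letters X) \<Longrightarrow> cls (u @ v) = cls u \<otimes>\<^bsub>P\<^esub> cls v"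
  by (simp only: path_class_mult)

lemma cls_eqD: "v \<in> lists (letters X) \<Longrightarrow> cls u = cls v \<Longrightarrow> path_eq X u v"
  using path_eq.refl[of v X] by (auto simp: path_class_def)

lemma Elt_letter: "x \<in> vtx X \<Longrightarrow> g \<in> carrier (vgrp X x) \<Longrightarrow> [Elt x g] \<in> lists (letters X)"
  by (auto simp: letters_def)

lemma Edge_letter: "e \<in> edg X \<Longrightarrow> [Edge e] \<in> lists (letters X)"
  by (auto simp: letters_def)

lemma vertex_elt_closed [simp]: "x \<in> vtx X \<Longrightarrow> g \<in> carrier (vgrp X x) \<Longrightarrow> vertex_elt X x g \<in> carrier P"
  unfolding vertex_elt_def by (intro cls_closed Elt_letter)

lemma edge_elt_closed [simp]: "e \<in> edg X \<Longrightarrow> edge_elt X e \<in> carrier P"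
  unfolding edge_elt_def by (intro cls_closed Edge_letter)

lemma vertex_elt_mult:
  assumes "x \<in> vtx X" "g \<in> carrier (vgrp X x)" "h \<in> carrier (vgrp X x)"
  shows "vertex_elt X x (g \<otimes>\<^bsub>vgrp X x\<^esub> h) = vertex_elt X x g \<otimes>\<^bsub>P\<^esub> vertex_elt X x h"
  unfolding vertex_elt_def
  using path_class_eqI[OF path_eq.vertex_mult[OF assms]] cls_append[OF Elt_letter Elt_letter] assms
  by simp

lemma vertex_elt_one: "x \<in> vtx X \<Longrightarrow> vertex_elt X x \<one>\<^bsub>vgrp X x\<^esub> = \<one>\<^bsub>P\<^esub>"
  unfolding vertex_elt_def one_P by (intro path_class_eqI path_eq.vertex_one)

lemma edge_elt_bar:
  assumes "e \<in> edg X"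
  shows "edge_elt X e \<otimes>\<^bsub>P\<^esub> edge_elt X (bar X e) = \<one>\<^bsub>P\<^esub>"
  unfolding edge_elt_def one_P
  using path_class_eqI[OF path_eq.edge_inv[OF assms]] cls_append[OF Edge_letter Edge_letter] assms
  by simp

text \<open>
  The defining relation of an edge, in the form in which it moves elements of the edge group from
  one side of the edge to the other.
\<close>

lemma edge_elt_slide:
  assumes e: "e \<in> edg X" and s: "s \<in> carrier (egrp X e)"
  shows "edge_elt X e \<otimes>\<^bsub>P\<^esub> vertex_elt X (ter X e) (emb X (bar X e) s) =
    vertex_elt X (ini X e) (emb X e s) \<otimes>\<^bsub>P\<^esub> edge_elt X e"
proof -
  let ?a = "edge_elt X e" and ?v = "vertex_elt X (ter X e) (emb X (bar X e) s)"
    and ?b = "edge_elt X (bar X e)" and ?w = "vertex_elt X (ini X e) (emb X e s)"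
  have c: "?a \<in> carrier P" "?b \<in> carrier P" "?v \<in> carrier P" using e s by simp_all
  have l: "[Edge e] \<in> lists (letters X)" "[Edge (bar X e)] \<in> lists (letters X)"
    "[Elt (ter X e) (emb X (bar X e) s)] \<in> lists (letters X)"
    using Edge_letter[OF e] Edge_letter[of "bar X e"] Elt_letter[of "ter X e" "emb X (bar X e) s"] e s by simp_all
  have "?a \<otimes>\<^bsub>P\<^esub> (?v \<otimes>\<^bsub>P\<^esub> ?b) = cls ([Edge e] @ ([Elt (ter X e) (emb X (bar X e) s)] @ [Edge (bar X e)]))"
    unfolding edge_elt_def vertex_elt_def using l by (simp only: cls_append append_in_lists_conv)
  also have "\<dots> = ?w"
    unfolding vertex_elt_def using path_class_eqI[OF path_eq.edge_conj[OF e s]] by simp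
  finally have "?w \<otimes>\<^bsub>P\<^esub> ?a = (?a \<otimes>\<^bsub>P\<^esub> ?v) \<otimes>\<^bsub>P\<^esub> (?b \<otimes>\<^bsub>P\<^esub> ?a)"
    using c by (simp add: path.m_assoc[symmetric])
  also have "?b \<otimes>\<^bsub>P\<^esub> ?a = \<one>\<^bsub>P\<^esub>" using edge_elt_bar[of "bar X e"] e by simp
  finally show ?thesis using c by simp
qed

lemma vertex_elt_hom: "x \<in> vtx X \<Longrightarrow> vertex_elt X x \<in> hom (vgrp X x) P"
  by (auto simp: hom_def vertex_elt_mult)

lemma vertex_subgroup: 
  assumes "x \<in> vtx X" shows "subgroup (vertex_subgroup X x) P"
proof -
  interpret group_hom "vgrp X x" P "vertex_elt X x"
    using assms by (intro group_hom.intro group_hom_axioms.intro vgrp_group path.is_group vertex_elt_hom)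
  show ?thesis unfolding vertex_subgroup_def by (rule img_is_subgroup)
qed

lemma edge_subgroup:
  assumes e: "e \<in> edg X" shows "subgroup (edge_subgroup X e) P"
proof -
  interpret group_hom "egrp X e" P "\<lambda>s. vertex_elt X (ini X e) (emb X e s)"
    using e by (intro group_hom.intro group_hom_axioms.intro egrp_group path.is_group)
      (auto simp: hom_def emb_mult vertex_elt_mult)
  show ?thesis unfolding edge_subgroup_def by (rule img_is_subgroup)
qed

lemma edge_subgroup_le: "e \<in> edg X \<Longrightarrow> edge_subgroup X e \<subseteq> vertex_subgroup X (ini X e)"
  by (auto simp: edge_subgroup_def vertex_subgroup_def)

lemma coset_times_vertex_subgroup:
  assumes e: "e \<in> edg X" and p: "p \<in> carrier P"
  shows "(p <#\<^bsub>P\<^esub> edge_subgroup X e) <#>\<^bsub>P\<^esub> vertex_subgroup X (ini X e) = p <#\<^bsub>P\<^esub> vertex_subgroup X (ini X e)"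
proof -
  interpret H: subgroup "vertex_subgroup X (ini X e)" P using e by (intro vertex_subgroup) auto
  show ?thesis
  proof
    show "(p <#\<^bsub>P\<^esub> edge_subgroup X e) <#>\<^bsub>P\<^esub> vertex_subgroup X (ini X e) \<subseteq> p <#\<^bsub>P\<^esub> vertex_subgroup X (ini X e)"
    proof
      fix x assume "x \<in> (p <#\<^bsub>P\<^esub> edge_subgroup X e) <#>\<^bsub>P\<^esub> vertex_subgroup X (ini X e)"
      then obtain s h where sh: "s \<in> edge_subgroup X e" "h \<in> vertex_subgroup X (ini X e)"
          "x = (p \<otimes>\<^bsub>P\<^esub> s) \<otimes>\<^bsub>P\<^esub> h" by (auto simp: l_coset_def set_mult_def)
      then have "s \<in> vertex_subgroup X (ini X e)" using edge_subgroup_le[OF e] by blast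
      then have "x = p \<otimes>\<^bsub>P\<^esub> (s \<otimes>\<^bsub>P\<^esub> h)" "s \<otimes>\<^bsub>P\<^esub> h \<in> vertex_subgroup X (ini X e)"
        using sh p by (simp_all add: path.m_assoc)
      then show "x \<in> p <#\<^bsub>P\<^esub> vertex_subgroup X (ini X e)" unfolding l_coset_def by blast
    qed
    show "p <#\<^bsub>P\<^esub> vertex_subgroup X (ini X e) \<subseteq> (p <#\<^bsub>P\<^esub> edge_subgroup X e) <#>\<^bsub>P\<^esub> vertex_subgroup X (ini X e)"
    proof
      fix x assume "x \<in> p <#\<^bsub>P\<^esub> vertex_subgroup X (ini X e)"
      then obtain h where h: "h \<in> vertex_subgroup X (ini X e)" "x = p \<otimes>\<^bsub>P\<^esub> h" by (auto simp: l_coset_def)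
      have "p \<in> p <#\<^bsub>P\<^esub> edge_subgroup X e" by (rule path.lcos_self[OF p edge_subgroup[OF e]])
      then show "x \<in> (p <#\<^bsub>P\<^esub> edge_subgroup X e) <#>\<^bsub>P\<^esub> vertex_subgroup X (ini X e)"
        using h unfolding set_mult_def by blast
    qed
  qed
qed

text \<open>
  The coset on the right is the reversed edge of the tree.
\<close>

lemma coset_times_edge_elt:
  assumes e: "e \<in> edg X" and p: "p \<in> carrier P"
  shows "(p <#\<^bsub>P\<^esub> edge_subgroup X e) #>\<^bsub>P\<^esub> edge_elt X e = (p \<otimes>\<^bsub>P\<^esub> edge_elt X e) <#\<^bsub>P\<^esub> edge_subgroup X (bar X e)"
proof -
  have "p \<otimes>\<^bsub>P\<^esub> vertex_elt X (ini X e) (emb X e s) \<otimes>\<^bsub>P\<^esub> edge_elt X e =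
      p \<otimes>\<^bsub>P\<^esub> edge_elt X e \<otimes>\<^bsub>P\<^esub> vertex_elt X (ter X e) (emb X (bar X e) s)"
    if "s \<in> carrier (egrp X e)" for s
    using edge_elt_slide[OF e that] e p that by (simp add: path.m_assoc)
  then show ?thesis
    using e by (auto simp: l_coset_def r_coset_def edge_subgroup_def egrp_bar)
qed

lemma path_word_letters: "path_word X x w y \<Longrightarrow> w \<in> lists (letters X)"
  by (induction rule: path_word.induct) (auto simp: letters_def)

lemma path_elts_closed: "p \<in> path_elts X x y \<Longrightarrow> p \<in> carrier P"
  by (auto simp: path_elts_def intro!: cls_closed path_word_letters)

lemma path_elts_vertex: "x \<in> vtx X \<Longrightarrow> g \<in> carrier (vgrp X x) \<Longrightarrow> vertex_elt X x g \<in> path_elts X x x"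
  by (auto simp: path_elts_def vertex_elt_def intro: path_word.start)

lemma path_elts_edge_vertex:
  assumes p: "p \<in> path_elts X x (ini X e)" and e: "e \<in> edg X" and g: "g \<in> carrier (vgrp X (ter X e))"
  shows "p \<otimes>\<^bsub>P\<^esub> edge_elt X e \<otimes>\<^bsub>P\<^esub> vertex_elt X (ter X e) g \<in> path_elts X x (ter X e)"
proof -
  obtain w where w: "path_word X x w (ini X e)" "p = cls w" using p by (auto simp: path_elts_def)
  have "cls ((w @ [Edge e]) @ [Elt (ter X e) g]) = p \<otimes>\<^bsub>P\<^esub> edge_elt X e \<otimes>\<^bsub>P\<^esub> vertex_elt X (ter X e) g"
    unfolding w(2) edge_elt_def vertex_elt_def
    using path_word_letters[OF w(1)] e g Edge_letter[OF e] Elt_letter[of "ter X e" g]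
    by (subst cls_append, simp_all) (subst cls_append, simp_all)
  then show ?thesis
    using path_word.step[OF w(1) e g] by (force simp: path_elts_def)
qed

text \<open>
  Induction along a path without reference to words.
\<close>

lemma path_elts_induct [consumes 1, case_names vertex edge]:
  assumes "p \<in> path_elts X x y"
    and "\<And>g. g \<in> carrier (vgrp X x) \<Longrightarrow> Q x (vertex_elt X x g)"
    and "\<And>p e g. p \<in> path_elts X x (ini X e) \<Longrightarrow> Q (ini X e) p \<Longrightarrow> e \<in> edg X \<Longrightarrow>
      g \<in> carrier (vgrp X (ter X e)) \<Longrightarrow>
      Q (ter X e) (p \<otimes>\<^bsub>P\<^esub> edge_elt X e \<otimes>\<^bsub>P\<^esub> vertex_elt X (ter X e) g)"
  shows "Q y p"
proof -
  obtain w where w: "path_word X x w y" "p = cls w" using assms(1) by (auto simp: path_elts_def)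
  have "Q y (cls w)" using w(1)
  proof (induction rule: path_word.induct)
    case (start g)
    then show ?case using assms(2) by (simp add: vertex_elt_def)
  next
    case (step w e g)
    have "cls ((w @ [Edge e]) @ [Elt (ter X e) g]) = cls w \<otimes>\<^bsub>P\<^esub> edge_elt X e \<otimes>\<^bsub>P\<^esub> vertex_elt X (ter X e) g"
      unfolding edge_elt_def vertex_elt_def
      using path_word_letters[OF step(1)] step Edge_letter[of e] Elt_letter[of "ter X e" g]
      by (subst cls_append, simp_all) (subst cls_append, simp_all)
    then show ?case using assms(3)[of "cls w" e g] step by (auto simp: path_elts_def)
  qed
  then show ?thesis using w by simp
qed

lemma path_elts_endpoints:
  assumes "p \<in> path_elts X x y" shows "x \<in> vtx X" "y \<in> vtx X"
proof -
  obtain w where "path_word X x w y" using assms by (auto simp: path_elts_def)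
  then have "x \<in> vtx X \<and> y \<in> vtx X" by (induction rule: path_word.induct) auto
  then show "x \<in> vtx X" "y \<in> vtx X" by auto
qed

lemma path_elts_mult_vertex:
  assumes "p \<in> path_elts X x y" "g \<in> carrier (vgrp X y)"
  shows "p \<otimes>\<^bsub>P\<^esub> vertex_elt X y g \<in> path_elts X x y"
  using assms
proof (induction arbitrary: g rule: path_elts_induct)
  case (vertex h)
  then have x: "x \<in> vtx X" using path_elts_endpoints assms by auto
  then show ?case
    using vertex vgrp_group[OF x] path_elts_vertex[OF x]
    by (simp add: vertex_elt_mult[symmetric] group.is_monoid monoid.m_closed)
next
  case (edge p e h)
  have "p \<otimes>\<^bsub>P\<^esub> edge_elt X e \<otimes>\<^bsub>P\<^esub> vertex_elt X (ter X e) (h \<otimes>\<^bsub>vgrp X (ter X e)\<^esub> g) \<in> path_elts X x (ter X e)"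
    using edge vgrp_ter[of e] by (intro path_elts_edge_vertex) (auto simp: group.is_monoid monoid.m_closed)
  then show ?case
    using edge path_elts_closed[of p] by (simp add: vertex_elt_mult path.m_assoc)
qed

lemma path_elts_mult_edge:
  assumes "p \<in> path_elts X x (ini X e)" "e \<in> edg X"
  shows "p \<otimes>\<^bsub>P\<^esub> edge_elt X e \<in> path_elts X x (ter X e)"
  using path_elts_edge_vertex[OF assms, of "\<one>\<^bsub>vgrp X (ter X e)\<^esub>"] assms vgrp_ter[of e] path_elts_closed[of p]
  by (simp add: vertex_elt_one group.is_monoid)

lemma path_elts_mult:
  assumes p: "p \<in> path_elts X x y" and q: "q \<in> path_elts X y z"
  shows "p \<otimes>\<^bsub>P\<^esub> q \<in> path_elts X x z"
  using q
proof (induction rule: path_elts_induct)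
  case (vertex g)
  then show ?case using path_elts_mult_vertex[OF p] by simp
next
  case (edge q e g)
  have "p \<otimes>\<^bsub>P\<^esub> q \<otimes>\<^bsub>P\<^esub> edge_elt X e \<otimes>\<^bsub>P\<^esub> vertex_elt X (ter X e) g \<in> path_elts X x (ter X e)"
    using edge by (intro path_elts_edge_vertex)
  then show ?case
    using edge path_elts_closed[OF p] path_elts_closed[OF edge(1)] by (simp add: path.m_assoc)
qed

lemma path_elts_inv:
  assumes p: "p \<in> path_elts X x y"
  shows "inv\<^bsub>P\<^esub> p \<in> path_elts X y x"
  using p
proof (induction rule: path_elts_induct)
  case (vertex g)
  have x: "x \<in> vtx X" using path_elts_endpoints[OF p] by simp
  interpret group_hom "vgrp X x" P "vertex_elt X x"
    using x by (intro group_hom.intro group_hom_axioms.intro vgrp_group path.is_group vertex_elt_hom)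
  show ?case
    using vertex path_elts_vertex[OF x, of "inv\<^bsub>vgrp X x\<^esub> g"] by simp
next
  case (edge p e g)
  interpret group_hom "vgrp X (ter X e)" P "vertex_elt X (ter X e)"
    using edge by (intro group_hom.intro group_hom_axioms.intro vgrp_ter path.is_group vertex_elt_hom) auto
  have "vertex_elt X (ter X e) (inv\<^bsub>vgrp X (ter X e)\<^esub> g) \<otimes>\<^bsub>P\<^esub> edge_elt X (bar X e) \<in> path_elts X (ter X e) (ini X e)"
    using path_elts_mult_edge[of _ "ter X e" "bar X e"] edge path_elts_vertex[of "ter X e" "inv\<^bsub>vgrp X (ter X e)\<^esub> g"]
    by simp
  from path_elts_mult[OF this edge.IH]
  have *: "vertex_elt X (ter X e) (inv\<^bsub>vgrp X (ter X e)\<^esub> g) \<otimes>\<^bsub>P\<^esub> edge_elt X (bar X e) \<otimes>\<^bsub>P\<^esub> inv\<^bsub>P\<^esub> p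
      \<in> path_elts X (ter X e) x" .
  have "edge_elt X (bar X e) = inv\<^bsub>P\<^esub> (edge_elt X e)"
    using path.inv_equality[OF edge_elt_bar[of "bar X e"]] edge by simp
  then show ?case
    using * edge path_elts_closed[OF edge(1)] by (simp add: path.inv_mult_group path.m_assoc)
qed

end

context rooted_graph_of_groups
begin

definition normal_class :: "('a \<times> 'e) list \<Rightarrow> ('v, 'e, 'a) letter list set" where
  "normal_class r = cls (word r)"

lemma normal_class_Nil [simp]: "normal_class [] = \<one>\<^bsub>P\<^esub>"
  by (simp add: normal_class_def one_P)

lemma normal_class_Cons:
  assumes "reduced ((g, e) # r)"
  shows "normal_class ((g, e) # r) = normal_class r \<otimes>\<^bsub>P\<^esub> vertex_elt X (ini X e) g \<otimes>\<^bsub>P\<^esub> edge_elt X e"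
proof -
  have l: "word r \<in> lists (letters X)" "[Elt (ini X e) g] \<in> lists (letters X)" "[Edge e] \<in> lists (letters X)"
    using assms word_letters[of r] transversal_closed[of e g] Edge_letter[of e] Elt_letter[of "ini X e" g]
      endpoint_vertex[of r] by simp_all
  have "cls ((word r @ [Elt (ini X e) g]) @ [Edge e]) =
      normal_class r \<otimes>\<^bsub>P\<^esub> vertex_elt X (ini X e) g \<otimes>\<^bsub>P\<^esub> edge_elt X e"
    unfolding normal_class_def vertex_elt_def edge_elt_def using l
    by (simp only: cls_append append_in_lists_conv)
  then show ?thesis by (simp add: normal_class_def)
qed

lemma normal_class_path: "reduced r \<Longrightarrow> normal_class r \<in> path_elts X root (endpoint r)"
proof (induction r rule: word.induct)
  case 1
  then show ?case
    using path_elts_vertex[OF root, of "\<one>\<^bsub>vgrp X root\<^esub>"] vgrp_group[OF root] root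
    by (simp add: vertex_elt_one group.is_monoid)
next
  case (2 g e r)
  then have "normal_class r \<in> path_elts X root (ini X e)" "g \<in> carrier (vgrp X (ini X e))" "e \<in> edg X"
    using transversal_closed[of e g] by auto
  then show ?case
    unfolding normal_class_Cons[OF 2(2)] by (auto intro: path_elts_mult_vertex path_elts_mult_edge)
qed

lemma normal_class_closed [simp]: "reduced r \<Longrightarrow> normal_class r \<in> carrier P"
  using normal_class_path path_elts_closed by blast

text \<open>
  The action on normal forms is right multiplication in the path group.
\<close>

lemma normal_class_traverse:
  assumes e: "e \<in> edg X" and st: "(r, h) \<in> states" and r: "endpoint r = ini X e"
    and tr: "traverse e (r, h) = (r', h')"
  shows "normal_class r' \<otimes>\<^bsub>P\<^esub> vertex_elt X (ter X e) h' = normal_class r \<otimes>\<^bsub>P\<^esub> vertex_elt X (ini X e) h \<otimes>\<^bsub>P\<^esub> edge_elt X e"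
proof -
  have h: "h \<in> carrier (vgrp X (ini X e))" and red: "reduced r" using st r by (auto simp: states_def)
  define g t where "g = coset_rep e h" and "t = edge_part e h"
  have gc: "g \<in> carrier (vgrp X (ini X e))" using coset_rep_closed[OF e h] by (simp add: g_def)
  have t: "t \<in> carrier (egrp X e)" "g \<otimes>\<^bsub>vgrp X (ini X e)\<^esub> emb X e t = h"
    using edge_part[OF e h] by (simp_all add: g_def t_def)
  let ?v = "vertex_elt X (ini X e)" and ?w = "vertex_elt X (ter X e)"
  have h_eq: "?v h = ?v g \<otimes>\<^bsub>P\<^esub> ?v (emb X e t)"
    using t gc e by (simp add: vertex_elt_mult[symmetric])
  have slide: "?v h \<otimes>\<^bsub>P\<^esub> edge_elt X e = ?v g \<otimes>\<^bsub>P\<^esub> edge_elt X e \<otimes>\<^bsub>P\<^esub> ?w (emb X (bar X e) t)"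
    using t gc e by (simp add: h_eq path.m_assoc edge_elt_slide)
  show ?thesis
  proof (cases "backtracks r g e")
    case True
    then obtain k q where q: "r = (k, bar X e) # q"
      by (cases r) (auto simp: backtracks_def)
    have g1: "g = \<one>\<^bsub>vgrp X (ini X e)\<^esub>" using True by (simp add: backtracks_def)
    have k: "k \<in> carrier (vgrp X (ter X e))" "reduced q"
      using red q e transversal_closed[of "bar X e" k] by auto
    have r': "r' = q" "h' = k \<otimes>\<^bsub>vgrp X (ter X e)\<^esub> emb X (bar X e) t"
      using tr True q by (auto simp: traverse_def g_def t_def)
    have "normal_class r = normal_class q \<otimes>\<^bsub>P\<^esub> ?w k \<otimes>\<^bsub>P\<^esub> edge_elt X (bar X e)"
      using normal_class_Cons[of k "bar X e" q] red q e by simp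
    then have "normal_class r \<otimes>\<^bsub>P\<^esub> ?v h \<otimes>\<^bsub>P\<^esub> edge_elt X e =
        normal_class q \<otimes>\<^bsub>P\<^esub> ?w k \<otimes>\<^bsub>P\<^esub> (edge_elt X (bar X e) \<otimes>\<^bsub>P\<^esub> edge_elt X e) \<otimes>\<^bsub>P\<^esub> ?w (emb X (bar X e) t)"
      using slide g1 e k t h gc by (simp add: path.m_assoc vertex_elt_one)
    also have "edge_elt X (bar X e) \<otimes>\<^bsub>P\<^esub> edge_elt X e = \<one>\<^bsub>P\<^esub>"
      using edge_elt_bar[of "bar X e"] e by simp
    finally show ?thesis
      using r' k e t by (simp add: vertex_elt_mult path.m_assoc)
  next
    case False
    then have r': "r' = (g, e) # r" "h' = emb X (bar X e) t"
      using tr by (auto simp: traverse_def g_def t_def)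
    have "reduced r'"
      using r' False red e r h by (simp add: g_def transversal_def)
    then have "normal_class r' = normal_class r \<otimes>\<^bsub>P\<^esub> (?v g \<otimes>\<^bsub>P\<^esub> edge_elt X e)"
      using r' normal_class_Cons[of g e r] red gc e endpoint_vertex[OF red] by (simp add: path.m_assoc)
    then have "normal_class r' \<otimes>\<^bsub>P\<^esub> ?w h' = normal_class r \<otimes>\<^bsub>P\<^esub> (?v g \<otimes>\<^bsub>P\<^esub> edge_elt X e \<otimes>\<^bsub>P\<^esub> ?w h')"
      using r' red gc e t by (simp add: path.m_assoc)
    also have "\<dots> = normal_class r \<otimes>\<^bsub>P\<^esub> (?v h \<otimes>\<^bsub>P\<^esub> edge_elt X e)" using slide r' by simp
    finally show ?thesis using red e h by (simp add: path.m_assoc)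
  qed
qed

lemma path_elts_normal_form:
  assumes "p \<in> path_elts X root y"
  shows "\<exists>r h. reduced r \<and> endpoint r = y \<and> h \<in> carrier (vgrp X y) \<and> p = normal_class r \<otimes>\<^bsub>P\<^esub> vertex_elt X y h"
  using assms
proof (induction rule: path_elts_induct)
  case (vertex g)
  then show ?case using root by (intro exI[of _ "[]"] exI[of _ g]) auto
next
  case (edge p e g)
  then obtain r h where r: "reduced r" "endpoint r = ini X e" "h \<in> carrier (vgrp X (ini X e))"
      "p = normal_class r \<otimes>\<^bsub>P\<^esub> vertex_elt X (ini X e) h" by blast
  obtain r' h' where tr: "traverse e (r, h) = (r', h')" by fastforce
  have st: "(r, h) \<in> states" using r by (simp add: states_def)
  have r': "reduced r'" "endpoint r' = ter X e" "h' \<in> carrier (vgrp X (ter X e))"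
    using traverse_state[OF edge.hyps(2) st r(2)] tr by (auto simp: states_def)
  have "p \<otimes>\<^bsub>P\<^esub> edge_elt X e \<otimes>\<^bsub>P\<^esub> vertex_elt X (ter X e) g =
      normal_class r' \<otimes>\<^bsub>P\<^esub> vertex_elt X (ter X e) (h' \<otimes>\<^bsub>vgrp X (ter X e)\<^esub> g)"
    using normal_class_traverse[OF edge.hyps(2) st r(2) tr, symmetric] r r' edge
    by (simp add: vertex_elt_mult path.m_assoc)
  then show ?case
    using r' edge vgrp_ter[of e]
    by (intro exI[of _ r'] exI[of _ "h' \<otimes>\<^bsub>vgrp X (ter X e)\<^esub> g"]) (simp add: group.is_monoid monoid.m_closed)
qed

text \<open>
  Two normal forms with the same class agree, because the class determines the action on the empty
  path, and a normal form sends the empty path to itself.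
\<close>

lemma normal_form_unique:
  assumes r: "reduced r" "reduced r'" "endpoint r = endpoint r'"
    and h: "h \<in> carrier (vgrp X (endpoint r))" "h' \<in> carrier (vgrp X (endpoint r))"
    and eq: "normal_class r \<otimes>\<^bsub>P\<^esub> vertex_elt X (endpoint r) h = normal_class r' \<otimes>\<^bsub>P\<^esub> vertex_elt X (endpoint r) h'"
  shows "r = r'" "h = h'"
proof -
  have l: "[Elt (endpoint r) h] \<in> lists (letters X)" "[Elt (endpoint r) h'] \<in> lists (letters X)"
    using Elt_letter[OF endpoint_vertex[OF r(1)]] h by simp_all
  have "cls (word r @ [Elt (endpoint r) h]) = cls (word r' @ [Elt (endpoint r) h'])"
    using eq l word_letters r unfolding normal_class_def vertex_elt_def by (simp only: cls_append)
  moreover have "word r' @ [Elt (endpoint r) h'] \<in> lists (letters X)"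
    using l word_letters[OF r(2)] by simp
  ultimately have "path_eq X (word r @ [Elt (endpoint r) h]) (word r' @ [Elt (endpoint r') h'])"
    using cls_eqD r by simp
  from word_eq_imp_eq[OF r(1,2) h(1) _ this] h(2) r(3) show "r = r'" "h = h'" by auto
qed

end

section \<open>The Bass--Serre tree as a rooted tree\<close>

text \<open>
  The tree seen from an arbitrary vertex \<open>p\<^sub>0 G\<^bsub>root\<^esub>\<close>, the centre of the balls; the base vertex of the tree
  is the initial vertex of \<open>p\<^sub>0\<close>. The paths from the base vertex are the products of \<open>p\<^sub>0\<close> with paths from
  \<open>root\<close>, so the vertices of the tree are enumerated by the normal forms of the latter.
\<close>

locale rooted_bass_serre_tree = rooted_graph_of_groups X root
  for X :: "('v, 'e, 'a, 'b) graph_of_groups" and root :: 'v +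
  fixes base_vertex :: 'v and p0 :: "('v, 'e, 'a) letter list set"
  assumes p0: "p0 \<in> path_elts X base_vertex root"
begin

abbreviation T where "T \<equiv> bs_tree X base_vertex"

definition V :: "('a \<times> 'e) list \<Rightarrow> 'v \<times> ('v, 'e, 'a) letter list set set" where
  "V r = (endpoint r, (p0 \<otimes>\<^bsub>P\<^esub> normal_class r) <#\<^bsub>P\<^esub> vertex_subgroup X (endpoint r))"

definition tree_arc :: "('a \<times> 'e) list \<Rightarrow> 'a \<Rightarrow> 'e \<Rightarrow> 'e \<times> ('v, 'e, 'a) letter list set set" where
  "tree_arc r g e = (e, (p0 \<otimes>\<^bsub>P\<^esub> normal_class r \<otimes>\<^bsub>P\<^esub> vertex_elt X (ini X e) g) <#\<^bsub>P\<^esub> edge_subgroup X e)"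

definition down :: "('a \<times> 'e) list \<Rightarrow> 'e \<times> ('v, 'e, 'a) letter list set set" where
  "down r = tree_arc (tl r) (fst (hd r)) (snd (hd r))"

definition up :: "('a \<times> 'e) list \<Rightarrow> 'e \<times> ('v, 'e, 'a) letter list set set" where
  "up r = (let e = bar X (snd (hd r)) in tree_arc r \<one>\<^bsub>vgrp X (ini X e)\<^esub> e)"

text \<open>
  The edges of the tree that issue from the vertex \<open>V r\<close>, including the one towards the root.
\<close>

definition turns :: "('a \<times> 'e) list \<Rightarrow> ('a \<times> 'e) set" where
  "turns r = {(g, e). e \<in> edg X \<and> ini X e = endpoint r \<and> g \<in> transversal e}"

lemma turnsD: "(g, e) \<in> turns r \<Longrightarrow> e \<in> edg X" "(g, e) \<in> turns r \<Longrightarrow> endpoint r = ini X e"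
  "(g, e) \<in> turns r \<Longrightarrow> g \<in> transversal e" "(g, e) \<in> turns r \<Longrightarrow> g \<in> carrier (vgrp X (ini X e))"
  using transversal_closed[of e g] by (auto simp: turns_def)

lemma reduced_Cons_iff: "reduced ((g, e) # r) \<longleftrightarrow> reduced r \<and> (g, e) \<in> turns r \<and> \<not> backtracks r g e"
  by (auto simp: turns_def)

lemma reduced_ConsE:
  assumes "reduced r" "r \<noteq> []"
  obtains g e q where "r = (g, e) # q" "reduced q" "(g, e) \<in> turns q" "\<not> backtracks q g e"
  using assms by (cases r) (auto simp: turns_def)

lemma p0_closed [simp]: "p0 \<in> carrier P"
  using p0 path_elts_closed by blast

lemma path_from_base:
  "p \<in> path_elts X base_vertex y \<longleftrightarrow> (\<exists>q\<in>path_elts X root y. p = p0 \<otimes>\<^bsub>P\<^esub> q)"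
proof
  assume p: "p \<in> path_elts X base_vertex y"
  then have "inv\<^bsub>P\<^esub> p0 \<otimes>\<^bsub>P\<^esub> p \<in> path_elts X root y"
    using path_elts_mult path_elts_inv p0 by blast
  moreover have "p = p0 \<otimes>\<^bsub>P\<^esub> (inv\<^bsub>P\<^esub> p0 \<otimes>\<^bsub>P\<^esub> p)"
    using path_elts_closed[OF p] by (simp add: path.m_assoc[symmetric])
  ultimately show "\<exists>q\<in>path_elts X root y. p = p0 \<otimes>\<^bsub>P\<^esub> q" by blast
qed (auto intro: path_elts_mult[OF p0])

lemma coset_eq: "subgroup H P \<Longrightarrow> p \<in> carrier P \<Longrightarrow> h \<in> H \<Longrightarrow> (p \<otimes>\<^bsub>P\<^esub> h) <#\<^bsub>P\<^esub> H = p <#\<^bsub>P\<^esub> H"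
  by (rule path.l_repr_independence[symmetric]) (auto simp: l_coset_def)

lemma coset_eqE:
  assumes "subgroup H P" "p \<in> carrier P" "q \<in> carrier P" "p <#\<^bsub>P\<^esub> H = q <#\<^bsub>P\<^esub> H"
  obtains h where "h \<in> H" "p = q \<otimes>\<^bsub>P\<^esub> h"
proof -
  have "p \<in> q <#\<^bsub>P\<^esub> H" using path.lcos_self[OF assms(2,1)] assms(4) by simp
  then show thesis using that by (auto simp: l_coset_def)
qed

lemma inj_V: "inj_on V (Collect reduced)"
proof (rule inj_onI)
  fix r r' assume r: "r \<in> Collect reduced" "r' \<in> Collect reduced" and eq: "V r = V r'"
  have x: "endpoint r = endpoint r'" "endpoint r \<in> vtx X" using eq endpoint_vertex r by (auto simp: V_def)
  have "(p0 \<otimes>\<^bsub>P\<^esub> normal_class r) <#\<^bsub>P\<^esub> vertex_subgroup X (endpoint r) = (p0 \<otimes>\<^bsub>P\<^esub> normal_class r') <#\<^bsub>P\<^esub> vertex_subgroup X (endpoint r)"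
    using eq x by (simp add: V_def)
  moreover have "p0 \<otimes>\<^bsub>P\<^esub> normal_class r \<in> carrier P" "p0 \<otimes>\<^bsub>P\<^esub> normal_class r' \<in> carrier P" using r by auto
  ultimately obtain h where "h \<in> vertex_subgroup X (endpoint r)" "p0 \<otimes>\<^bsub>P\<^esub> normal_class r = p0 \<otimes>\<^bsub>P\<^esub> normal_class r' \<otimes>\<^bsub>P\<^esub> h"
    using coset_eqE[OF vertex_subgroup[OF x(2)]] by blast
  then obtain h where h: "h \<in> carrier (vgrp X (endpoint r))"
      "p0 \<otimes>\<^bsub>P\<^esub> normal_class r = p0 \<otimes>\<^bsub>P\<^esub> normal_class r' \<otimes>\<^bsub>P\<^esub> vertex_elt X (endpoint r) h"
    by (auto simp: vertex_subgroup_def)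
  then have "normal_class r = normal_class r' \<otimes>\<^bsub>P\<^esub> vertex_elt X (endpoint r) h"
    using r x by (simp add: path.m_assoc)
  then show "r = r'"
    using normal_form_unique[of r r' "\<one>\<^bsub>vgrp X (endpoint r)\<^esub>" h] r x h vgrp_group[OF x(2)]
    by (simp add: vertex_elt_one group.is_monoid)
qed

lemma verts_T: "verts T = V ` Collect reduced"
proof
  show "V ` Collect reduced \<subseteq> verts T"
    using endpoint_vertex normal_class_path path_from_base by (fastforce simp: bs_tree_def V_def)
  show "verts T \<subseteq> V ` Collect reduced"
  proof
    fix c assume "c \<in> verts T"
    then obtain x p where x: "x \<in> vtx X" and p: "p \<in> path_elts X base_vertex x"
      and c: "c = (x, p <#\<^bsub>P\<^esub> vertex_subgroup X x)"
      by (auto simp: bs_tree_def)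
    obtain q where "q \<in> path_elts X root x" and pq: "p = p0 \<otimes>\<^bsub>P\<^esub> q" using p path_from_base by blast
    then obtain r h where r: "reduced r" "endpoint r = x" "h \<in> carrier (vgrp X x)"
        "q = normal_class r \<otimes>\<^bsub>P\<^esub> vertex_elt X x h" using path_elts_normal_form by blast
    have "p = p0 \<otimes>\<^bsub>P\<^esub> normal_class r \<otimes>\<^bsub>P\<^esub> vertex_elt X x h" using pq r x by (simp add: path.m_assoc)
    then have "p <#\<^bsub>P\<^esub> vertex_subgroup X x = (p0 \<otimes>\<^bsub>P\<^esub> normal_class r) <#\<^bsub>P\<^esub> vertex_subgroup X x"
      using coset_eq[OF vertex_subgroup[OF x]] r by (simp add: vertex_subgroup_def)
    then show "c \<in> V ` Collect reduced" using r c by (auto simp: V_def)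
  qed
qed

lemma inj_tree_arc:
  assumes r: "reduced r" "reduced r'" and t: "(g, e) \<in> turns r" "(g', e') \<in> turns r'"
    and eq: "tree_arc r g e = tree_arc r' g' e'"
  shows "r = r' \<and> g = g' \<and> e = e'"
proof -
  have e: "e' = e" using eq by (simp add: tree_arc_def)
  note t = turnsD[OF t(1)] turnsD[OF t(2)]
  interpret G: group "vgrp X (ini X e)" using t e by (intro vgrp_ini) auto
  let ?v = "vertex_elt X (ini X e)"
  have c: "p0 \<otimes>\<^bsub>P\<^esub> normal_class r \<otimes>\<^bsub>P\<^esub> ?v g \<in> carrier P" "p0 \<otimes>\<^bsub>P\<^esub> normal_class r' \<otimes>\<^bsub>P\<^esub> ?v g' \<in> carrier P"
    using r t e by auto
  obtain h where "h \<in> edge_subgroup X e" "p0 \<otimes>\<^bsub>P\<^esub> normal_class r \<otimes>\<^bsub>P\<^esub> ?v g = p0 \<otimes>\<^bsub>P\<^esub> normal_class r' \<otimes>\<^bsub>P\<^esub> ?v g' \<otimes>\<^bsub>P\<^esub> h"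
    using coset_eqE[OF edge_subgroup c] eq e t by (auto simp: tree_arc_def)
  then obtain s where s: "s \<in> carrier (egrp X e)"
      "p0 \<otimes>\<^bsub>P\<^esub> normal_class r \<otimes>\<^bsub>P\<^esub> ?v g = p0 \<otimes>\<^bsub>P\<^esub> normal_class r' \<otimes>\<^bsub>P\<^esub> ?v g' \<otimes>\<^bsub>P\<^esub> ?v (emb X e s)"
    by (auto simp: edge_subgroup_def)
  then have "normal_class r \<otimes>\<^bsub>P\<^esub> ?v g = normal_class r' \<otimes>\<^bsub>P\<^esub> ?v (g' \<otimes>\<^bsub>vgrp X (ini X e)\<^esub> emb X e s)"
    using r t e by (simp add: path.m_assoc vertex_elt_mult)
  then have "r = r' \<and> g = g' \<otimes>\<^bsub>vgrp X (ini X e)\<^esub> emb X e s"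
    using normal_form_unique[of r r' g "g' \<otimes>\<^bsub>vgrp X (ini X e)\<^esub> emb X e s"] r t e s by auto
  then show ?thesis
    using decompose_unique(1)[of e g' s] coset_rep_transversal[of e g] t e s by auto
qed

lemma arcs_T_eq_tree_arc: "arcs T = {tree_arc r g e | r g e. reduced r \<and> (g, e) \<in> turns r}"
proof
  show "{tree_arc r g e | r g e. reduced r \<and> (g, e) \<in> turns r} \<subseteq> arcs T"
  proof
    fix c assume "c \<in> {tree_arc r g e | r g e. reduced r \<and> (g, e) \<in> turns r}"
    then obtain r g e where r: "reduced r" and t: "(g, e) \<in> turns r" and c: "c = tree_arc r g e" by blast
    have "normal_class r \<otimes>\<^bsub>P\<^esub> vertex_elt X (ini X e) g \<in> path_elts X root (ini X e)"
      using normal_class_path[OF r] turnsD[OF t] by (intro path_elts_mult_vertex) auto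
    then have "p0 \<otimes>\<^bsub>P\<^esub> normal_class r \<otimes>\<^bsub>P\<^esub> vertex_elt X (ini X e) g \<in> path_elts X base_vertex (ini X e)"
      using path_elts_mult[OF p0] r turnsD[OF t] by (simp add: path.m_assoc)
    then show "c \<in> arcs T" using turnsD[OF t] c by (auto simp: bs_tree_def tree_arc_def)
  qed
  show "arcs T \<subseteq> {tree_arc r g e | r g e. reduced r \<and> (g, e) \<in> turns r}"
  proof
    fix c assume "c \<in> arcs T"
    then obtain e p where e: "e \<in> edg X" and p: "p \<in> path_elts X base_vertex (ini X e)"
      and c: "c = (e, p <#\<^bsub>P\<^esub> edge_subgroup X e)"
      by (auto simp: bs_tree_def)
    let ?v = "vertex_elt X (ini X e)"
    obtain q where "q \<in> path_elts X root (ini X e)" and pq: "p = p0 \<otimes>\<^bsub>P\<^esub> q" using p path_from_base by blast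
    then obtain r h where r: "reduced r" "endpoint r = ini X e" "h \<in> carrier (vgrp X (ini X e))"
        "q = normal_class r \<otimes>\<^bsub>P\<^esub> ?v h" using path_elts_normal_form by blast
    let ?g = "coset_rep e h" and ?s = "edge_part e h"
    have g: "?g \<in> transversal e" "?g \<in> carrier (vgrp X (ini X e))"
      using r coset_rep_closed[OF e r(3)] by (auto simp: transversal_def)
    have s: "?s \<in> carrier (egrp X e)" "?v h = ?v ?g \<otimes>\<^bsub>P\<^esub> ?v (emb X e ?s)"
      using edge_part[OF e r(3)] e g by (simp_all add: vertex_elt_mult[symmetric])
    have "p = p0 \<otimes>\<^bsub>P\<^esub> normal_class r \<otimes>\<^bsub>P\<^esub> ?v ?g \<otimes>\<^bsub>P\<^esub> ?v (emb X e ?s)"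
      using pq r e g s by (simp add: path.m_assoc)
    then have "p <#\<^bsub>P\<^esub> edge_subgroup X e = (p0 \<otimes>\<^bsub>P\<^esub> normal_class r \<otimes>\<^bsub>P\<^esub> ?v ?g) <#\<^bsub>P\<^esub> edge_subgroup X e"
      using coset_eq[OF edge_subgroup[OF e]] r e g s by (simp add: edge_subgroup_def)
    then have "c = tree_arc r ?g e" using c by (simp add: tree_arc_def)
    moreover have "(?g, e) \<in> turns r" using g e r by (simp add: turns_def)
    ultimately show "c \<in> {tree_arc r g e | r g e. reduced r \<and> (g, e) \<in> turns r}" using r by blast
  qed
qed

lemma tail_tree_arc:
  assumes "reduced r" "(g, e) \<in> turns r"
  shows "tail T (tree_arc r g e) = V r"
proof -
  note t = turnsD[OF assms(2)]
  let ?v = "vertex_elt X (ini X e) g"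
  have "(p0 \<otimes>\<^bsub>P\<^esub> normal_class r \<otimes>\<^bsub>P\<^esub> ?v) <#\<^bsub>P\<^esub> vertex_subgroup X (ini X e) = (p0 \<otimes>\<^bsub>P\<^esub> normal_class r) <#\<^bsub>P\<^esub> vertex_subgroup X (ini X e)"
    using t assms by (intro coset_eq vertex_subgroup) (auto simp: vertex_subgroup_def)
  then show ?thesis
    using t assms by (simp add: bs_tree_def tree_arc_def V_def coset_times_vertex_subgroup)
qed

lemma head_tree_arc:
  assumes "reduced r" "(g, e) \<in> turns r"
  shows "head T (tree_arc r g e) = (ter X e,
    (p0 \<otimes>\<^bsub>P\<^esub> normal_class r \<otimes>\<^bsub>P\<^esub> vertex_elt X (ini X e) g \<otimes>\<^bsub>P\<^esub> edge_elt X e) <#\<^bsub>P\<^esub> vertex_subgroup X (ter X e))"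
proof -
  note t = turnsD[OF assms(2)]
  show ?thesis
    using t assms coset_times_vertex_subgroup[of "bar X e"]
    by (simp add: bs_tree_def tree_arc_def coset_times_edge_elt)
qed

lemma bar_tree_arc:
  assumes "reduced r" "(g, e) \<in> turns r"
  shows "bs_bar X base_vertex (tree_arc r g e) = (bar X e,
    (p0 \<otimes>\<^bsub>P\<^esub> normal_class r \<otimes>\<^bsub>P\<^esub> vertex_elt X (ini X e) g \<otimes>\<^bsub>P\<^esub> edge_elt X e) <#\<^bsub>P\<^esub> edge_subgroup X (bar X e))"
proof -
  note t = turnsD[OF assms(2)]
  have "tree_arc r g e \<in> arcs T" using arcs_T_eq_tree_arc assms by blast
  then show ?thesis
    using t assms by (simp add: bs_bar_def tree_arc_def coset_times_edge_elt)
qed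

lemma back_turn:
  assumes "reduced ((g, e) # r)"
  shows "(\<one>\<^bsub>vgrp X (ter X e)\<^esub>, bar X e) \<in> turns ((g, e) # r)"
  using assms one_transversal[of "bar X e"] by (auto simp: turns_def)

lemma normal_class_back:
  assumes "reduced ((g, e) # r)"
  shows "p0 \<otimes>\<^bsub>P\<^esub> normal_class ((g, e) # r) \<otimes>\<^bsub>P\<^esub> vertex_elt X (ter X e) \<one>\<^bsub>vgrp X (ter X e)\<^esub> \<otimes>\<^bsub>P\<^esub> edge_elt X (bar X e)
    = p0 \<otimes>\<^bsub>P\<^esub> normal_class r \<otimes>\<^bsub>P\<^esub> vertex_elt X (ini X e) g"
proof -
  have r: "reduced r" "(g, e) \<in> turns r" using assms reduced_Cons_iff by blast+
  show ?thesis
    using normal_class_Cons[OF assms] r(1) turnsD[OF r(2)]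
    by (simp add: path.m_assoc vertex_elt_one edge_elt_bar)
qed

lemma down_Cons: "down ((g, e) # r) = tree_arc r g e"
  by (simp add: down_def)

lemma up_Cons: "e \<in> edg X \<Longrightarrow> up ((g, e) # r) = tree_arc ((g, e) # r) \<one>\<^bsub>vgrp X (ter X e)\<^esub> (bar X e)"
  by (simp add: up_def)

text \<open>
  An edge issuing from \<open>V r\<close> leads either back to the parent of \<open>V r\<close>, when it cancels the last edge of
  \<open>r\<close>, or to the child whose normal form it extends. Uniqueness of normal forms keeps the vertices
  and arcs so obtained apart.
\<close>

lemma tree_model:
  assumes l: "length_function X l"
  shows "rooted_tree_model T (bs_bar X base_vertex) (l \<circ> fst) (Collect reduced) V down up"
proof
  let ?R = "Collect reduced"
  show "[] \<in> ?R" "\<And>r. r \<in> ?R \<Longrightarrow> tl r \<in> ?R"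
    by (auto elim: reduced.elims)
  show "bij_betw V ?R (verts T)" using inj_V verts_T by (simp add: bij_betw_def)
  have down: "\<exists>g e q. r = (g, e) # q \<and> reduced q \<and> (g, e) \<in> turns q \<and> \<not> backtracks q g e \<and> down r = tree_arc q g e"
    if "r \<in> ?R - {[]}" for r
  proof -
    from that obtain g e q where "r = (g, e) # q" "reduced q" "(g, e) \<in> turns q" "\<not> backtracks q g e"
      by (auto elim: reduced_ConsE)
    then show ?thesis using down_Cons by blast
  qed
  have up: "\<exists>g e q. r = (g, e) # q \<and> e \<in> edg X \<and> (\<one>\<^bsub>vgrp X (ter X e)\<^esub>, bar X e) \<in> turns r \<and>
      backtracks r \<one>\<^bsub>vgrp X (ter X e)\<^esub> (bar X e) \<and> up r = tree_arc r \<one>\<^bsub>vgrp X (ter X e)\<^esub> (bar X e)"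
    if "r \<in> ?R - {[]}" for r
  proof -
    from that obtain g e q where r: "r = (g, e) # q" "(g, e) \<in> turns q"
      by (auto elim: reduced_ConsE)
    then have e: "e \<in> edg X" using turnsD by blast
    then show ?thesis
      using r that back_turn[of g e q] up_Cons[OF e, of g q] by (auto simp: backtracks_def)
  qed
  show "inj_on down (?R - {[]})"
  proof (rule inj_onI)
    fix r r' assume "r \<in> ?R - {[]}" "r' \<in> ?R - {[]}" "down r = down r'"
    then show "r = r'" using down[of r] down[of r'] inj_tree_arc by metis
  qed
  show "inj_on up (?R - {[]})"
  proof (rule inj_onI)
    fix r r' assume a: "r \<in> ?R - {[]}" "r' \<in> ?R - {[]}" "up r = up r'"
    obtain e where e: "(\<one>\<^bsub>vgrp X (ter X e)\<^esub>, bar X e) \<in> turns r" "up r = tree_arc r \<one>\<^bsub>vgrp X (ter X e)\<^esub> (bar X e)"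
      using up[OF a(1)] by blast
    obtain e' where e': "(\<one>\<^bsub>vgrp X (ter X e')\<^esub>, bar X e') \<in> turns r'"
      "up r' = tree_arc r' \<one>\<^bsub>vgrp X (ter X e')\<^esub> (bar X e')"
      using up[OF a(2)] by blast
    show "r = r'" using inj_tree_arc[OF _ _ e(1) e'(1)] e(2) e'(2) a by simp
  qed
  show "down ` (?R - {[]}) \<inter> up ` (?R - {[]}) = {}"
  proof (rule equals0I)
    fix c assume "c \<in> down ` (?R - {[]}) \<inter> up ` (?R - {[]})"
    then obtain r r' where a: "r \<in> ?R - {[]}" "r' \<in> ?R - {[]}" "down r = up r'" by auto
    obtain g e q where 1: "reduced q" "(g, e) \<in> turns q" "\<not> backtracks q g e" "down r = tree_arc q g e"
      using down[OF a(1)] by blast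
    obtain e' where 2: "(\<one>\<^bsub>vgrp X (ter X e')\<^esub>, bar X e') \<in> turns r'"
      "backtracks r' \<one>\<^bsub>vgrp X (ter X e')\<^esub> (bar X e')" "up r' = tree_arc r' \<one>\<^bsub>vgrp X (ter X e')\<^esub> (bar X e')"
      using up[OF a(2)] by blast
    show False using inj_tree_arc[OF 1(1) _ 1(2) 2(1)] 1 2 a by auto
  qed
  show "arcs T = down ` (?R - {[]}) \<union> up ` (?R - {[]})"
  proof
    show "down ` (?R - {[]}) \<union> up ` (?R - {[]}) \<subseteq> arcs T"
      unfolding arcs_T_eq_tree_arc using down up by blast
    show "arcs T \<subseteq> down ` (?R - {[]}) \<union> up ` (?R - {[]})"
    proof
      fix c assume "c \<in> arcs T"
      then obtain r g e where c: "c = tree_arc r g e" "reduced r" and t: "(g, e) \<in> turns r"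
        by (auto simp: arcs_T_eq_tree_arc)
      show "c \<in> down ` (?R - {[]}) \<union> up ` (?R - {[]})"
      proof (cases "backtracks r g e")
        case True
        then have "c = up r" "r \<noteq> []"
          using c turnsD[OF t] by (auto simp: backtracks_def up_def)
        then show ?thesis using c by blast
      next
        case False
        then have "c = down ((g, e) # r)" "reduced ((g, e) # r)"
          using c t down_Cons by (auto simp: reduced_Cons_iff simp del: reduced.simps)
        then show ?thesis by blast
      qed
    qed
  qed
  fix r assume "r \<in> ?R" "r \<noteq> []"
  then obtain g e q where r: "r = (g, e) # q" "reduced q" "(g, e) \<in> turns q" "\<not> backtracks q g e"
    by (auto elim: reduced_ConsE)
  then have red: "reduced ((g, e) # q)" by (simp add: reduced_Cons_iff del: reduced.simps)
  have t: "e \<in> edg X" "endpoint q = ini X e" "g \<in> carrier (vgrp X (ini X e))" using turnsD r by blast+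
  have Dr: "down r = tree_arc q g e" and Ur: "up r = tree_arc r \<one>\<^bsub>vgrp X (ter X e)\<^esub> (bar X e)"
    using r down_Cons up_Cons[OF t(1)] by auto
  note bt = back_turn[OF red]
  show "tail T (down r) = V (tl r)" using tail_tree_arc[OF r(2,3)] Dr r by simp
  have nc: "p0 \<otimes>\<^bsub>P\<^esub> normal_class q \<otimes>\<^bsub>P\<^esub> vertex_elt X (ini X e) g \<otimes>\<^bsub>P\<^esub> edge_elt X e = p0 \<otimes>\<^bsub>P\<^esub> normal_class r"
    using normal_class_Cons[OF red] r t by (simp add: path.m_assoc)
  show "head T (down r) = V r"
    using head_tree_arc[OF r(2,3)] Dr r nc by (simp add: V_def)
  show "tail T (up r) = V r" using tail_tree_arc[OF red bt] Ur r by simp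
  have "(p0 \<otimes>\<^bsub>P\<^esub> normal_class q \<otimes>\<^bsub>P\<^esub> vertex_elt X (ini X e) g) <#\<^bsub>P\<^esub> vertex_subgroup X (ini X e) =
      (p0 \<otimes>\<^bsub>P\<^esub> normal_class q) <#\<^bsub>P\<^esub> vertex_subgroup X (ini X e)"
    using r t by (intro coset_eq vertex_subgroup) (auto simp: vertex_subgroup_def)
  then show "head T (up r) = V (tl r)"
    using head_tree_arc[OF red bt] Ur r t normal_class_back[OF red] by (simp add: V_def)
  have Ur': "up r = (bar X e, (p0 \<otimes>\<^bsub>P\<^esub> normal_class r) <#\<^bsub>P\<^esub> edge_subgroup X (bar X e))"
    using Ur red r(1) t by (simp add: tree_arc_def vertex_elt_one)
  show "bs_bar X base_vertex (down r) = up r"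
    unfolding Ur' using bar_tree_arc[OF r(2,3)] Dr nc by simp
  show "bs_bar X base_vertex (up r) = down r"
    using bar_tree_arc[OF red bt] Ur r t normal_class_back[OF red] Dr by (simp add: tree_arc_def)
  show "(l \<circ> fst) (up r) = (l \<circ> fst) (down r)" "0 < (l \<circ> fst) (down r)"
    using l t Ur Dr by (auto simp: length_function_def tree_arc_def)
qed

end

section \<open>Growth of the Bass--Serre tree\<close>

locale branching_bass_serre_tree =
  rooted_bass_serre_tree X root base_vertex p0 + branching_graph_of_groups X
  for X :: "('v, 'e, 'a, 'b) graph_of_groups" and root :: 'v and base_vertex :: 'v
    and p0 :: "('v, 'e, 'a) letter list set"
begin

fun path_length :: "('e \<Rightarrow> real) \<Rightarrow> ('a \<times> 'e) list \<Rightarrow> real" where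
  "path_length l [] = 0"
| "path_length l ((g, e) # r) = l e + path_length l r"

definition level :: "nat \<Rightarrow> ('a \<times> 'e) list set" where
  "level m = {r. reduced r \<and> length r = m}"

definition steps :: "('a \<times> 'e) list \<Rightarrow> ('a \<times> 'e) set" where
  "steps r = {(g, e). (g, e) \<in> turns r \<and> \<not> backtracks r g e}"

abbreviation last_edge :: "('a \<times> 'e) list \<Rightarrow> 'e" where
  "last_edge r \<equiv> snd (hd r)"

lemma steps_Sigma:
  "prod.swap ` steps r =
    (SIGMA e:{e \<in> edg X. ini X e = endpoint r}. {g \<in> transversal e. \<not> backtracks r g e})"
  by (force simp: steps_def turns_def)

lemma finite_steps [simp]: "finite (steps r)"
proof -
  have "finite (prod.swap ` steps r)"
    unfolding steps_Sigma by (intro finite_SigmaI) (auto simp: finite_transversal)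
  then show ?thesis by (rule finite_imageD) simp
qed

lemma level_0: "level 0 = {[]}"
  by (auto simp: level_def)

lemma level_Suc: "level (Suc m) = (\<lambda>(r, a). a # r) ` (SIGMA r:level m. steps r)"
proof
  show "level (Suc m) \<subseteq> (\<lambda>(r, a). a # r) ` (SIGMA r:level m. steps r)"
  proof
    fix r assume r: "r \<in> level (Suc m)"
    then have "reduced r" "r \<noteq> []" by (auto simp: level_def)
    then obtain g e q where q: "r = (g, e) # q" "reduced q" "(g, e) \<in> turns q" "\<not> backtracks q g e"
      by (rule reduced_ConsE)
    then have "(q, (g, e)) \<in> (SIGMA r:level m. steps r)" using r by (auto simp: level_def steps_def)
    then show "r \<in> (\<lambda>(r, a). a # r) ` (SIGMA r:level m. steps r)"
      using q(1) by (intro image_eqI[of _ _ "(q, (g, e))"]) simp_all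
  qed
  show "(\<lambda>(r, a). a # r) ` (SIGMA r:level m. steps r) \<subseteq> level (Suc m)"
    by (auto simp: level_def steps_def reduced_Cons_iff simp del: reduced.simps(2))
qed

lemma finite_level [simp]: "finite (level m)"
  by (induction m) (simp_all add: level_0 level_Suc)

lemma sum_level_Suc:
  "(\<Sum>r\<in>level (Suc m). F r) = (\<Sum>r\<in>level m. \<Sum>a\<in>steps r. F (a # r))"
  unfolding level_Suc
  by (subst sum.reindex) (auto simp: inj_on_def sum.Sigma split_def)

text \<open>
  The number of edges over \<open>f\<close> by which a normal form can be extended depends only on its last edge.
\<close>

lemma sum_steps:
  assumes r: "reduced r" "r \<noteq> []"
  shows "(\<Sum>(g, e)\<in>steps r. F e) = (\<Sum>f\<in>edg X. succ_weight (last_edge r) f * F f)"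
proof -
  obtain g e q where q: "r = (g, e) # q" "(g, e) \<in> turns q" using r by (auto elim: reduced_ConsE)
  then have e: "e \<in> edg X" using turnsD by blast
  have count: "real (card {g \<in> transversal f. \<not> backtracks r g f}) = succ_weight e f"
    if f: "f \<in> edg X" "ini X f = endpoint r" for f
  proof (cases "f = bar X e")
    case True
    then have "{g \<in> transversal f. \<not> backtracks r g f} = transversal f - {\<one>\<^bsub>vgrp X (ini X f)\<^esub>}"
      using q e by (auto simp: backtracks_def)
    moreover have "card (transversal f) \<ge> 1"
      using one_transversal[OF f(1)] finite_transversal[OF f(1)]
      by (metis One_nat_def Suc_leI card_gt_0_iff empty_iff)
    ultimately show ?thesis
      using True f q e one_transversal[OF f(1)] finite_transversal[OF f(1)] card_transversal[OF f(1)]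
      by (simp add: succ_weight_def card_Diff_singleton of_nat_diff)
  next
    case False
    then have "{g \<in> transversal f. \<not> backtracks r g f} = transversal f"
      using q e f by (auto simp: backtracks_def)
    then show ?thesis using False f q card_transversal[OF f(1)] by (simp add: succ_weight_def)
  qed
  have "(\<Sum>(g, e)\<in>steps r. F e) = (\<Sum>(e, g)\<in>prod.swap ` steps r. F e)"
    by (subst sum.reindex) (auto simp: split_def)
  also have "\<dots> = (\<Sum>f\<in>{f \<in> edg X. ini X f = endpoint r}. \<Sum>g\<in>{g \<in> transversal f. \<not> backtracks r g f}. F f)"
    unfolding steps_Sigma by (rule sum.Sigma[symmetric]) (auto simp: finite_transversal)
  also have "\<dots> = (\<Sum>f\<in>{f \<in> edg X. ini X f = endpoint r}. succ_weight e f * F f)"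
    by (intro sum.cong HOL.refl) (simp add: count)
  also have "\<dots> = (\<Sum>f\<in>edg X. succ_weight e f * F f)"
    using q by (intro sum.mono_neutral_left) (auto simp: succ_weight_def)
  finally show ?thesis using q by simp
qed

lemma last_edge_edge:
  assumes "r \<in> level (Suc m)"
  shows "last_edge r \<in> edg X"
proof -
  have "reduced r" "r \<noteq> []" using assms by (auto simp: level_def)
  then obtain g e q where "r = (g, e) # q" "(g, e) \<in> turns q" by (rule reduced_ConsE)
  then show ?thesis using turnsD(1)[of g e q] by simp
qed

lemma level_sum_step:
  "(\<Sum>r\<in>level (Suc (Suc m)). exp (- s * path_length l r) * u (last_edge r)) =
    (\<Sum>r\<in>level (Suc m). exp (- s * path_length l r) * transfer l s u (last_edge r))"
  unfolding sum_level_Suc[of _ "Suc m"]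
proof (intro sum.cong HOL.refl)
  fix r assume "r \<in> level (Suc m)"
  then have r: "reduced r" "r \<noteq> []" by (auto simp: level_def)
  have "(\<Sum>a\<in>steps r. exp (- s * path_length l (a # r)) * u (last_edge (a # r))) =
      (\<Sum>(g, e)\<in>steps r. exp (- s * path_length l r) * (exp (- s * l e) * u e))"
    by (intro sum.cong HOL.refl) (auto simp: exp_add[symmetric] algebra_simps)
  also have "\<dots> = exp (- s * path_length l r) * transfer l s u (last_edge r)"
    unfolding sum_steps[OF r] transfer_def sum_distrib_left
    by (intro sum.cong HOL.refl) (simp add: mult_ac)
  finally show "(\<Sum>a\<in>steps r. exp (- s * path_length l (a # r)) * u (last_edge (a # r))) =
      exp (- s * path_length l r) * transfer l s u (last_edge r)" .
qed

text \<open>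
  Sums over the tree reduce to powers of the transfer operator on the finite graph.
\<close>

lemma level_sum:
  "(\<Sum>r\<in>level (Suc m). exp (- s * path_length l r) * u (last_edge r)) =
    (\<Sum>r\<in>level 1. exp (- s * path_length l r) * (transfer l s ^^ m) u (last_edge r))"
proof (induction m arbitrary: u)
  case (Suc m)
  show ?case unfolding level_sum_step Suc by (simp add: funpow_swap1)
qed simp

lemma ex_level_1: "\<exists>g e. e \<in> edg X \<and> [(g, e)] \<in> level 1"
proof -
  have "{e \<in> edg X. ini X e = root} \<noteq> {}"
  proof
    assume no: "{e \<in> edg X. ini X e = root} = {}"
    have "vertex_degree X root = 0" unfolding vertex_degree_def no by simp
    then show False using degree_ge_3[OF root] by simp
  qed
  then obtain e where e: "e \<in> edg X" "ini X e = root" by blast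
  then have "[(\<one>\<^bsub>vgrp X (ini X e)\<^esub>, e)] \<in> level 1"
    using one_transversal[OF e(1)] by (simp add: level_def backtracks_def)
  then show ?thesis using e by blast
qed

context
  fixes l :: "'e \<Rightarrow> real"
  assumes l: "length_function X l"
begin

interpretation tree: rooted_tree_model T "bs_bar X base_vertex" "l \<circ> fst" "Collect reduced" V down up
  by (rule tree_model[OF l])

lemma len_down: "(l \<circ> fst) (down (a # r)) = l (snd a)"
  by (simp add: down_def tree_arc_def)

lemma depth_eq: "tree.depth r = path_length l r"
  by (induction r) (auto simp: len_down simp del: comp_apply)

lemma l_bounds: "\<exists>c C. 0 < c \<and> 0 < C \<and> (\<forall>e\<in>edg X. c \<le> l e \<and> l e \<le> C)"
proof -
  have ne: "edg X \<noteq> {}" using ex_edge by blast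
  have "Min (l ` edg X) \<in> l ` edg X" using ne by (intro Min_in) auto
  then have "0 < Min (l ` edg X)" using l by (auto simp: length_function_def)
  moreover have b: "Min (l ` edg X) \<le> l e \<and> l e \<le> Max (l ` edg X)" if "e \<in> edg X" for e
    using that by simp
  moreover obtain e where "e \<in> edg X" using ex_edge by blast
  ultimately have "0 < Max (l ` edg X)" using b[of e] by linarith
  then show ?thesis using \<open>0 < Min (l ` edg X)\<close> b by blast
qed

lemma path_length_bounds:
  assumes c: "\<And>e. e \<in> edg X \<Longrightarrow> c \<le> l e" and r: "reduced r"
  shows "real (length r) * c \<le> path_length l r"
  using r
proof (induction r rule: word.induct)
  case (2 g e r)
  then show ?case using c[of e] by (auto simp: algebra_simps)
qed simp

lemma path_length_nonneg: "reduced r \<Longrightarrow> 0 \<le> path_length l r"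
  using path_length_bounds[of 0 r] l by (force simp: length_function_def)

lemma finite_nodes: "finite {r. reduced r \<and> path_length l r \<le> \<rho>}"
proof -
  obtain c C where c: "0 < c" "\<And>e. e \<in> edg X \<Longrightarrow> c \<le> l e" using l_bounds by blast
  have "{r. reduced r \<and> path_length l r \<le> \<rho>} \<subseteq> (\<Union>m\<le>nat \<lfloor>\<rho> / c\<rfloor>. level m)"
  proof
    fix r assume "r \<in> {r. reduced r \<and> path_length l r \<le> \<rho>}"
    then have r: "reduced r" "real (length r) * c \<le> \<rho>"
      using path_length_bounds[OF c(2), of r] by auto
    then have "real (length r) \<le> \<rho> / c" using c by (simp add: field_simps)
    then have "length r \<le> nat \<lfloor>\<rho> / c\<rfloor>" by (simp add: le_nat_floor)
    then show "r \<in> (\<Union>m\<le>nat \<lfloor>\<rho> / c\<rfloor>. level m)" using r by (auto simp: level_def)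
  qed
  then show ?thesis by (rule finite_subset) simp
qed

definition nodes :: "real \<Rightarrow> ('a \<times> 'e) list set" where
  "nodes \<rho> = {r. reduced r \<and> r \<noteq> [] \<and> path_length l r \<le> \<rho>}"

lemma finite_nodes' [simp]: "finite (nodes \<rho>)"
  by (rule finite_subset[OF _ finite_nodes[of \<rho>]]) (auto simp: nodes_def)

abbreviation ball_len :: "real \<Rightarrow> real" where
  "ball_len \<rho> \<equiv> tree_ball_length X base_vertex (V []) l \<rho>"

lemma ball_len_eq: "ball_len \<rho> = edges_length_in T (bs_bar X base_vertex) (l \<circ> fst) (tree.root_ball \<rho>)"
  by (simp add: tree_ball_length_def tree.root_ball_def Let_def)

lemma parent_nodes_subset:
  assumes "\<And>e. e \<in> edg X \<Longrightarrow> l e \<le> C"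
  shows "{r \<in> Collect reduced - {[]}. tree.depth (tl r) \<le> \<rho>} \<subseteq> nodes (\<rho> + C)"
proof
  fix r assume r: "r \<in> {r \<in> Collect reduced - {[]}. tree.depth (tl r) \<le> \<rho>}"
  then obtain g e q where "r = (g, e) # q" "(g, e) \<in> turns q" by (auto elim: reduced_ConsE)
  then show "r \<in> nodes (\<rho> + C)"
    using r assms[of e] turnsD[of g e q] by (auto simp: nodes_def depth_eq)
qed

lemma finite_parent_nodes: "finite {r \<in> Collect reduced - {[]}. tree.depth (tl r) \<le> \<rho>}"
proof -
  obtain C where "\<And>e. e \<in> edg X \<Longrightarrow> l e \<le> C" using l_bounds by blast
  from parent_nodes_subset[OF this] show ?thesis by (rule finite_subset) auto
qed

lemma len_node:
  assumes "reduced r" "r \<noteq> []"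
  shows "\<exists>e\<in>edg X. (l \<circ> fst) (down r) = l e"
proof -
  from assms obtain g e q where "r = (g, e) # q" "(g, e) \<in> turns q" by (auto elim: reduced_ConsE)
  then show ?thesis using turnsD[of g e q] len_down[of "(g, e)" q] by auto
qed

lemma ball_len_lower:
  assumes c: "\<And>e. e \<in> edg X \<Longrightarrow> c \<le> l e"
  shows "c * real (card (nodes \<rho>)) \<le> ball_len \<rho>"
proof -
  have eq: "nodes \<rho> = {r \<in> Collect reduced - {[]}. tree.depth r \<le> \<rho>}"
    by (auto simp: nodes_def depth_eq)
  have "c * real (card (nodes \<rho>)) = (\<Sum>r\<in>nodes \<rho>. c)" by simp
  also have "\<dots> \<le> (\<Sum>r\<in>nodes \<rho>. (l \<circ> fst) (down r))"
    using c len_node by (intro sum_mono) (fastforce simp: nodes_def)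
  also have "\<dots> \<le> ball_len \<rho>"
    unfolding ball_len_eq eq by (rule tree.ball_length_lower[OF finite_parent_nodes])
  finally show ?thesis .
qed

lemma ball_len_upper:
  assumes C: "\<And>e. e \<in> edg X \<Longrightarrow> l e \<le> C" "0 < C"
  shows "ball_len \<rho> \<le> C * real (card (nodes (\<rho> + C)))"
proof -
  let ?N = "{r \<in> Collect reduced - {[]}. tree.depth (tl r) \<le> \<rho>}"
  have "ball_len \<rho> \<le> (\<Sum>r\<in>?N. (l \<circ> fst) (down r))"
    unfolding ball_len_eq by (rule tree.ball_length_upper[OF finite_parent_nodes])
  also have "\<dots> \<le> (\<Sum>r\<in>?N. C)"
    using C len_node by (intro sum_mono) fastforce
  also have "\<dots> = C * real (card ?N)" by simp
  also have "\<dots> \<le> C * real (card (nodes (\<rho> + C)))"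
    using C(2) card_mono[OF finite_nodes' parent_nodes_subset[OF C(1)]] by simp
  finally show ?thesis .
qed

text \<open>
  The vertices are grouped by the integer part of their depth, and the number of vertices in each
  group is at most exponential with the smaller rate \<open>s'\<close>; a geometric series remains.
\<close>

lemma poincare_bound:
  assumes s: "s' < s" and C: "\<And>\<rho>. \<rho> \<ge> 0 \<Longrightarrow> real (card (nodes \<rho>)) \<le> C * exp (s' * \<rho>)" and s0: "0 \<le> s'"
    and F: "finite F" "F \<subseteq> {r. reduced r \<and> r \<noteq> []}"
  shows "(\<Sum>r\<in>F. exp (- s * path_length l r)) \<le> C * exp s' / (1 - exp (s' - s))"
proof -
  let ?k = "\<lambda>r. nat \<lfloor>path_length l r\<rfloor>"
  have C0: "C \<ge> 0" using C[of 0] by (metis exp_zero mult.right_neutral mult_zero_right of_nat_0_le_iff order_refl order_trans)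
  have part: "(\<Sum>r\<in>{r \<in> F. ?k r = k}. exp (- s * path_length l r)) \<le> C * exp s' * exp (s' - s) ^ k" for k
  proof -
    have k: "real k \<le> path_length l r \<and> path_length l r \<le> real k + 1" if "r \<in> F" "?k r = k" for r
      using that path_length_nonneg[of r] F(2) by (auto simp: of_nat_nat)
    have "(\<Sum>r\<in>{r \<in> F. ?k r = k}. exp (- s * path_length l r)) \<le> (\<Sum>r\<in>{r \<in> F. ?k r = k}. exp (- s * real k))"
      using k s s0 by (intro sum_mono) (auto intro!: mult_left_mono)
    also have "\<dots> = real (card {r \<in> F. ?k r = k}) * exp (- s * real k)" by simp
    also have "\<dots> \<le> real (card (nodes (real k + 1))) * exp (- s * real k)"
      using k F(2) by (intro mult_right_mono of_nat_mono card_mono finite_nodes') (auto simp: nodes_def)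
    also have "\<dots> \<le> C * exp (s' * (real k + 1)) * exp (- s * real k)"
      by (intro mult_right_mono C) auto
    also have "\<dots> = C * exp s' * exp (s' - s) ^ k"
      by (simp add: exp_of_nat_mult[symmetric] exp_add[symmetric] algebra_simps)
    finally show ?thesis .
  qed
  have geo: "(\<lambda>k. C * exp s' * exp (s' - s) ^ k) sums (C * exp s' * (1 / (1 - exp (s' - s))))"
    using s by (intro sums_mult geometric_sums) simp
  have "(\<Sum>r\<in>F. exp (- s * path_length l r)) = (\<Sum>k\<in>?k ` F. \<Sum>r\<in>{r \<in> F. ?k r = k}. exp (- s * path_length l r))"
    by (rule sum.image_gen[OF F(1)])
  also have "\<dots> \<le> (\<Sum>k\<in>?k ` F. C * exp s' * exp (s' - s) ^ k)"
    by (intro sum_mono part)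
  also have "\<dots> \<le> (\<Sum>k. C * exp s' * exp (s' - s) ^ k)"
    using F(1) C0 geo by (intro sum_le_suminf) (auto simp: sums_iff)
  also have "\<dots> = C * exp s' / (1 - exp (s' - s))" using geo by (simp add: sums_iff)
  finally show ?thesis .
qed

text \<open>
  Above the entropy the Poincare series of the tree converges. Up to a constant
  factor, its part over the vertices beyond a fixed first edge is the series of the powers of the
  transfer operator at this edge.
\<close>

lemma superharmonic_above_entropy:
  assumes h: "volume_entropy X base_vertex (V []) l < ereal s" and s: "0 < s"
  shows "\<exists>x. \<forall>e\<in>edg X. x e > 0 \<and> transfer l s x e \<le> x e"
proof -
  obtain z where z: "volume_entropy X base_vertex (V []) l < ereal z" "z < s"
    using ereal_dense2[OF h] by auto
  \<comment> \<open>A nonnegative rate lets the bound on the counts extend to small radii.\<close>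
  define s' where "s' = max z 0"
  have s': "0 \<le> s'" "s' < s" using z s by (auto simp: s'_def)
  have "volume_entropy X base_vertex (V []) l < ereal s'"
    using z(1) by (rule less_le_trans) (simp add: s'_def)
  then have "eventually (\<lambda>\<rho>. ereal (1 / \<rho> * ln (ball_len \<rho>)) < ereal s') at_top"
    unfolding volume_entropy_def by (rule Limsup_lessD)
  then obtain \<rho>1 where \<rho>1: "\<And>\<rho>. \<rho> \<ge> \<rho>1 \<Longrightarrow> 1 / \<rho> * ln (ball_len \<rho>) < s'"
    by (auto simp: eventually_at_top_linorder)
  define \<rho>0 where "\<rho>0 = max \<rho>1 1"
  have W: "ball_len \<rho> \<le> exp (s' * \<rho>)" if "\<rho> \<ge> \<rho>0" for \<rho>
  proof (cases "ball_len \<rho> > 0")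
    case True
    have "\<rho> > 0" "1 / \<rho> * ln (ball_len \<rho>) < s'" using that \<rho>1 by (auto simp: \<rho>0_def)
    then have "ln (ball_len \<rho>) \<le> s' * \<rho>" by (simp add: field_simps)
    then have "exp (ln (ball_len \<rho>)) \<le> exp (s' * \<rho>)" by simp
    then show ?thesis using True by simp
  next
    case False
    then show ?thesis using exp_gt_zero[of "s' * \<rho>"] by linarith
  qed
  obtain c C where c: "0 < c" "\<And>e. e \<in> edg X \<Longrightarrow> c \<le> l e" using l_bounds by blast
  define K where "K = exp (s' * \<rho>0) / c"
  have cardN: "real (card (nodes \<rho>)) \<le> K * exp (s' * \<rho>)" if "\<rho> \<ge> 0" for \<rho>
  proof -
    have "c * real (card (nodes \<rho>)) \<le> c * real (card (nodes (max \<rho> \<rho>0)))"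
      using c(1) by (intro mult_left_mono of_nat_mono card_mono finite_nodes') (auto simp: nodes_def)
    also have "\<dots> \<le> ball_len (max \<rho> \<rho>0)" by (rule ball_len_lower[OF c(2)])
    also have "\<dots> \<le> exp (s' * max \<rho> \<rho>0)" by (rule W) simp
    also have "\<dots> \<le> exp (s' * \<rho>0 + s' * \<rho>)"
    proof -
      have "max \<rho> \<rho>0 \<le> \<rho>0 + \<rho>" using that by (auto simp: \<rho>0_def)
      then show ?thesis using s' by (simp add: distrib_left[symmetric] mult_left_mono)
    qed
    finally show ?thesis using c(1) by (simp add: K_def exp_add field_simps)
  qed
  let ?Z = "\<lambda>m. \<Sum>r\<in>level (Suc m). exp (- s * path_length l r)"
  have sm: "summable ?Z"
  proof (rule summableI_nonneg_bounded)
    fix n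
    have "(\<Sum>m<n. ?Z m) = (\<Sum>r\<in>(\<Union>m<n. level (Suc m)). exp (- s * path_length l r))"
      by (rule sum.UNION_disjoint[symmetric]) (simp, simp, auto simp: level_def)
    also have "\<dots> \<le> K * exp s' / (1 - exp (s' - s))"
    proof (rule poincare_bound[OF s'(2) _ s'(1)])
      show "(\<Union>m<n. level (Suc m)) \<subseteq> {r. reduced r \<and> r \<noteq> []}" by (auto simp: level_def)
    qed (use cardN in simp_all)
    finally show "(\<Sum>m<n. ?Z m) \<le> K * exp s' / (1 - exp (s' - s))" .
  qed (auto intro: sum_nonneg)
  obtain g e where e: "e \<in> edg X" "[(g, e)] \<in> level 1" using ex_level_1 by blast
  let ?M = "\<lambda>m. (transfer l s ^^ m) (\<lambda>_. 1)"
  note nn = transfer_power_nonneg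
  have last: "last_edge r \<in> edg X" if "r \<in> level 1" for r
    using last_edge_edge[of r 0] that by simp
  have le_Z: "exp (- s * l e) * ?M m e \<le> ?Z m" for m
  proof -
    have "exp (- s * path_length l [(g, e)]) * ?M m (last_edge [(g, e)]) \<le>
        (\<Sum>r\<in>level 1. exp (- s * path_length l r) * ?M m (last_edge r))"
      using e last nn by (intro member_le_sum[of _ _ "\<lambda>r. exp (- s * path_length l r) * ?M m (last_edge r)"]) auto
    also have "\<dots> = ?Z m" using level_sum[of s l "\<lambda>_. 1" m] by simp
    finally show ?thesis by simp
  qed
  have "summable (\<lambda>m. exp (- s * l e) * ?M m e)"
  proof (rule summable_comparison_test'[OF sm, of 0])
    fix m
    have "norm (exp (- s * l e) * ?M m e) = exp (- s * l e) * ?M m e"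
      using nn[OF e(1), of m] by (simp add: abs_mult)
    then show "norm (exp (- s * l e) * ?M m e) \<le> ?Z m" using le_Z[of m] by simp
  qed
  then have "summable (\<lambda>m. ?M m e)" by (subst (asm) summable_cmult_iff) auto
  then show ?thesis by (rule superharmonic_from_summable[OF e(1)])
qed

lemma entropy_lower_bound:
  "ereal (minimal_product / gog_volume X l) \<le> volume_entropy X base_vertex (V []) l"
proof (rule ccontr)
  let ?\<delta> = "minimal_product / gog_volume X l"
  assume "\<not> ?thesis"
  then have "volume_entropy X base_vertex (V []) l < ereal ?\<delta>" by simp
  then obtain z where z: "volume_entropy X base_vertex (V []) l < ereal z" "z < ?\<delta>"
    using ereal_dense2 by force
  \<comment> \<open>The maximum keeps \<open>s\<close> positive, even if the entropy were not.\<close>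
  define s where "s = max z (?\<delta> / 2)"
  have V: "gog_volume X l > 0" using volume_pos[OF l] .
  have "?\<delta> > 0" using V minimal_product_pos by simp
  then have s: "0 < s" "s < ?\<delta>" using z by (auto simp: s_def)
  have "volume_entropy X base_vertex (V []) l < ereal s"
    using z(1) by (rule less_le_trans) (simp add: s_def)
  then obtain x where "\<forall>e\<in>edg X. x e > 0 \<and> transfer l s x e \<le> x e"
    using superharmonic_above_entropy s by blast
  then have "minimal_product \<le> s * gog_volume X l"
    by (intro superharmonic_volume_bound[of l s x]) auto
  also have "\<dots> < minimal_product" using s V by (simp add: field_simps)
  finally show False by simp
qed

lemma entropy_rigidity:
  assumes "volume_entropy X base_vertex (V []) l = ereal (minimal_product / gog_volume X l)"
    and f: "f \<in> edg X"
  shows "l f = gog_volume X l / minimal_product * optimal_length f"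
proof -
  let ?\<delta> = "minimal_product / gog_volume X l"
  have V: "gog_volume X l > 0" "minimal_product > 0" using volume_pos[OF l] minimal_product_pos by auto
  have "2 * ?\<delta> * l f = ln (branching (ini X f) * branching (ter X f))"
  proof (rule rigidity[OF l _ _ f])
    fix s assume "?\<delta> < s"
    moreover have "?\<delta> > 0" using V by simp
    ultimately show "\<exists>x. \<forall>e\<in>edg X. x e > 0 \<and> transfer l s x e \<le> x e"
      using assms(1) by (intro superharmonic_above_entropy) auto
  qed (use V in simp)
  then show ?thesis using V by (simp add: optimal_length_def field_simps)
qed

text \<open>
  For a fixed function of the transfer operator, every level of the tree contributes the same amount
  to the Poincare series weighted by that function, and a ball of radius \<open>\<rho>\<close> meets only linearly many
  levels.
\<close>

lemma entropy_upper_bound: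
  assumes s: "0 < s" and harm: "\<And>e. e \<in> edg X \<Longrightarrow> transfer l s x e = x e"
    and x1: "\<And>e. e \<in> edg X \<Longrightarrow> x e \<ge> 1"
  shows "volume_entropy X base_vertex (V []) l \<le> ereal s"
proof -
  obtain c C where c: "0 < c" "\<And>e. e \<in> edg X \<Longrightarrow> c \<le> l e" and C: "0 < C" "\<And>e. e \<in> edg X \<Longrightarrow> l e \<le> C"
    using l_bounds by blast
  note last = last_edge_edge
  define A where "A = (\<Sum>r\<in>level 1. exp (- s * path_length l r) * x (last_edge r))"
  have const: "(\<Sum>r\<in>level (Suc m). exp (- s * path_length l r) * x (last_edge r)) = A" for m
  proof (induction m)
    case (Suc m)
    have "(\<Sum>r\<in>level (Suc (Suc m)). exp (- s * path_length l r) * x (last_edge r)) =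
        (\<Sum>r\<in>level (Suc m). exp (- s * path_length l r) * x (last_edge r))"
      unfolding level_sum_step by (intro sum.cong HOL.refl) (simp add: harm last)
    then show ?case using Suc by simp
  qed (simp add: A_def)
  obtain g0 e0 where e0: "e0 \<in> edg X" "[(g0, e0)] \<in> level 1" using ex_level_1 by blast
  have A: "A > 0"
    unfolding A_def
  proof (rule sum_pos)
    fix r assume "r \<in> level 1"
    then have "x (last_edge r) \<ge> 1" using last[of r 0] x1 by simp
    then show "exp (- s * path_length l r) * x (last_edge r) > 0" by simp
  qed (use e0 in auto)
  have cardN: "real (card (nodes t)) \<le> exp (s * t) * ((t / c + 1) * A)" if "t \<ge> 0" for t
  proof -
    let ?n = "nat \<lfloor>t / c\<rfloor>"
    have sub: "nodes t \<subseteq> (\<Union>m\<in>{..<?n}. level (Suc m))"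
    proof
      fix r assume r: "r \<in> nodes t"
      then have "real (length r) * c \<le> t" using path_length_bounds[OF c(2), of r] by (auto simp: nodes_def)
      then have "real (length r) \<le> t / c" using c by (simp add: field_simps)
      then have "length r \<le> ?n" by (simp add: le_nat_floor)
      moreover obtain m where "length r = Suc m" using r by (cases r) (auto simp: nodes_def)
      ultimately show "r \<in> (\<Union>m\<in>{..<?n}. level (Suc m))" using r by (auto simp: nodes_def level_def)
    qed
    have "real (card (nodes t)) * exp (- s * t) = (\<Sum>r\<in>nodes t. exp (- s * t) * 1)" by simp
    also have "\<dots> \<le> (\<Sum>r\<in>nodes t. exp (- s * path_length l r) * x (last_edge r))"
    proof (intro sum_mono mult_mono)
      fix r assume r: "r \<in> nodes t"
      then have "r \<in> level (Suc (length (tl r)))" by (auto simp: nodes_def level_def)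
      then show "1 \<le> x (last_edge r)" using last x1 by blast
      show "exp (- s * t) \<le> exp (- s * path_length l r)" using r s by (simp add: nodes_def)
    qed auto
    also have "\<dots> \<le> (\<Sum>r\<in>(\<Union>m\<in>{..<?n}. level (Suc m)). exp (- s * path_length l r) * x (last_edge r))"
    proof (rule sum_mono2[OF _ sub])
      fix r assume "r \<in> (\<Union>m\<in>{..<?n}. level (Suc m)) - nodes t"
      then obtain m where "r \<in> level (Suc m)" by blast
      then have "x (last_edge r) \<ge> 1" using last x1 by blast
      then show "0 \<le> exp (- s * path_length l r) * x (last_edge r)" by simp
    qed simp
    also have "\<dots> = (\<Sum>m<?n. \<Sum>r\<in>level (Suc m). exp (- s * path_length l r) * x (last_edge r))"
      by (rule sum.UNION_disjoint) (simp, simp, auto simp: level_def)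
    also have "\<dots> = real ?n * A" by (simp only: const) simp
    also have "\<dots> \<le> (t / c + 1) * A"
    proof -
      have "real ?n \<le> t / c + 1" using that c by (simp add: of_nat_nat) linarith
      then show ?thesis using A by simp
    qed
    finally have "real (card (nodes t)) / exp (s * t) \<le> (t / c + 1) * A"
      by (simp add: exp_minus divide_inverse)
    then show ?thesis by (subst (asm) pos_divide_le_eq) (simp_all add: mult.commute)
  qed
  let ?B = "\<lambda>\<rho>. 1 / \<rho> * (s * (\<rho> + C) + ln (C * ((\<rho> + C) / c + 1) * A))"
  have "eventually (\<lambda>\<rho>. ereal (1 / \<rho> * ln (ball_len \<rho>)) \<le> ereal (?B \<rho>)) at_top"
    using eventually_ge_at_top[of "max 1 (l e0)"]
  proof eventually_elim
    case (elim \<rho>)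
    then have \<rho>: "\<rho> \<ge> 1" "l e0 \<le> \<rho>" by auto
    then have "[(g0, e0)] \<in> nodes \<rho>" using e0 by (simp add: nodes_def level_def)
    then have "card (nodes \<rho>) > 0" by (auto simp: card_gt_0_iff)
    then have "0 < c * real (card (nodes \<rho>))" using c by simp
    also have "\<dots> \<le> ball_len \<rho>" by (rule ball_len_lower[OF c(2)])
    finally have W: "ball_len \<rho> > 0" .
    have "ball_len \<rho> \<le> C * real (card (nodes (\<rho> + C)))" by (rule ball_len_upper[OF C(2,1)])
    also have "\<dots> \<le> C * (exp (s * (\<rho> + C)) * (((\<rho> + C) / c + 1) * A))"
      using \<rho> C by (intro mult_left_mono cardN) auto
    finally have le: "ball_len \<rho> \<le> exp (s * (\<rho> + C)) * (C * ((\<rho> + C) / c + 1) * A)" by (simp add: mult_ac)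
    have pos: "C * ((\<rho> + C) / c + 1) * A > 0" using C c A \<rho> by (intro mult_pos_pos add_pos_pos) auto
    have "ln (ball_len \<rho>) \<le> ln (exp (s * (\<rho> + C)) * (C * ((\<rho> + C) / c + 1) * A))"
      using W le by (subst ln_le_cancel_iff) auto
    also have "\<dots> = s * (\<rho> + C) + ln (C * ((\<rho> + C) / c + 1) * A)"
      using pos by (subst ln_mult) auto
    finally show ?case using \<rho> by (simp add: divide_right_mono)
  qed
  then have "volume_entropy X base_vertex (V []) l \<le> Limsup at_top (\<lambda>\<rho>. ereal (?B \<rho>))"
    unfolding volume_entropy_def by (rule Limsup_mono)
  also have "\<dots> = ereal s"
  proof (rule lim_imp_Limsup)
    have "(?B \<longlongrightarrow> s) at_top" using c C A by real_asymp
    then show "((\<lambda>\<rho>. ereal (?B \<rho>)) \<longlongrightarrow> ereal s) at_top" by (rule tendsto_ereal)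
  qed simp
  finally show ?thesis .
qed

end

lemma entropy_optimal:
  assumes k: "k > 0"
  shows "volume_entropy X base_vertex (V []) (\<lambda>e. k * optimal_length e) \<le> ereal (1 / k)"
proof (rule entropy_upper_bound[OF length_function_optimal[OF k]])
  fix e assume e: "e \<in> edg X"
  show "transfer (\<lambda>e. k * optimal_length e) (1 / k) (\<lambda>e. sqrt (branching (ter X e))) e = sqrt (branching (ter X e))"
    by (rule optimal_harmonic[OF k e])
  show "1 \<le> sqrt (branching (ter X e))" using branching_ge_2[of "ter X e"] e by simp
qed (use k in simp)

end

section \<open>Minimal volume entropy\<close>

context branching_graph_of_groups
begin

text \<open>
  Every vertex of the tree can serve as the root of the enumeration by normal forms.
\<close>

lemma bass_serre_tree_at:
  assumes "v \<in> verts (bs_tree X b)"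
  obtains root p0 where "branching_bass_serre_tree X root b p0"
    and "v = (root, p0 <#\<^bsub>P\<^esub> vertex_subgroup X root)"
proof -
  obtain root p0 where v: "root \<in> vtx X" "p0 \<in> path_elts X b root"
      "v = (root, p0 <#\<^bsub>P\<^esub> vertex_subgroup X root)"
    using assms by (auto simp: bs_tree_def)
  have "branching_bass_serre_tree X root b p0"
    by unfold_locales (use v in auto)
  then show thesis using that v by blast
qed

lemma (in rooted_bass_serre_tree) V_Nil: "V [] = (root, p0 <#\<^bsub>P\<^esub> vertex_subgroup X root)"
  by (simp add: V_def)

context
  fixes b v
  assumes v: "v \<in> verts (bs_tree X b)"
begin

theorem volume_entropy_ge:
  assumes "length_function X l"
  shows "ereal (minimal_product / gog_volume X l) \<le> volume_entropy X b v l"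
proof -
  obtain root p0 where t: "branching_bass_serre_tree X root b p0" and veq: "v = (root, p0 <#\<^bsub>P\<^esub> vertex_subgroup X root)"
    using bass_serre_tree_at[OF v] .
  interpret t: branching_bass_serre_tree X root b p0 by (rule t)
  show ?thesis using t.entropy_lower_bound[OF assms] by (simp add: t.V_Nil veq)
qed

theorem volume_entropy_eq_imp_optimal:
  assumes "length_function X l" "volume_entropy X b v l = ereal (minimal_product / gog_volume X l)" "f \<in> edg X"
  shows "l f = gog_volume X l / minimal_product * optimal_length f"
proof -
  obtain root p0 where t: "branching_bass_serre_tree X root b p0" and veq: "v = (root, p0 <#\<^bsub>P\<^esub> vertex_subgroup X root)"
    using bass_serre_tree_at[OF v] .
  interpret t: branching_bass_serre_tree X root b p0 by (rule t)
  show ?thesis using t.entropy_rigidity[OF assms(1) _ assms(3)] assms(2) by (simp add: t.V_Nil veq)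
qed

lemma volume_entropy_optimal:
  assumes k: "k > 0"
  shows "volume_entropy X b v (\<lambda>e. k * optimal_length e) = ereal (1 / k)"
proof (rule antisym)
  obtain root p0 where t: "branching_bass_serre_tree X root b p0" and veq: "v = (root, p0 <#\<^bsub>P\<^esub> vertex_subgroup X root)"
    using bass_serre_tree_at[OF v] .
  interpret t: branching_bass_serre_tree X root b p0 by (rule t)
  show "volume_entropy X b v (\<lambda>e. k * optimal_length e) \<le> ereal (1 / k)"
    using t.entropy_optimal[OF k] by (simp add: t.V_Nil veq)
  show "ereal (1 / k) \<le> volume_entropy X b v (\<lambda>e. k * optimal_length e)"
    using volume_entropy_ge[OF length_function_optimal[OF k]] k minimal_product_pos
    by (simp add: volume_optimal)
qed

theorem entropy_minimizing_iff:
  assumes l: "length_function X l"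
  shows "entropy_minimizing X b v l \<longleftrightarrow> volume_entropy X b v l = ereal (minimal_product / gog_volume X l)"
proof
  have V: "gog_volume X l > 0" "minimal_product > 0" using volume_pos[OF l] minimal_product_pos by auto
  let ?k = "gog_volume X l / minimal_product"
  have k: "?k > 0" using V by simp
  assume "entropy_minimizing X b v l"
  moreover have "gog_volume X (\<lambda>e. ?k * optimal_length e) = gog_volume X l"
    using V by (simp only: volume_optimal) simp
  ultimately have "volume_entropy X b v l \<le> volume_entropy X b v (\<lambda>e. ?k * optimal_length e)"
    using length_function_optimal[OF k] unfolding entropy_minimizing_def by blast
  also have "\<dots> = ereal (minimal_product / gog_volume X l)"
    unfolding volume_entropy_optimal[OF k] by simp
  finally show "volume_entropy X b v l = ereal (minimal_product / gog_volume X l)"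
    using volume_entropy_ge[OF l] by (intro antisym)
next
  assume "volume_entropy X b v l = ereal (minimal_product / gog_volume X l)"
  then show "entropy_minimizing X b v l"
    using volume_entropy_ge l unfolding entropy_minimizing_def by metis
qed

end

end

section \<open>Coverings of graphs of groups\<close>

text \<open>
  At a vertex \<open>y\<close> the covering matches the cosets of edge groups, which are the edges of the tree of
  \<open>Y\<close> issuing from a lift of \<open>y\<close>, with those of the tree of \<open>X\<close> at a lift of \<open>\<phi>(y)\<close>.
\<close>

lemma covering_vertex_degree:
  assumes Y: "finite_graph_of_groups Y" and X: "finite_graph_of_groups X"
    and cov: "covering Y X \<phi>" and y: "y \<in> vtx Y"
  shows "vertex_degree Y y = vertex_degree X (vmap \<phi> y)"
proof -
  interpret Y: finite_graph_of_groups Y by (rule Y)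
  interpret X: finite_graph_of_groups X by (rule X)
  let ?O = "{e \<in> edg X. ini X e = vmap \<phi> y}" and ?S = "{f \<in> edg Y. ini Y f = y}"
  have emap: "emap \<phi> ` ?S \<subseteq> ?O"
    using cov by (auto simp: covering_def gog_morph_def graph_morphism_def)
  have fin: "finite (lcosets\<^bsub>vgrp Y y\<^esub> (Y.edge_image f))" if "f \<in> edg Y" "ini Y f = y" for f
  proof -
    interpret G: group "vgrp Y y" using y by (rule Y.vgrp_group)
    have "lcosets\<^bsub>vgrp Y y\<^esub> (Y.edge_image f) \<subseteq> Pow (carrier (vgrp Y y))"
      using G.lcosets_subset_PowG Y.emb_subgroup[OF that(1)] that(2) by simp
    then show ?thesis using Y.vgrp_finite[OF y] by (auto intro: finite_subset)
  qed
  have "vertex_degree Y y = (\<Sum>f\<in>?S. Y.lifts f)" by (rule Y.degree_eq_sum_lifts)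
  also have "\<dots> = (\<Sum>e\<in>?O. \<Sum>f\<in>{f \<in> ?S. emap \<phi> f = e}. Y.lifts f)"
    by (rule sum.group[symmetric, OF _ _ emap]) simp_all
  also have "\<dots> = (\<Sum>e\<in>?O. X.lifts e)"
  proof (rule sum.cong[OF HOL.refl])
    fix e assume e: "e \<in> ?O"
    let ?F = "{f \<in> edg Y. emap \<phi> f = e \<and> ini Y f = y}"
    have F: "{f \<in> ?S. emap \<phi> f = e} = ?F" by auto
    have "card (SIGMA f:?F. lcosets\<^bsub>vgrp Y y\<^esub> (Y.edge_image f)) =
        card (lcosets\<^bsub>vgrp X (vmap \<phi> y)\<^esub> (X.edge_image e))"
      using cov e y unfolding covering_def by (intro bij_betw_same_card[of "fibre_map Y X \<phi> y e"]) auto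
    moreover have "card (SIGMA f:?F. lcosets\<^bsub>vgrp Y y\<^esub> (Y.edge_image f)) =
        (\<Sum>f\<in>?F. card (lcosets\<^bsub>vgrp Y y\<^esub> (Y.edge_image f)))"
      using fin by (intro card_SigmaI) auto
    moreover have "Y.lifts f = real (card (lcosets\<^bsub>vgrp Y y\<^esub> (Y.edge_image f)))" if "f \<in> ?F" for f
      using Y.lifts_eq_index[of f] that by simp
    ultimately show "(\<Sum>f\<in>{f \<in> ?S. emap \<phi> f = e}. Y.lifts f) = X.lifts e"
      using X.lifts_eq_index[of e] e unfolding F by (simp add: of_nat_sum[symmetric] del: of_nat_sum)
  qed
  also have "\<dots> = vertex_degree X (vmap \<phi> y)" by (rule X.degree_eq_sum_lifts[symmetric])
  finally show ?thesis .
qed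

locale branching_covering =
  Y: branching_graph_of_groups Y + X: branching_graph_of_groups X
  for Y :: "('w, 'f, 'c, 'd) graph_of_groups" and X :: "('v, 'e, 'a, 'b) graph_of_groups" +
  fixes \<phi> :: "('w, 'f, 'c, 'd, 'v, 'e, 'a, 'b) gog_morphism" and n :: nat
  assumes sheeted: "sheeted_covering n Y X \<phi>"
begin

lemma cov: "covering Y X \<phi>"
  using sheeted by (simp add: sheeted_covering_def)

lemma emap:
  assumes "f \<in> edg Y"
  shows "emap \<phi> f \<in> edg X" "ini X (emap \<phi> f) = vmap \<phi> (ini Y f)" "ter X (emap \<phi> f) = vmap \<phi> (ter Y f)"
  using cov assms by (auto simp: covering_def gog_morph_def graph_morphism_def)

lemma branching_lift: "y \<in> vtx Y \<Longrightarrow> Y.branching y = X.branching (vmap \<phi> y)"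
  using covering_vertex_degree[OF Y.finite_graph_of_groups_axioms X.finite_graph_of_groups_axioms cov]
  by (simp add: Y.branching_def X.branching_def)

lemma optimal_length_lift: "f \<in> edg Y \<Longrightarrow> Y.optimal_length f = X.optimal_length (emap \<phi> f)"
  by (simp add: Y.optimal_length_def X.optimal_length_def branching_lift emap)

lemma mass_fibre:
  assumes e: "e \<in> edg X"
  shows "(\<Sum>f | f \<in> edg Y \<and> emap \<phi> f = e. Y.mass f) = real n * X.mass e"
proof -
  have "real n = (\<Sum>f | f \<in> edg Y \<and> emap \<phi> f = e. real (order (egrp X e)) * Y.mass f)"
    using sheeted e by (simp add: sheeted_covering_def Y.mass_def)
  also have "\<dots> = real (order (egrp X e)) * (\<Sum>f | f \<in> edg Y \<and> emap \<phi> f = e. Y.mass f)"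
    by (simp add: sum_distrib_left)
  finally show ?thesis using X.order_egrp_pos[OF e] by (simp add: X.mass_def)
qed

lemma minimal_product_lift: "Y.minimal_product = real n * X.minimal_product"
proof -
  let ?q = "\<lambda>e. ln (X.branching (ter X e))"
  have "(\<Sum>f\<in>edg Y. Y.mass f * ln (Y.branching (ter Y f))) = (\<Sum>f\<in>edg Y. Y.mass f * ?q (emap \<phi> f))"
    by (intro sum.cong HOL.refl) (simp add: branching_lift emap)
  also have "\<dots> = (\<Sum>e\<in>edg X. \<Sum>f\<in>{f \<in> edg Y. emap \<phi> f = e}. Y.mass f * ?q (emap \<phi> f))"
    by (rule sum.group[symmetric]) (auto simp: emap)
  also have "\<dots> = (\<Sum>e\<in>edg X. real n * (X.mass e * ?q e))"
  proof (rule sum.cong[OF HOL.refl])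
    fix e assume e: "e \<in> edg X"
    have "(\<Sum>f\<in>{f \<in> edg Y. emap \<phi> f = e}. Y.mass f * ?q (emap \<phi> f)) =
        (\<Sum>f\<in>{f \<in> edg Y. emap \<phi> f = e}. Y.mass f) * ?q e"
      unfolding sum_distrib_right by (intro sum.cong HOL.refl) auto
    then show "(\<Sum>f\<in>{f \<in> edg Y. emap \<phi> f = e}. Y.mass f * ?q (emap \<phi> f)) = real n * (X.mass e * ?q e)"
      using mass_fibre[OF e] by simp
  qed
  finally show ?thesis
    by (simp add: Y.minimal_product_def X.minimal_product_def sum_distrib_left)
qed

end

theorem corollary10:
  fixes X :: "('v, 'e, 'a, 'b) graph_of_groups"
    and Y :: "('w, 'f, 'c, 'd) graph_of_groups"
    and \<phi> :: "('w, 'f, 'c, 'd, 'v, 'e, 'a, 'b) gog_morphism"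
    and n :: nat
    and l\<^sub>0 :: "'e \<Rightarrow> real"
    and l :: "'f \<Rightarrow> real"
  assumes "finite_graph_of_groups Y" and "finite_graph_of_groups X"
    and "sheeted_covering n Y X \<phi>"
    and "\<And>x. x \<in> vtx X \<Longrightarrow> vertex_degree X x \<ge> 3"
    and "\<And>y. y \<in> vtx Y \<Longrightarrow> vertex_degree Y y \<ge> 3"
    and "b \<in> vtx X" and "v \<in> verts (bs_tree X b)"
    and "c \<in> vtx Y" and "w \<in> verts (bs_tree Y c)"
    and "entropy_minimizing X b v l\<^sub>0" and "gog_volume X l\<^sub>0 = 1"
    and "length_function Y l"
  shows "volume_entropy Y c w l * ereal (gog_volume Y l)
           \<ge> ereal (real n) * volume_entropy X b v l\<^sub>0 * ereal (gog_volume X l\<^sub>0) \<and>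
         (volume_entropy Y c w l * ereal (gog_volume Y l)
             = ereal (real n) * volume_entropy X b v l\<^sub>0 * ereal (gog_volume X l\<^sub>0)
           \<longleftrightarrow> entropy_minimizing Y c w l) \<and>
         (volume_entropy Y c w l * ereal (gog_volume Y l)
             = ereal (real n) * volume_entropy X b v l\<^sub>0 * ereal (gog_volume X l\<^sub>0)
           \<longrightarrow> (\<exists>r>0. metric_covering Y l X (\<lambda>e. r * l\<^sub>0 e) \<phi>))"
proof -
  interpret branching_covering Y X \<phi> n
    by (intro branching_covering.intro branching_covering_axioms.intro branching_graph_of_groups.intro
        branching_graph_of_groups_axioms.intro) fact+
  have l0: "length_function X l\<^sub>0" using assms(10) by (simp add: entropy_minimizing_def)
  have VY: "gog_volume Y l > 0" using Y.volume_pos[OF assms(12)] .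
  have hX: "volume_entropy X b v l\<^sub>0 = ereal (X.minimal_product / gog_volume X l\<^sub>0)"
    using X.entropy_minimizing_iff[OF assms(7) l0] assms(10) by blast
  then have rhs: "ereal (real n) * volume_entropy X b v l\<^sub>0 * ereal (gog_volume X l\<^sub>0) = ereal Y.minimal_product"
    using assms(11) by (simp add: minimal_product_lift)
  let ?h = "volume_entropy Y c w l" and ?H = "ereal (Y.minimal_product / gog_volume Y l)"
  have ge: "?H \<le> ?h" by (rule Y.volume_entropy_ge[OF assms(9,12)])
  have eq_iff: "?h * ereal (gog_volume Y l) = ereal Y.minimal_product \<longleftrightarrow> ?h = ?H"
    using VY by (cases ?h) (auto simp: field_simps)
  have "ereal Y.minimal_product = ?H * ereal (gog_volume Y l)" using VY by simp
  also have "\<dots> \<le> ?h * ereal (gog_volume Y l)" using ge VY by (intro ereal_mult_right_mono) auto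
  finally have 1: "ereal Y.minimal_product \<le> ?h * ereal (gog_volume Y l)" .
  have 2: "?h = ?H \<longleftrightarrow> entropy_minimizing Y c w l"
    using Y.entropy_minimizing_iff[OF assms(9,12)] by blast
  have 3: "\<exists>r>0. metric_covering Y l X (\<lambda>e. r * l\<^sub>0 e) \<phi>" if "?h = ?H"
  proof -
    let ?r = "gog_volume Y l / Y.minimal_product * X.minimal_product"
    have "l f = ?r * l\<^sub>0 (emap \<phi> f)" if f: "f \<in> edg Y" for f
      using Y.volume_entropy_eq_imp_optimal[OF assms(9,12) \<open>?h = ?H\<close> f]
        X.volume_entropy_eq_imp_optimal[OF assms(7) l0 hX emap(1)[OF f]]
        X.minimal_product_pos assms(11) optimal_length_lift[OF f]
      by simp
    moreover have "?r > 0" using VY X.minimal_product_pos Y.minimal_product_pos by simp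
    ultimately show ?thesis using cov unfolding metric_covering_def by blast
  qed
  show ?thesis unfolding rhs eq_iff using 1 2 3 by blast
qed

end
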